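(* Let $\mathbb{F}$ be a field of characteristic $2$, let $V$ be a vector space over $\mathbb{F}$ with countable dimension, and let $u\in\mathrm{End}(V)$ be locally finite. Then the following conditions are equivalent: (i) $u$ is the sum of two square-zero endomorphisms of $V$; (ii) $u$ has the exchange property; (iii) for every non-even polynomial $p\in\mathrm{Irr}(\mathbb{F})\setminus\{t\}$ and for every even ordinal $\alpha$, one has $\kappa_\alpha(u,p)=0$.
   Context: "Countable" includes finite. An endomorphism $u$ of $V$ is locally finite if for every $x\in V$ the sequence $(u^k(x))_{k\ge 0}$ is linearly dependent over $\mathbb{F}$. Square-zero: $a^2=0$. Exchange property: there is a splitting $V=V_1\oplus V_2$ into linear subspaces with $u(V_1)\subset V_2$ and $u(V_2)\subset V_1$. $\mathrm{Irr}(\mathbb{F})$ is the set of monic irreducible polynomials of $\mathbb{F}[t]$. A polynomial is even if it is of the form $r(t^2)$ with $r\in\mathbb{F}[t]$ (all coefficients on odd powers of $t$ vanish), non-even otherwise. Every ordinal $\alpha$ is uniquely $\delta+k$ with $\delta$ an ordinal with no predecessor ($0$ or a limit ordinal) and $k\in\mathbb{N}$; $\alpha$ is even when $k$ is even, odd otherwise. Kaplansky invariants: let $u\in\mathrm{End}(V)$ and $p\in\mathrm{Irr}(\mathbb{F})$; $V^u$ denotes $V$ with the $\mathbb{F}[t]$-module structure $r\cdot x=r(u)[x]$. Define submodules by transfinite induction: $p^0(V^u):=V$; $p^{\alpha+1}(V^u):=p(u)\bigl(p^\alpha(V^u)\bigr)$; $p^\alpha(V^u):=\bigcap_{\beta<\alpha}p^\beta(V^u)$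 for limit $\alpha$. For an ordinal $\alpha$, $\kappa_\alpha(u,p)$ is the dimension (a cardinal) over the field $\mathbb{F}[t]/(p)$ of the kernel of the linear map $p^\alpha(V^u)/p^{\alpha+1}(V^u)\to p^{\alpha+1}(V^u)/p^{\alpha+2}(V^u)$ induced by $p(u)$. *)

theory Defs
  imports
    "HOL-Library.Countable_Set"
    "HOL-Library.Infinite_Typeclass"
    "HOL-Computational_Algebra.Computational_Algebra"
    "HOL-Algebra.QuotRing"
    "Jordan_Normal_Form.Missing_VectorSpace"
begin

unbundle cardinal_syntax

text \<open>
  The space \<open>V\<close> is a type \<open>'v\<close> with a scalar multiplication \<open>scale\<close>, as in \<^theory>\<open>HOL.Vector_Spaces\<close>.
  The quotient modules in the Kaplansky invariants have cosets as elements and residue classes of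
  polynomials as scalars, so they are records in the style of \<^theory>\<open>HOL-Algebra.Module\<close>, with
  bases as in \<^theory>\<open>VectorSpace.VectorSpace\<close>.
\<close>

subsection \<open>Endomorphisms of a vector space\<close>

definition countable_dim :: "('f::field \<Rightarrow> 'v::ab_group_add \<Rightarrow> 'v) \<Rightarrow> bool" where
  "countable_dim scale \<longleftrightarrow>
     (\<exists>B. \<not> Modules.module.dependent scale B \<and> Modules.module.span scale B = UNIV \<and> countable B)"

text \<open>Dependence of the \<^emph>\<open>sequence\<close>: a repetition \<open>u\<^sup>j x = u\<^sup>k x\<close> with \<open>j \<noteq> k\<close> counts as dependent,
  so the range of the sequence cannot be used instead.\<close>

definition locally_finite_end :: "('f::field \<Rightarrow> 'v::ab_group_add \<Rightarrow> 'v) \<Rightarrow> ('v \<Rightarrow> 'v) \<Rightarrow> bool" where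
  "locally_finite_end scale u \<longleftrightarrow>
     (\<forall>x. \<exists>(S :: nat set) c. finite S \<and> (\<Sum>k\<in>S. scale (c k) ((u ^^ k) x)) = 0 \<and> (\<exists>k\<in>S. c k \<noteq> 0))"

definition square_zero_end :: "('f::field \<Rightarrow> 'v::ab_group_add \<Rightarrow> 'v) \<Rightarrow> ('v \<Rightarrow> 'v) \<Rightarrow> bool" where
  "square_zero_end scale a \<longleftrightarrow> Vector_Spaces.linear scale scale a \<and> (\<forall>x. a (a x) = 0)"

definition sum_of_two_square_zero :: "('f::field \<Rightarrow> 'v::ab_group_add \<Rightarrow> 'v) \<Rightarrow> ('v \<Rightarrow> 'v) \<Rightarrow> bool" where
  "sum_of_two_square_zero scale u \<longleftrightarrow>
     (\<exists>a b. square_zero_end scale a \<and> square_zero_end scale b \<and> (\<forall>x. u x = a x + b x))"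

definition exchange_property :: "('f::field \<Rightarrow> 'v::ab_group_add \<Rightarrow> 'v) \<Rightarrow> ('v \<Rightarrow> 'v) \<Rightarrow> bool" where
  "exchange_property scale u \<longleftrightarrow>
     (\<exists>V1 V2. Modules.module.subspace scale V1 \<and> Modules.module.subspace scale V2 \<and>
        V1 \<inter> V2 = {0} \<and> (\<forall>x. \<exists>y\<in>V1. \<exists>z\<in>V2. x = y + z) \<and>
        u ` V1 \<subseteq> V2 \<and> u ` V2 \<subseteq> V1)"


subsection \<open>Polynomials\<close>

definition Irr :: "'f::field poly set" where
  "Irr = {p. irreducible p \<and> lead_coeff p = 1}"

definition even_poly :: "'f::field poly \<Rightarrow> bool" where
  "even_poly p \<longleftrightarrow> (\<exists>r. p = pcompose r (monom 1 2))"

definition poly_end :: "('f::field \<Rightarrow> 'v::ab_group_add \<Rightarrow> 'v) \<Rightarrow> 'f poly \<Rightarrow> ('v \<Rightarrow> 'v) \<Rightarrow> 'v \<Rightarrow> 'v" where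
  "poly_end scale p u x = (\<Sum>i\<le>degree p. scale (coeff p i) ((u ^^ i) x))"


subsection \<open>Ordinals\<close>

text \<open>
  An ordinal is represented by a well-order \<open>r\<close>, a relation satisfying \<^const>\<open>Well_order\<close>, whose
  field may be any subset of its type. The ordinals below that of \<open>r\<close> are those of
  \<open>ord_below r a\<close> for \<open>a \<in> Field r\<close>, and \<open>r\<close> is the successor of \<open>ord_below r m\<close> if \<open>m\<close> is its
  last element. Since a type \<open>'o\<close> carries only the ordinals of cardinality at most \<open>|'o|\<close>,
  "for every ordinal" means: for every well-order over \<open>'o\<close>, where \<open>'o\<close> is an arbitrary infinite
  type. Already \<open>nat\<close> carries all countable ordinals.
\<close>

definition ord_below :: "'o rel \<Rightarrow> 'o \<Rightarrow> 'o rel" where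
  "ord_below r a = Restr r (underS r a)"

definition is_last :: "'o rel \<Rightarrow> 'o \<Rightarrow> bool" where
  "is_last r m \<longleftrightarrow> m \<in> Field r \<and> (\<forall>a\<in>Field r. (a, m) \<in> r)"

text \<open>\<open>r = \<delta> + k\<close> where \<open>\<delta>\<close> is the restriction of \<open>r\<close> to an initial segment \<open>D\<close>.\<close>

definition even_ordinal :: "'o rel \<Rightarrow> bool" where
  "even_ordinal r \<longleftrightarrow>
     (\<exists>D. ofilter r D \<and> (\<nexists>m. is_last (Restr r D) m) \<and>
          finite (Field r - D) \<and> even (card (Field r - D)))"

lemma ord_below_ordLess:
  assumes "Well_order r" "a \<in> Field r"
  shows "ord_below r a <o r"
  using assms unfolding ord_below_def by (intro underS_Restr_ordLess) auto

lemma is_last_the: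
  assumes "Well_order r" "\<exists>m. is_last r m"
  shows "(THE m. is_last r m) \<in> Field r"
proof -
  have "antisym r"
    using assms(1) by (simp add: order_on_defs)
  then have "\<exists>!m. is_last r m"
    using assms(2) unfolding is_last_def antisym_def by blast
  then show ?thesis
    using theI'[of "is_last r"] by (simp add: is_last_def)
qed

text \<open>\<open>transfinite_image f \<alpha>\<close> is \<open>f\<^sup>\<alpha>(V)\<close>: the equations are those of \<open>p\<^sup>\<alpha>(V\<^sup>u)\<close> with \<open>f = p(u)\<close>. The value
  on relations that are not well-orders is irrelevant.\<close>

function transfinite_image :: "('v \<Rightarrow> 'v) \<Rightarrow> 'o rel \<Rightarrow> 'v set" where
  "transfinite_image f r =
     (if \<not> Well_order r \<or> r = {} then UNIV
      else if \<exists>m. is_last r m then f ` transfinite_image f (ord_below r (THE m. is_last r m))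
      else (\<Inter>a\<in>Field r. transfinite_image f (ord_below r a)))"
  by pat_completeness auto
termination
proof (relation "inv_image ordLess snd")
  show "wf (inv_image ordLess snd)"
    by (intro wf_inv_image wf_ordLess)
qed (auto intro!: ord_below_ordLess is_last_the)

declare transfinite_image.simps [simp del]


subsection \<open>Kaplansky invariants\<close>

definition poly_ring :: "'f::field poly ring" where
  "poly_ring = \<lparr>carrier = UNIV, mult = (*), one = 1, zero = 0, add = (+)\<rparr>"

text \<open>The fields \<^const>\<open>mult\<close> and \<^const>\<open>one\<close> of a module record carry no meaning.\<close>

definition end_module ::
  "('f::field \<Rightarrow> 'v::ab_group_add \<Rightarrow> 'v) \<Rightarrow> ('v \<Rightarrow> 'v) \<Rightarrow> ('f poly, 'v) module" where
  "end_module scale u =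
     \<lparr>carrier = UNIV, mult = (\<lambda>_ _. 0), one = 0, zero = 0, add = (+),
      smult = (\<lambda>r. poly_end scale r u)\<rparr>"

text \<open>Quotient of a module by a submodule \<open>N\<close>, on the model of \<^const>\<open>FactRing\<close>: the cosets
  united in \<open>smult\<close> all coincide.\<close>

definition quot_module :: "('r, 'a) module \<Rightarrow> 'a set \<Rightarrow> ('r, 'a set) module" where
  "quot_module M N =
     \<lparr>carrier = a_rcosets\<^bsub>M\<^esub> N, mult = (\<lambda>_ _. N), one = N, zero = N, add = set_add M,
      smult = (\<lambda>r X. \<Union>x\<in>X. N +>\<^bsub>M\<^esub> (r \<odot>\<^bsub>M\<^esub> x))\<rparr>"

text \<open>The quotient \<open>W / p(u)(W)\<close> for a submodule \<open>W\<close> of \<open>V\<^sup>u\<close>.\<close>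

definition layer ::
  "('f::field \<Rightarrow> 'v::ab_group_add \<Rightarrow> 'v) \<Rightarrow> ('v \<Rightarrow> 'v) \<Rightarrow> 'f poly \<Rightarrow> 'v set \<Rightarrow> ('f poly, 'v set) module" where
  "layer scale u p W =
     quot_module ((end_module scale u)\<lparr>carrier := W\<rparr>) (poly_end scale p u ` W)"

text \<open>The map \<open>W / p(u)(W) \<rightarrow> p(u)(W) / p(u)\<^sup>2(W)\<close> induced by \<open>p(u)\<close>, given by
  \<open>x + p(u)(W) \<mapsto> p(u)(x) + p(u)\<^sup>2(W)\<close>.\<close>

definition layer_map ::
  "('f::field \<Rightarrow> 'v::ab_group_add \<Rightarrow> 'v) \<Rightarrow> ('v \<Rightarrow> 'v) \<Rightarrow> 'f poly \<Rightarrow> 'v set \<Rightarrow> 'v set \<Rightarrow> 'v set" where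
  "layer_map scale u p W X =
     (\<Union>x\<in>X. (poly_end scale p u ` poly_end scale p u ` W) +>\<^bsub>end_module scale u\<^esub> poly_end scale p u x)"

definition residue_field :: "'f::field poly \<Rightarrow> 'f poly set ring" where
  "residue_field p = poly_ring Quot (PIdl\<^bsub>poly_ring\<^esub> p)"

text \<open>The kernel of \<open>layer_map\<close> as a vector space over \<open>F[t]/(p)\<close>. Since \<open>p\<close> annihilates the
  layer, all representatives \<open>r\<close> of a residue class \<open>C\<close> act in the same way.\<close>

definition layer_kernel ::
  "('f::field \<Rightarrow> 'v::ab_group_add \<Rightarrow> 'v) \<Rightarrow> ('v \<Rightarrow> 'v) \<Rightarrow> 'f poly \<Rightarrow> 'v set \<Rightarrow> ('f poly set, 'v set) module" where
  "layer_kernel scale u p W =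
     (let L = layer scale u p W; L' = layer scale u p (poly_end scale p u ` W) in
      \<lparr>carrier = a_kernel L L' (layer_map scale u p W),
       mult = mult L, one = one L, zero = zero L, add = add L,
       smult = (\<lambda>C X. \<Union>r\<in>C. r \<odot>\<^bsub>L\<^esub> X)\<rparr>)"

text \<open>Cardinals are represented as in \<^theory>\<open>HOL.BNF_Cardinal_Order_Relation\<close>: they are compared
  by \<open>=o\<close>. (\<^const>\<open>vectorspace.dim\<close> is a natural number and only meaningful in finite dimension.)\<close>

definition cardinal_dim :: "('k, 'm) ring_scheme \<Rightarrow> ('k, 'a, 'n) module_scheme \<Rightarrow> 'a rel" where
  "cardinal_dim K M = card_of (SOME B. vectorspace.basis K M B)"

definition kaplansky_invariant ::
  "('f::field \<Rightarrow> 'v::ab_group_add \<Rightarrow> 'v) \<Rightarrow> 'o rel \<Rightarrow> ('v \<Rightarrow> 'v) \<Rightarrow> 'f poly \<Rightarrow> 'v set rel" where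
  "kaplansky_invariant scale \<alpha> u p =
     cardinal_dim (residue_field p)
       (layer_kernel scale u p (transfinite_image (poly_end scale p u) \<alpha>))"

end

theory Submission
  imports Defs
begin

text \<open>
  For \<open>g = p(u)\<close> the submodules \<open>p\<^sup>\<alpha>(V)\<close> are the members of the least family of subsets closed under
  images by \<open>g\<close> and intersections, and those with \<open>\<alpha>\<close> even are, up to repetition, the members of the
  family of \<open>g\<^sup>2\<close>. So condition (iii) says that \<open>ker p(u) \<inter> C \<subseteq> p(u)(C)\<close> for all \<open>C\<close> in the family of
  \<open>p(u)\<^sup>2\<close>, and most of the argument needs no ordinals.

  (i) implies (iii): if \<open>u = a + b\<close> with \<open>a\<^sup>2 = b\<^sup>2 = 0\<close>, then \<open>a\<close> commutes with \<open>p(u)\<^sup>2\<close>, hence leaves \<open>C\<close>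
  invariant, and \<open>p(u)(a x) = p'(u) u\<^sup>2 x\<close> for \<open>x \<in> ker p(u)\<close>, where \<open>p' t\<^sup>2\<close> is invertible modulo \<open>p\<close>.

  (iii) implies (ii): it suffices to split each primary component. Such a splitting is the union of
  a sequence of finite-dimensional partial ones, which are kept compatible with the chain of
  submodules and enlarged step by step, as in the proof of Ulm's theorem. If \<open>p\<close> is even or \<open>p = t\<close>,
  then \<open>p(u)\<close> is homogeneous for the grading by the two summands, and the elements that are adjoined
  are homogeneous. Otherwise the partial splittings are \<open>T \<oplus> u(T)\<close> for modules \<open>T\<close> over the even
  polynomials, and (iii) yields the generators that are adjoined to \<open>T\<close>.
\<close>

subsection \<open>Iterated images of a map\<close>

text \<open>In characteristic 2 the square of every polynomial is even and has derivative zero. This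
  is the source of the parity of ordinals: the square-zero summands in (i) and the splittings for
  non-even p are compatible with the chain of p(u)^2, and need not be with that of p(u). The
  obstacle in enlarging a partial splitting S is that a new vector must lie as deep in the chain as
  its coset modulo S permits. Such a vector exists because S, being finite-dimensional, has a least
  trace on every part of the chain. For homogeneous p the image of that vector need not be
  homogeneous; its two parts are treated separately, and a fixed finite-dimensional submodule that
  contains all images bounds the recursion. For the other p, the odd part of p is t times an even
  polynomial invertible modulo p, which lets p(T) replace u(T); condition (iii) turns a vector z
  with p(u) z in T into some w with p(u) w = z. Countable dimension enters twice: finite-dimensional
  stages exhaust a primary component, and only countably many members lie above a given one, so
  every infinite type can index them.\<close>

inductive_set iterated_images :: "('a \<Rightarrow> 'a) \<Rightarrow> 'a set set" for g where
  image: "X \<in> iterated_images g \<Longrightarrow> g ` X \<in> iterated_images g"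
| Inter: "(\<And>X. X \<in> M \<Longrightarrow> X \<in> iterated_images g) \<Longrightarrow> \<Inter>M \<in> iterated_images g"

lemma UNIV_in_iterated_images [simp]: "UNIV \<in> iterated_images g"
  using iterated_images.Inter[of "{}" g] by simp

lemma image_subset_iterated_images: "X \<in> iterated_images g \<Longrightarrow> g ` X \<subseteq> X"
  by (induction rule: iterated_images.induct) blast+

text \<open>The second assumption makes \<open>C\<close> an extreme point as in the Bourbaki-Witt
  argument, with inclusion reversed. In the induction on \<open>D\<close>, an image step can leave
  the region above \<open>C\<close> only from \<open>C\<close> itself, and then it lands on the
  image of \<open>C\<close>.\<close>

lemma iterated_images_extreme_cases:
  assumes "D \<in> iterated_images g"
    and "\<And>X. X \<in> iterated_images g \<Longrightarrow> C \<subset> X \<Longrightarrow> C \<subseteq> g ` X"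
  shows "C \<subseteq> D \<or> D \<subseteq> g ` C"
  using assms(1)
proof (induction rule: iterated_images.induct)
  case (image X)
  show ?case
  proof (cases "C \<subset> X")
    case True
    then show ?thesis
      using assms(2) image.hyps by blast
  next
    case False
    then have "C = X \<or> X \<subseteq> g ` C"
      using image.IH by blast
    then show ?thesis
      using image_subset_iterated_images[OF image.hyps] by auto
  qed
next
  case (Inter M)
  then show ?case by blast
qed

text \<open>Zermelo's argument: each member dominates the image of every strictly larger member, which makes the family a
  chain.\<close>

lemma iterated_images_extreme:
  assumes "C \<in> iterated_images g" "X \<in> iterated_images g" "C \<subset> X"
  shows "C \<subseteq> g ` X"
  using assms
proof (induction arbitrary: X rule: iterated_images.induct)
  case (image C)
  have "C \<subseteq> X \<or> X \<subseteq> g ` C"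
    using iterated_images_extreme_cases[OF image.prems(1)] image.IH by blast
  then show ?case
    using image.prems by blast
next
  case (Inter M)
  have cmp: "Y \<subseteq> D \<or> D \<subseteq> g ` Y" if "Y \<in> M" "D \<in> iterated_images g" for Y D
    using iterated_images_extreme_cases[OF that(2)] Inter.IH[OF that(1)] by blast
  obtain Y where Y: "Y \<in> M" "\<not> X \<subseteq> Y"
    using Inter.prems by blast
  then have "Y \<subseteq> X"
    using cmp[OF Y(1) Inter.prems(1)] image_subset_iterated_images[OF Inter.hyps[OF Y(1)]] by blast
  with Y have "Y \<subset> X" by blast
  then have "Y \<subseteq> g ` X"
    using Inter.IH[OF Y(1) Inter.prems(1)] by blast
  with Y show ?case by blast
qed

lemma iterated_images_cases:
  assumes "C \<in> iterated_images g" "D \<in> iterated_images g"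
  shows "C \<subseteq> D \<or> D \<subseteq> g ` C"
  using iterated_images_extreme_cases[OF assms(2)] iterated_images_extreme[OF assms(1)] by blast

lemma iterated_images_linear:
  assumes "C \<in> iterated_images g" "D \<in> iterated_images g"
  shows "C \<subseteq> D \<or> D \<subseteq> C"
  using iterated_images_cases[OF assms] image_subset_iterated_images[OF assms(1)] by blast

text \<open>A fixed set survives every image and every intersection, so the chain stops at a fixed
  member.\<close>

lemma iterated_images_fixed_least:
  assumes "g ` U = U" "C \<in> iterated_images g"
  shows "U \<subseteq> C"
  using assms(2)
proof (induction rule: iterated_images.induct)
  case (image X)
  then have "g ` U \<subseteq> g ` X" by blast
  with assms(1) show ?case by simp
qed blast

text \<open>Well-ordering by reverse inclusion, the substitute for transfinite induction. If the
  least member \<open>U\<close> that contains all of \<open>M\<close> were not in \<open>M\<close>,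
  every \<open>X\<close> in \<open>M\<close> would lie in the image of \<open>U\<close>; then
  \<open>U\<close> would be fixed, hence contained in every member.\<close>

lemma iterated_images_greatest:
  assumes "M \<subseteq> iterated_images g" "M \<noteq> {}"
  obtains U where "U \<in> M" "\<And>X. X \<in> M \<Longrightarrow> X \<subseteq> U"
proof -
  define U where "U = \<Inter>{D \<in> iterated_images g. \<forall>X\<in>M. X \<subseteq> D}"
  have UI: "U \<in> iterated_images g"
    unfolding U_def by (rule iterated_images.Inter) blast
  have ub: "X \<subseteq> U" if "X \<in> M" for X
    unfolding U_def using that by blast
  have "U \<in> M"
  proof (rule ccontr)
    assume "U \<notin> M"
    then have "X \<subset> U" if "X \<in> M" for X
      using ub[OF that] that by blast
    then have gu: "X \<subseteq> g ` U" if "X \<in> M" for X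
      using iterated_images_extreme[OF _ UI, of X] that assms(1) by blast
    then have "U \<subseteq> g ` U"
      using iterated_images.image[OF UI] by (auto simp: U_def)
    then have fixed: "g ` U = U"
      using image_subset_iterated_images[OF UI] by blast
    obtain X where "X \<in> M" using assms(2) by blast
    then show False
      using iterated_images_fixed_least[OF fixed, of X] ub[of X] assms(1) \<open>U \<notin> M\<close>
      by (metis subset_antisym subsetD)
  qed
  then show thesis using ub that by blast
qed

lemma iterated_images_funpow2:
  "C \<in> iterated_images (\<lambda>x. g (g x)) \<Longrightarrow> C \<in> iterated_images g"
proof (induction rule: iterated_images.induct)
  case (image X)
  have "(\<lambda>x. g (g x)) ` X = g ` g ` X" by blast
  then show ?case using image.IH by (simp add: iterated_images.image)
next
  case (Inter M)
  then show ?case by (blast intro: iterated_images.Inter)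
qed

subsection \<open>The polynomial action of an endomorphism\<close>

locale endomorphism = vector_space scale
  for scale :: "'f::field \<Rightarrow> 'v::ab_group_add \<Rightarrow> 'v" +
  fixes u :: "'v \<Rightarrow> 'v"
  assumes linear_u: "Vector_Spaces.linear scale scale u"
begin

sublocale u: Vector_Spaces.linear scale scale u
  by (rule linear_u)

text \<open>The scalar comes first and the vector last, so that \<open>act\<close> is a module
  structure over the polynomials in the sense of \<open>Modules.module\<close>.\<close>

definition act :: "'f poly \<Rightarrow> 'v \<Rightarrow> 'v"  (infixr "\<cdot>" 75)
  where "f \<cdot> x = poly_end scale f u x"

lemma act_eq_sum:
  assumes "degree f \<le> n"
  shows "f \<cdot> x = (\<Sum>i\<le>n. scale (coeff f i) ((u ^^ i) x))"
  unfolding act_def poly_end_def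
  by (rule sum.mono_neutral_left) (use assms in \<open>auto simp: coeff_eq_0\<close>)

lemma act_0 [simp]: "0 \<cdot> x = 0"
  by (simp add: act_def poly_end_def)

lemma act_add_poly: "(f + g) \<cdot> x = f \<cdot> x + g \<cdot> x"
proof -
  let ?n = "max (degree f) (degree g)"
  have "degree (f + g) \<le> ?n" by (rule degree_add_le) auto
  then show ?thesis
    by (simp add: act_eq_sum[of _ ?n] scale_left_distrib sum.distrib)
qed

lemma act_smult_poly: "Polynomial.smult c f \<cdot> x = scale c (f \<cdot> x)"
  using act_eq_sum[of "Polynomial.smult c f" "degree f" x] act_eq_sum[of f "degree f" x]
  by (simp add: scale_sum_right degree_smult_le)

lemma act_pCons: "pCons a f \<cdot> x = scale a x + u (f \<cdot> x)"
proof -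
  have "pCons a f \<cdot> x = (\<Sum>i\<le>Suc (degree f). scale (coeff (pCons a f) i) ((u ^^ i) x))"
    by (rule act_eq_sum) (simp add: degree_pCons_le)
  also have "\<dots> = scale a x + (\<Sum>i\<le>degree f. scale (coeff f i) (u ((u ^^ i) x)))"
    by (simp add: sum.atMost_Suc_shift del: sum.atMost_Suc)
  also have "(\<Sum>i\<le>degree f. scale (coeff f i) (u ((u ^^ i) x))) = u (f \<cdot> x)"
    by (simp add: act_eq_sum[of f "degree f"] u.sum u.scale)
  finally show ?thesis .
qed

lemma act_const: "[:c:] \<cdot> x = scale c x"
  by (simp add: act_pCons u.zero)

lemma act_add: "f \<cdot> (x + y) = f \<cdot> x + f \<cdot> y"
  by (induction f) (auto simp: act_pCons u.add scale_right_distrib u.zero)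

lemma act_scale: "f \<cdot> scale c x = scale c (f \<cdot> x)"
  by (induction f) (auto simp: act_pCons u.scale scale_right_distrib u.zero scale_left_commute)

lemma act_mult: "(f * g) \<cdot> x = f \<cdot> g \<cdot> x"
  by (induction f) (auto simp: mult_pCons_left act_add_poly act_smult_poly act_pCons u.zero)

lemma act_1: "1 \<cdot> x = x"
  by (simp add: one_pCons act_const del: pCons_one)

sublocale act: Modules.module act
  by unfold_locales (auto simp: act_add act_add_poly act_mult act_1)

lemma act_linear: "Vector_Spaces.linear scale scale (act f)"
  by unfold_locales (auto simp: act_add act_scale)

lemma act_X: "[:0, 1:] \<cdot> x = u x"
  by (simp add: act_pCons u.zero)

lemma act_u: "f \<cdot> u x = u (f \<cdot> x)"
  using act.scale_left_commute[of f "[:0, 1:]" x] by (simp only: act_X)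

lemma act_subspace_imp_subspace: "act.subspace W \<Longrightarrow> subspace W"
  unfolding act.subspace_def subspace_def by (metis act_const)

lemma act_subspace_u: "act.subspace W \<Longrightarrow> x \<in> W \<Longrightarrow> u x \<in> W"
  unfolding act.subspace_def by (metis act_X)

lemma act_subspaceI:
  assumes "subspace W" "\<And>x. x \<in> W \<Longrightarrow> u x \<in> W"
  shows "act.subspace W"
proof (rule act.subspaceI)
  show "f \<cdot> x \<in> W" if "x \<in> W" for f x
    using that by (induction f) (auto simp: act_pCons subspace_0 subspace_add subspace_scale assms)
qed (use assms in \<open>auto simp: subspace_0 subspace_add\<close>)

lemma act_subspace_image: "act.subspace W \<Longrightarrow> act.subspace (act f ` W)"
  unfolding act.subspace_def
  by safe (metis act.scale_zero_right image_eqI, metis act_add image_eqI,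
    metis act.scale_left_commute image_eqI)

lemma act_subspace_iterated_images: "W \<in> iterated_images (act f) \<Longrightarrow> act.subspace W"
  by (induction rule: iterated_images.induct) (simp_all add: act_subspace_image act.subspace_Inter)

end

subsection \<open>Comaximal polynomials\<close>

text \<open>The Bezout form is used because its coefficients can be applied to vectors.\<close>

definition comaximal :: "'a::comm_ring_1 \<Rightarrow> 'a \<Rightarrow> bool"
  where "comaximal a b \<longleftrightarrow> (\<exists>k l. k * a + l * b = 1)"

lemma comaximal_sym: "comaximal a b \<Longrightarrow> comaximal b a"
  unfolding comaximal_def by (metis add.commute)

lemma comaximal_mult:
  assumes "comaximal a c" "comaximal b c"
  shows "comaximal (a * b) c"
proof -
  obtain k l m n where *: "k * a + l * c = 1" "m * b + n * c = 1"
    using assms unfolding comaximal_def by blast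
  have "k * m * (a * b) + (k * a * n + l) * c = k * a * (m * b + n * c) + l * c"
    by (simp add: algebra_simps)
  then have "k * m * (a * b) + (k * a * n + l) * c = 1"
    by (simp add: *)
  then show ?thesis unfolding comaximal_def by blast
qed

lemma comaximal_power:
  assumes "comaximal a c"
  shows "comaximal (a ^ n) c"
proof (induction n)
  case 0
  have "1 * 1 + 0 * c = 1" by simp
  then show ?case unfolding comaximal_def by (metis power_0)
next
  case (Suc n)
  then show ?case using comaximal_mult[OF assms] by simp
qed

lemma comaximal_dvd_mult:
  assumes "comaximal a c" and dvd: "c dvd a * b"
  shows "c dvd b"
proof -
  obtain k l where *: "k * a + l * c = 1"
    using assms(1) unfolding comaximal_def by blast
  have "b = k * (a * b) + l * b * c"
    using arg_cong[OF *, of "\<lambda>y. y * b"] by (simp add: algebra_simps)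
  moreover have "c dvd k * (a * b) + l * b * c"
    by (intro dvd_add dvd_mult[OF dvd] dvd_triv_right)
  ultimately show ?thesis by simp
qed

text \<open>A nonzero element of least degree generates the ideal \<open>(f, p)\<close>.\<close>

lemma irreducible_comaximal:
  fixes p f :: "'a::field poly"
  assumes "irreducible p" "\<not> p dvd f"
  shows "comaximal f p"
proof -
  define I where "I = {k * f + l * p | k l. True}"
  have pI: "p \<in> I" "f \<in> I"
    unfolding I_def by (simp_all, metis add_0 mult_1 mult_zero_left, metis add.right_neutral mult_1 mult_zero_left)
  have addI: "a + b \<in> I" if "a \<in> I" "b \<in> I" for a b
  proof -
    obtain k l k' l' where "a = k * f + l * p" "b = k' * f + l' * p"
      using \<open>a \<in> I\<close> \<open>b \<in> I\<close> unfolding I_def by blast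
    then have "a + b = (k + k') * f + (l + l') * p" by (simp add: algebra_simps)
    then show ?thesis unfolding I_def by blast
  qed
  have multI: "c * a \<in> I" if a: "a \<in> I" for a c
  proof -
    obtain k l where "a = k * f + l * p"
      using a unfolding I_def by blast
    then have "c * a = (c * k) * f + (c * l) * p" by (simp add: algebra_simps)
    then show ?thesis unfolding I_def by blast
  qed
  have "p \<noteq> 0" using assms(1) by auto
  then obtain d where d: "d \<in> I" "d \<noteq> 0" and least: "\<And>a. a \<in> I \<Longrightarrow> a \<noteq> 0 \<Longrightarrow> degree d \<le> degree a"
    using ex_has_least_nat[of "\<lambda>a. a \<in> I \<and> a \<noteq> 0" p degree] pI(1) by blast
  have "d dvd a" if "a \<in> I" for a
  proof -
    have "a mod d = a + (- (a div d)) * d"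
      by (simp add: minus_div_mult_eq_mod[symmetric])
    then have "a mod d \<in> I"
      using addI[OF that multI[OF d(1)]] by metis
    then have "a mod d = 0"
      using least degree_mod_less[OF d(2), of a] by (metis not_le)
    then show ?thesis by auto
  qed
  then have dvd: "d dvd p" "d dvd f" using pI by auto
  have "\<not> p dvd d" using dvd(2) assms(2) dvd_trans by blast
  then have "is_unit d"
    using assms(1) dvd(1) unfolding irreducible_def by (metis dvd_def dvd_mult_unit_iff dvd_refl)
  then obtain c where "1 = d * c" by (auto elim: dvdE)
  then have "1 \<in> I" using multI[OF d(1), of c] by (simp add: mult.commute)
  then obtain k l where "1 = k * f + l * p" unfolding I_def by blast
  then show ?thesis unfolding comaximal_def by metis
qed

subsection \<open>Vanishing of Kaplansky invariants\<close>

text \<open>The normal form of cosets to which all operations of the quotient records are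
  reduced.\<close>

definition translate :: "'a::ab_group_add set \<Rightarrow> 'a \<Rightarrow> 'a set"
  where "translate N x = (\<lambda>n. n + x) ` N"

lemma mem_translate: "y \<in> translate N x \<longleftrightarrow> y - x \<in> N"
  unfolding translate_def by (metis (no_types, lifting) add_diff_cancel_right' diff_add_cancel imageE image_eqI)

text \<open>\<open>cardinal_dim\<close> picks a basis by choice, so its value is meaningful only
  once a basis is known to exist in every dimension. Zorn's lemma provides one.\<close>

lemma (in vectorspace) ex_basis: "\<exists>B. basis B"
proof -
  let ?A = "{S. S \<subseteq> carrier V \<and> lin_indpt S}"
  have "\<exists>M\<in>?A. \<forall>X\<in>?A. M \<subseteq> X \<longrightarrow> X = M"
  proof (rule subset_Zorn')
    fix C assume C: "subset.chain ?A C"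
    have "lin_indpt (\<Union>C)"
    proof
      assume "lin_dep (\<Union>C)"
      then obtain A a v where A: "finite A" "A \<subseteq> \<Union>C" "a \<in> A \<rightarrow> carrier K" "lincomb a A = \<zero>\<^bsub>V\<^esub>" "v \<in> A" "a v \<noteq> \<zero>\<^bsub>K\<^esub>"
        unfolding lin_dep_def by blast
      then have "C \<noteq> {}" by blast
      then obtain S where S: "S \<in> C" "A \<subseteq> S"
        using finite_subset_Union_chain[OF A(1,2) _ C] by blast
      then have "lin_dep S"
        unfolding lin_dep_def using A by blast
      then show False
        using C S(1) unfolding subset.chain_def by blast
    qed
    then show "\<Union>C \<in> ?A"
      using C unfolding subset.chain_def by blast
  qed
  then obtain M where "M \<in> ?A" "\<forall>X\<in>?A. M \<subseteq> X \<longrightarrow> X = M" by blast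
  then have "maximal M (\<lambda>S. S \<subseteq> carrier V \<and> lin_indpt S)"
    unfolding maximal_def by blast
  then show ?thesis using max_li_is_basis by blast
qed

lemma (in vectorspace) cardinal_dim_eq_czero_iff:
  "cardinal_dim K V =o (czero :: 'z rel) \<longleftrightarrow> carrier V = {\<zero>\<^bsub>V\<^esub>}"
proof -
  define B where "B = (SOME B. basis B)"
  have B: "basis B"
    unfolding B_def by (rule someI_ex[OF ex_basis])
  have nt: "carrier K \<noteq> {\<zero>\<^bsub>K\<^esub>}"
    using one_not_zero one_closed by blast
  have "B = {} \<longleftrightarrow> carrier V = {\<zero>\<^bsub>V\<^esub>}"
  proof
    assume "B = {}"
    then have "carrier V = span {}"
      using B unfolding basis_def by simp
    also have "\<dots> = {\<zero>\<^bsub>V\<^esub>}"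
      unfolding span_def lincomb_def by auto
    finally show "carrier V = {\<zero>\<^bsub>V\<^esub>}" .
  next
    assume *: "carrier V = {\<zero>\<^bsub>V\<^esub>}"
    have "\<zero>\<^bsub>V\<^esub> \<notin> B"
      using zero_nin_lin_indpt[of B] B nt unfolding basis_def by blast
    then show "B = {}"
      using B * unfolding basis_def by auto
  qed
  then show ?thesis
    unfolding cardinal_dim_def B_def[symmetric] by (simp add: card_of_ordIso_czero_iff_empty)
qed

section \<open>The residue field of an irreducible polynomial\<close>

lemma poly_ring_simps [simp]:
  "carrier poly_ring = UNIV" "mult poly_ring = (*)" "one poly_ring = 1" "zero poly_ring = 0"
  "add poly_ring = (+)"
  by (simp_all add: poly_ring_def)

lemma cring_poly_ring: "cring (poly_ring :: 'f::field poly ring)"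
proof (rule cringI)
  show "abelian_group (poly_ring :: 'f poly ring)"
  proof (rule abelian_groupI)
    fix x :: "'f poly"
    show "\<exists>y\<in>carrier poly_ring. y \<oplus>\<^bsub>poly_ring\<^esub> x = \<zero>\<^bsub>poly_ring\<^esub>"
      by (rule bexI[of _ "- x"]) auto
  qed (auto simp: add_ac)
  show "comm_monoid (poly_ring :: 'f poly ring)"
    by (rule comm_monoidI) (auto simp: mult_ac)
qed (auto simp: algebra_simps)

lemma ideal_PIdl_poly_ring: "ideal (PIdl\<^bsub>poly_ring\<^esub> (p :: 'f::field poly)) poly_ring"
  by (rule cring.cgenideal_ideal[OF cring_poly_ring]) simp

lemma mem_PIdl_poly_ring: "f \<in> PIdl\<^bsub>poly_ring\<^esub> p \<longleftrightarrow> (p :: 'f::field poly) dvd f"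
  unfolding cgenideal_def by (auto simp: dvd_def mult.commute)

lemma field_residue_field:
  fixes p :: "'f::field poly"
  assumes "irreducible p"
  shows "field (residue_field p)"
  unfolding residue_field_def
proof (rule maximalideal.quotient_is_field[OF maximalidealI cring_poly_ring])
  show "carrier poly_ring \<noteq> PIdl\<^bsub>poly_ring\<^esub> p"
    using assms mem_PIdl_poly_ring[of 1 p] by (auto simp: irreducible_def)
  fix J assume J: "ideal J poly_ring" "PIdl\<^bsub>poly_ring\<^esub> p \<subseteq> J"
  have "J = UNIV" if f: "f \<in> J" "\<not> p dvd f" for f
  proof -
    obtain k l where kl: "k * f + l * p = 1"
      using irreducible_comaximal[OF assms f(2)] unfolding comaximal_def by blast
    interpret J: ideal J poly_ring by (rule J(1))
    have "l * p \<in> J"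
      using J(2) mem_PIdl_poly_ring[of "l * p" p] by auto
    moreover have "k * f \<in> J"
      using J.I_l_closed[OF f(1), of k] by simp
    ultimately have "1 \<in> J"
      using additive_subgroup.a_closed[OF J.additive_subgroup_axioms, of "k * f" "l * p"] kl by simp
    then show ?thesis
      using J.one_imp_carrier by simp
  qed
  then show "J = PIdl\<^bsub>poly_ring\<^esub> p \<or> J = carrier poly_ring"
    using J(2) by (metis poly_ring_simps(1) mem_PIdl_poly_ring subsetI subset_antisym)
qed (rule ideal_PIdl_poly_ring)

definition residue :: "'f::field poly \<Rightarrow> 'f poly \<Rightarrow> 'f poly set"
  where "residue p r = {s. p dvd s - r}"

lemma a_r_coset_PIdl: "PIdl\<^bsub>poly_ring\<^esub> p +>\<^bsub>poly_ring\<^esub> r = residue p r"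
proof -
  have "s \<in> PIdl\<^bsub>poly_ring\<^esub> p +>\<^bsub>poly_ring\<^esub> r \<longleftrightarrow> s - r \<in> PIdl\<^bsub>poly_ring\<^esub> p" for s
    unfolding a_r_coset_def' by (auto intro: bexI[of _ "s - r"])
  then show ?thesis
    unfolding residue_def by (auto simp: mem_PIdl_poly_ring)
qed

lemma residue_field_simps:
  "carrier (residue_field p) = range (residue p)"
  "one (residue_field p) = residue p 1"
  "mult (residue_field p) (residue p r) (residue p s) = residue p (r * s)"
  "add (residue_field p) (residue p r) (residue p s) = residue p (r + s)"
proof -
  interpret ideal "PIdl\<^bsub>poly_ring\<^esub> p" poly_ring by (rule ideal_PIdl_poly_ring)
  show "carrier (residue_field p) = range (residue p)" "one (residue_field p) = residue p 1"
    unfolding residue_field_def FactRing_def A_RCOSETS_def' by (auto simp: a_r_coset_PIdl)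
  show "mult (residue_field p) (residue p r) (residue p s) = residue p (r * s)"
    using rcoset_mult_add[of r s] unfolding residue_field_def FactRing_def by (simp add: a_r_coset_PIdl)
  show "add (residue_field p) (residue p r) (residue p s) = residue p (r + s)"
    using a_rcos_sum[of r s] unfolding residue_field_def FactRing_def by (simp add: a_r_coset_PIdl)
qed

section \<open>The kernel of a layer map as a vector space of cosets\<close>

context endomorphism
begin

context
  fixes p :: "'f poly" and W :: "'v set"
  assumes irr: "irreducible p" and W: "act.subspace W"
begin

abbreviation (input) "N \<equiv> act p ` W"
abbreviation (input) "N2 \<equiv> act p ` N"

lemma N: "act.subspace N" "act.subspace N2" "N \<subseteq> W"
  using W act_subspace_image by (auto intro: act.subspace_scale)

lemma translate_eq_iff: "act.subspace M \<Longrightarrow> translate M x = translate M y \<longleftrightarrow> x - y \<in> M"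
proof -
  assume M: "act.subspace M"
  have "x \<in> translate M x" using act.subspace_0[OF M] by (simp add: mem_translate)
  moreover have "z - y \<in> M" if "z - x \<in> M" "x - y \<in> M" for z x y
    using act.subspace_add[OF M that] by simp
  moreover have "y - x \<in> M" if "x - y \<in> M"
    using act.subspace_neg[OF M that] by simp
  ultimately show ?thesis by (auto simp: mem_translate set_eq_iff)
qed

lemma layer_simps:
  "carrier (layer scale u p W) = translate N ` W" "zero (layer scale u p W) = N"
  by (simp_all add: layer_def quot_module_def end_module_def A_RCOSETS_def' a_r_coset_def'
      translate_def act_def[abs_def] UNION_singleton_eq_range image_def, blast)

lemma translate_self: "translate N x \<noteq> {}"
  using act.subspace_0[OF N(1)] by (auto simp: translate_def)

lemma layer_smult:
  "smult (layer scale u p W) r (translate N x) = translate N (r \<cdot> x)"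
proof -
  have "smult (layer scale u p W) r (translate N x) = (\<Union>y\<in>translate N x. translate N (r \<cdot> y))"
    by (simp add: layer_def quot_module_def end_module_def a_r_coset_def'
        translate_def act_def[abs_def] UNION_singleton_eq_range)
  also have "\<dots> = (\<Union>y\<in>translate N x. translate N (r \<cdot> x))"
  proof (intro SUP_cong refl)
    fix y assume "y \<in> translate N x"
    then have "r \<cdot> (y - x) \<in> N"
      by (intro act.subspace_scale[OF N(1)]) (simp add: mem_translate)
    then show "translate N (r \<cdot> y) = translate N (r \<cdot> x)"
      by (simp add: translate_eq_iff[OF N(1)] act.scale_right_diff_distrib)
  qed
  finally show ?thesis using translate_self by simp
qed

lemma layer_add:
  "add (layer scale u p W) (translate N x) (translate N y) = translate N (x + y)"
proof -
  have "add (layer scale u p W) (translate N x) (translate N y) = {a + b | a b. a \<in> translate N x \<and> b \<in> translate N y}"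
    by (auto simp: layer_def quot_module_def end_module_def set_add_def')
  also have "\<dots> = translate N (x + y)"
  proof (intro equalityI subsetI)
    fix z assume "z \<in> {a + b | a b. a \<in> translate N x \<and> b \<in> translate N y}"
    then obtain a b where "z = a + b" "a - x \<in> N" "b - y \<in> N"
      by (auto simp: mem_translate)
    then show "z \<in> translate N (x + y)"
      using act.subspace_add[OF N(1), of "a - x" "b - y"] by (simp add: mem_translate algebra_simps)
  next
    fix z assume "z \<in> translate N (x + y)"
    then have "z = (z - y) + y" "(z - y) \<in> translate N x" "y \<in> translate N y"
      using act.subspace_0[OF N(1)] by (auto simp: mem_translate algebra_simps)
    then show "z \<in> {a + b | a b. a \<in> translate N x \<and> b \<in> translate N y}" by blast
  qed
  finally show ?thesis .
qed

lemma layer_map_translate: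
  "layer_map scale u p W (translate N x) = translate N2 (p \<cdot> x)"
proof -
  have "layer_map scale u p W (translate N x) = (\<Union>y\<in>translate N x. translate N2 (p \<cdot> y))"
    by (simp add: layer_map_def end_module_def a_r_coset_def'
        translate_def act_def[abs_def] UNION_singleton_eq_range)
  also have "\<dots> = (\<Union>y\<in>translate N x. translate N2 (p \<cdot> x))"
  proof (intro SUP_cong refl)
    fix y assume "y \<in> translate N x"
    then have "p \<cdot> (y - x) \<in> N2"
      by (intro imageI) (simp add: mem_translate)
    then show "translate N2 (p \<cdot> y) = translate N2 (p \<cdot> x)"
      by (simp add: translate_eq_iff[OF N(2)] act.scale_right_diff_distrib)
  qed
  finally show ?thesis using translate_self by simp
qed

text \<open>The preimage in \<open>W\<close> of the kernel of the induced map, so that membership is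
  tested on representatives.\<close>

definition kernel_lift :: "'v set"
  where "kernel_lift = {x \<in> W. p \<cdot> x \<in> N2}"

lemma subspace_kernel_lift: "act.subspace kernel_lift"
  unfolding kernel_lift_def
  by (rule act.subspaceI)
    (auto simp: act_add act.scale_left_commute[of p] simp del: act.scale_scale intro: act.subspace_0 act.subspace_add act.subspace_scale W N(2))

lemma translate_0: "translate M 0 = M"
  by (simp add: translate_def)

lemma layer_kernel_simps:
  "carrier (layer_kernel scale u p W) = translate N ` kernel_lift"
  "zero (layer_kernel scale u p W) = N"
  "add (layer_kernel scale u p W) (translate N x) (translate N y) = translate N (x + y)"
  "x \<in> W \<Longrightarrow> smult (layer_kernel scale u p W) (residue p r) (translate N x) = translate N (r \<cdot> x)"
proof -
  have z: "zero (layer scale u p (poly_end scale p u ` W)) = N2"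
    by (simp add: layer_def quot_module_def act_def[abs_def])
  have "carrier (layer_kernel scale u p W) = {X \<in> translate N ` W. layer_map scale u p W X = N2}"
    unfolding layer_kernel_def Let_def by (simp add: a_kernel_def' layer_simps z)
  also have "\<dots> = translate N ` kernel_lift"
  proof -
    have "translate N2 y = N2 \<longleftrightarrow> y \<in> N2" for y
      using translate_eq_iff[OF N(2), of y 0] by (simp only: translate_0 diff_zero)
    then have "layer_map scale u p W (translate N y) = N2 \<longleftrightarrow> p \<cdot> y \<in> N2" for y
      by (simp only: layer_map_translate)
    then show ?thesis unfolding kernel_lift_def by blast
  qed
  finally show "carrier (layer_kernel scale u p W) = translate N ` kernel_lift" .
  show "zero (layer_kernel scale u p W) = N"
    unfolding layer_kernel_def Let_def by (simp add: layer_simps)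
  show "add (layer_kernel scale u p W) (translate N x) (translate N y) = translate N (x + y)"
    unfolding layer_kernel_def Let_def by (simp add: layer_add)
  assume x: "x \<in> W"
  have "translate N (s \<cdot> x) = translate N (r \<cdot> x)" if s: "s \<in> residue p r" for s
  proof -
    obtain q where "s - r = p * q"
      using s unfolding residue_def by (auto elim: dvdE)
    then have "s \<cdot> x - r \<cdot> x = p \<cdot> q \<cdot> x"
      by (metis act_mult act.scale_left_diff_distrib)
    also have "\<dots> \<in> N"
      using x W by (intro imageI act.subspace_scale)
    finally show ?thesis by (simp add: translate_eq_iff[OF N(1)])
  qed
  then have "(\<Union>s\<in>residue p r. translate N (s \<cdot> x)) = (\<Union>s\<in>residue p r. translate N (r \<cdot> x))"
    by (rule SUP_cong[OF refl])
  also have "\<dots> = translate N (r \<cdot> x)"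
  proof (rule SUP_const)
    show "residue p r \<noteq> {}" by (metis residue_def diff_self dvd_0_right empty_iff mem_Collect_eq)
  qed
  finally show "smult (layer_kernel scale u p W) (residue p r) (translate N x) = translate N (r \<cdot> x)"
    unfolding layer_kernel_def Let_def by (simp only: layer_smult module.simps)
qed

lemma vectorspace_layer_kernel: "vectorspace (residue_field p) (layer_kernel scale u p W)"
proof (rule vs_criteria)
  have kW: "x \<in> W" if "x \<in> kernel_lift" for x
    using that by (simp add: kernel_lift_def)
  note K = subspace_kernel_lift
  have cl: "x + y \<in> kernel_lift" if "x \<in> kernel_lift" "y \<in> kernel_lift" for x y
    using that K by (auto intro: act.subspace_add)
  have cl': "r \<cdot> x \<in> kernel_lift" "- x \<in> kernel_lift" if "x \<in> kernel_lift" for x r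
    using that K by (auto intro: act.subspace_scale act.subspace_neg)
  let ?L = "layer_kernel scale u p W" and ?K = "residue_field p"
  have L_E: "v \<in> carrier ?L \<Longrightarrow> (\<And>x. v = translate N x \<Longrightarrow> x \<in> kernel_lift \<Longrightarrow> P) \<Longrightarrow> P" for P v
    unfolding layer_kernel_simps(1) by (erule imageE)
  have K_E: "c \<in> carrier ?K \<Longrightarrow> (\<And>r. c = residue p r \<Longrightarrow> P) \<Longrightarrow> P" for P c
    unfolding residue_field_simps(1) by (erule rangeE)
  have in_L: "translate N x \<in> carrier ?L" if "x \<in> kernel_lift" for x
    unfolding layer_kernel_simps(1) using that by (rule imageI)
  have smult_L: "residue p r \<odot>\<^bsub>?L\<^esub> translate N x = translate N (r \<cdot> x)" if "x \<in> kernel_lift" for r x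
    by (rule layer_kernel_simps(4)) (rule kW[OF that])
  note add_L = layer_kernel_simps(3)
  have zero_L: "\<zero>\<^bsub>?L\<^esub> = translate N 0"
    unfolding layer_kernel_simps(2) translate_0 ..
  show "field ?K" by (rule field_residue_field[OF irr])
  show "\<zero>\<^bsub>?L\<^esub> \<in> carrier ?L"
    unfolding zero_L by (rule in_L) (rule act.subspace_0[OF K])
  show "\<forall>v w. v \<in> carrier ?L \<and> w \<in> carrier ?L \<longrightarrow> v \<oplus>\<^bsub>?L\<^esub> w \<in> carrier ?L"
  proof (intro allI impI, elim conjE)
    fix v w assume "v \<in> carrier ?L" "w \<in> carrier ?L"
    then show "v \<oplus>\<^bsub>?L\<^esub> w \<in> carrier ?L"
      by (elim L_E) (simp only: add_L in_L cl)
  qed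
  show "\<forall>v\<in>carrier ?L. \<exists>w\<in>carrier ?L. v \<oplus>\<^bsub>?L\<^esub> w = \<zero>\<^bsub>?L\<^esub>"
  proof
    fix v assume "v \<in> carrier ?L"
    then show "\<exists>w\<in>carrier ?L. v \<oplus>\<^bsub>?L\<^esub> w = \<zero>\<^bsub>?L\<^esub>"
    proof (rule L_E)
      fix x assume "v = translate N x" "x \<in> kernel_lift"
      then show ?thesis
        by (intro bexI[of _ "translate N (- x)"]) (simp_all only: add_L zero_L in_L cl' add.right_inverse)
    qed
  qed
  show "\<forall>c v. c \<in> carrier ?K \<and> v \<in> carrier ?L \<longrightarrow> c \<odot>\<^bsub>?L\<^esub> v \<in> carrier ?L"
  proof (intro allI impI, elim conjE)
    fix c v assume "c \<in> carrier ?K" "v \<in> carrier ?L"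
    then show "c \<odot>\<^bsub>?L\<^esub> v \<in> carrier ?L"
      by (elim L_E K_E) (simp only: smult_L in_L cl')
  qed
  show "\<forall>v w. v \<in> carrier ?L \<and> w \<in> carrier ?L \<longrightarrow> v \<oplus>\<^bsub>?L\<^esub> w = w \<oplus>\<^bsub>?L\<^esub> v"
  proof (intro allI impI, elim conjE)
    fix v w assume "v \<in> carrier ?L" "w \<in> carrier ?L"
    then show "v \<oplus>\<^bsub>?L\<^esub> w = w \<oplus>\<^bsub>?L\<^esub> v"
      by (elim L_E) (simp only: add_L add.commute)
  qed
  show "\<forall>v w x. v \<in> carrier ?L \<and> w \<in> carrier ?L \<and> x \<in> carrier ?L \<longrightarrow>
      v \<oplus>\<^bsub>?L\<^esub> w \<oplus>\<^bsub>?L\<^esub> x = v \<oplus>\<^bsub>?L\<^esub> (w \<oplus>\<^bsub>?L\<^esub> x)"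
  proof (intro allI impI, elim conjE)
    fix v w x assume "v \<in> carrier ?L" "w \<in> carrier ?L" "x \<in> carrier ?L"
    then show "v \<oplus>\<^bsub>?L\<^esub> w \<oplus>\<^bsub>?L\<^esub> x = v \<oplus>\<^bsub>?L\<^esub> (w \<oplus>\<^bsub>?L\<^esub> x)"
      by (elim L_E) (simp only: add_L add.assoc)
  qed
  show "\<forall>v\<in>carrier ?L. v \<oplus>\<^bsub>?L\<^esub> \<zero>\<^bsub>?L\<^esub> = v"
  proof
    fix v assume "v \<in> carrier ?L"
    then show "v \<oplus>\<^bsub>?L\<^esub> \<zero>\<^bsub>?L\<^esub> = v"
      by (elim L_E) (simp only: add_L zero_L add_0_right)
  qed
  show "\<forall>a b v. a \<in> carrier ?K \<and> b \<in> carrier ?K \<and> v \<in> carrier ?L \<longrightarrow>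
      (a \<otimes>\<^bsub>?K\<^esub> b) \<odot>\<^bsub>?L\<^esub> v = a \<odot>\<^bsub>?L\<^esub> (b \<odot>\<^bsub>?L\<^esub> v)"
  proof (intro allI impI, elim conjE)
    fix a b v assume "a \<in> carrier ?K" "b \<in> carrier ?K" "v \<in> carrier ?L"
    then show "(a \<otimes>\<^bsub>?K\<^esub> b) \<odot>\<^bsub>?L\<^esub> v = a \<odot>\<^bsub>?L\<^esub> (b \<odot>\<^bsub>?L\<^esub> v)"
      by (elim L_E K_E) (simp only: smult_L cl' residue_field_simps act_mult)
  qed
  show "\<forall>v\<in>carrier ?L. \<one>\<^bsub>?K\<^esub> \<odot>\<^bsub>?L\<^esub> v = v"
  proof
    fix v assume "v \<in> carrier ?L"
    then show "\<one>\<^bsub>?K\<^esub> \<odot>\<^bsub>?L\<^esub> v = v"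
      by (elim L_E) (simp only: smult_L residue_field_simps act_1)
  qed
  show "\<forall>a b v. a \<in> carrier ?K \<and> b \<in> carrier ?K \<and> v \<in> carrier ?L \<longrightarrow>
      (a \<oplus>\<^bsub>?K\<^esub> b) \<odot>\<^bsub>?L\<^esub> v = a \<odot>\<^bsub>?L\<^esub> v \<oplus>\<^bsub>?L\<^esub> b \<odot>\<^bsub>?L\<^esub> v"
  proof (intro allI impI, elim conjE)
    fix a b v assume "a \<in> carrier ?K" "b \<in> carrier ?K" "v \<in> carrier ?L"
    then show "(a \<oplus>\<^bsub>?K\<^esub> b) \<odot>\<^bsub>?L\<^esub> v = a \<odot>\<^bsub>?L\<^esub> v \<oplus>\<^bsub>?L\<^esub> b \<odot>\<^bsub>?L\<^esub> v"
      by (elim L_E K_E) (simp only: smult_L cl' residue_field_simps act_add_poly add_L)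
  qed
  show "\<forall>a v w. a \<in> carrier ?K \<and> v \<in> carrier ?L \<and> w \<in> carrier ?L \<longrightarrow>
      a \<odot>\<^bsub>?L\<^esub> (v \<oplus>\<^bsub>?L\<^esub> w) = a \<odot>\<^bsub>?L\<^esub> v \<oplus>\<^bsub>?L\<^esub> a \<odot>\<^bsub>?L\<^esub> w"
  proof (intro allI impI, elim conjE)
    fix a v w assume "a \<in> carrier ?K" "v \<in> carrier ?L" "w \<in> carrier ?L"
    then show "a \<odot>\<^bsub>?L\<^esub> (v \<oplus>\<^bsub>?L\<^esub> w) = a \<odot>\<^bsub>?L\<^esub> v \<oplus>\<^bsub>?L\<^esub> a \<odot>\<^bsub>?L\<^esub> w"
      by (elim L_E K_E) (simp only: smult_L cl cl' act_add add_L)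
  qed
qed

text \<open>A vector x of \<open>W\<close> with p x = p p w differs from p w, which lies in p(W), by
  a vector of \<open>W\<close> killed by p. Hence the kernel on the quotient vanishes as soon as the
  vectors killed by p do so modulo p(W).\<close>

lemma layer_kernel_dim_eq_czero_iff:
  "cardinal_dim (residue_field p) (layer_kernel scale u p W) =o (czero :: 'z rel) \<longleftrightarrow>
     (\<forall>x\<in>W. p \<cdot> x = 0 \<longrightarrow> x \<in> act p ` W)"
proof -
  have "carrier (layer_kernel scale u p W) = {\<zero>\<^bsub>layer_kernel scale u p W\<^esub>} \<longleftrightarrow> (\<forall>x\<in>kernel_lift. translate N x = N)"
    using act.subspace_0[OF subspace_kernel_lift] unfolding layer_kernel_simps by blast
  also have "\<dots> \<longleftrightarrow> (\<forall>x\<in>kernel_lift. x \<in> N)"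
  proof (rule ball_cong[OF refl])
    show "translate N x = N \<longleftrightarrow> x \<in> N" for x
      using translate_eq_iff[OF N(1), of x 0] by (simp only: translate_0 diff_zero)
  qed
  also have "\<dots> \<longleftrightarrow> (\<forall>x\<in>W. p \<cdot> x = 0 \<longrightarrow> x \<in> N)"
  proof (intro iffI ballI impI)
    fix x assume *: "\<forall>x\<in>kernel_lift. x \<in> N" and x: "x \<in> W" "p \<cdot> x = 0"
    have "x \<in> kernel_lift"
      unfolding kernel_lift_def mem_Collect_eq x(2) using x(1) act.subspace_0[OF N(2)] by (rule conjI)
    then show "x \<in> N" by (rule *[rule_format])
  next
    fix x assume *: "\<forall>x\<in>W. p \<cdot> x = 0 \<longrightarrow> x \<in> N" and x: "x \<in> kernel_lift"
    then obtain w where w: "w \<in> W" "p \<cdot> x = p \<cdot> p \<cdot> w"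
      unfolding kernel_lift_def by blast
    then have "x - p \<cdot> w \<in> N"
    proof (intro *[rule_format] act.subspace_diff[OF W] act.subspace_scale[OF W])
      show "x \<in> W" using x by (simp only: kernel_lift_def mem_Collect_eq)
      show "p \<cdot> (x - p \<cdot> w) = 0"
        unfolding act.scale_right_diff_distrib w(2) by (rule diff_self)
    qed (rule w(1))
    then have "(x - p \<cdot> w) + p \<cdot> w \<in> N"
      using w(1) by (intro act.subspace_add[OF N(1)]) auto
    then show "x \<in> N" by simp
  qed
  finally show ?thesis
    by (simp only: vectorspace.cardinal_dim_eq_czero_iff[OF vectorspace_layer_kernel])
qed

end

end
subsection \<open>Even ordinals and iterated images of the square\<close>

lemma transfinite_image_last:
  assumes "Well_order r" "is_last r m"
  shows "transfinite_image f r = f ` transfinite_image f (ord_below r m)"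
proof -
  have "antisym r"
    using assms(1) by (simp add: order_on_defs)
  then have "(THE m. is_last r m) = m"
    using assms(2) by (intro the_equality) (auto simp: is_last_def antisym_def)
  moreover have "r \<noteq> {}"
    using assms(2) by (auto simp: is_last_def)
  ultimately show ?thesis
    using assms by (subst transfinite_image.simps) auto
qed

lemma transfinite_image_limit:
  assumes "Well_order r" "\<nexists>m. is_last r m"
  shows "transfinite_image f r = (\<Inter>a\<in>Field r. transfinite_image f (ord_below r a))"
  using assms by (subst transfinite_image.simps) auto

lemma Well_order_ord_below: "Well_order r \<Longrightarrow> Well_order (ord_below r a)"
  unfolding ord_below_def by (rule Well_order_Restr)

lemma ord_below_ord_below:
  assumes "Well_order r" "(a, b) \<in> r" "a \<noteq> b"
  shows "ord_below (ord_below r b) a = ord_below r a" "a \<in> Field (ord_below r b)"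
proof -
  have r: "trans r" "antisym r" "\<And>x. x \<in> Field r \<Longrightarrow> (x, x) \<in> r"
    using assms(1) by (auto simp: order_on_defs refl_on_def)
  show "ord_below (ord_below r b) a = ord_below r a"
    unfolding ord_below_def underS_def using r assms(2,3) by (auto dest: transD antisymD)
  have "a \<in> Field r" using assms(2) by (auto simp: Field_def)
  then have "(a, a) \<in> ord_below r b"
    unfolding ord_below_def underS_def using r assms(2,3) by auto
  then show "a \<in> Field (ord_below r b)" by (auto simp: Field_def)
qed

lemma Well_order_not_last:
  assumes "Well_order r" "a \<in> Field r" "\<not> is_last r a"
  obtains b where "(a, b) \<in> r" "a \<noteq> b" "b \<in> Field r"
proof -
  obtain b where b: "b \<in> Field r" "(b, a) \<notin> r"
    using assms(2,3) unfolding is_last_def by blast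
  moreover have "(a, b) \<in> r \<and> a \<noteq> b"
    using assms(1,2) b unfolding order_on_defs total_on_def refl_on_def by metis
  ultimately show thesis using that by blast
qed

text \<open>The form of well-founded induction that matches the recursion of
  \<open>transfinite_image\<close>, whose calls are all on proper initial segments.\<close>

lemma ordLess_induct [consumes 1, case_names less]:
  assumes "Well_order r"
    and "\<And>r. Well_order r \<Longrightarrow> (\<And>a. a \<in> Field r \<Longrightarrow> P (ord_below r a)) \<Longrightarrow> P r"
  shows "P r"
proof -
  have "Well_order r \<longrightarrow> P r"
  proof (induction r rule: wf_induct_rule[OF wf_ordLess])
    case (1 r)
    show ?case
    proof
      assume r: "Well_order r"
      show "P r"
      proof (rule assms(2)[OF r])
        fix a assume "a \<in> Field r"
        then show "P (ord_below r a)"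
          using 1 ord_below_ordLess[OF r] Well_order_ord_below[OF r] by blast
      qed
    qed
  qed
  with assms(1) show ?thesis by blast
qed

lemma transfinite_image_in_iterated_images:
  "Well_order r \<Longrightarrow> transfinite_image f r \<in> iterated_images f"
proof (induction r rule: ordLess_induct)
  case (less r)
  show ?case
  proof (cases "\<exists>m. is_last r m")
    case True
    then obtain m where m: "is_last r m" by blast
    then have "m \<in> Field r" by (simp add: is_last_def)
    show ?thesis
      unfolding transfinite_image_last[OF less.hyps m]
      by (rule iterated_images.image[OF less.IH[OF \<open>m \<in> Field r\<close>]])
  next
    case False
    show ?thesis
      unfolding transfinite_image_limit[OF less.hyps False]
      by (rule iterated_images.Inter) (elim imageE, simp only: less.IH)
  qed
qed

text \<open>Passing beyond the stage \<open>a\<close> costs at least one application of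
  \<open>f\<close>. The bound by the image, rather than by the stage itself, is what the limit case
  for the square rests on.\<close>

lemma transfinite_image_subset_image_below:
  assumes "Well_order r" "a \<in> Field r"
  shows "transfinite_image f r \<subseteq> f ` transfinite_image f (ord_below r a)"
  using assms
proof (induction r arbitrary: a rule: ordLess_induct)
  case (less r)
  show ?case
  proof (cases "is_last r a")
    case True
    show ?thesis unfolding transfinite_image_last[OF less.hyps True] by (rule subset_refl)
  next
    case False
    then obtain b where b: "(a, b) \<in> r" "a \<noteq> b" "b \<in> Field r"
      using Well_order_not_last[OF less.hyps less.prems] by blast
    have IH: "transfinite_image f (ord_below r c) \<subseteq> f ` transfinite_image f (ord_below r a)"
      if "(a, c) \<in> r" "a \<noteq> c" "c \<in> Field r" for c
      using less.IH[OF that(3) ord_below_ord_below(2)[OF less.hyps that(1,2)]]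
      by (simp add: ord_below_ord_below(1)[OF less.hyps that(1,2)])
    show ?thesis
    proof (cases "\<exists>m. is_last r m")
      case True
      then obtain m where m: "is_last r m" by blast
      then have "(a, m) \<in> r" "a \<noteq> m" "m \<in> Field r"
        using False less.prems by (auto simp: is_last_def)
      then have "transfinite_image f (ord_below r m) \<subseteq> f ` transfinite_image f (ord_below r a)"
        by (rule IH)
      moreover have "f ` transfinite_image f (ord_below r m) \<subseteq> transfinite_image f (ord_below r m)"
        by (intro image_subset_iterated_images transfinite_image_in_iterated_images
            Well_order_ord_below less.hyps)
      ultimately show ?thesis
        unfolding transfinite_image_last[OF less.hyps m] by (rule order_trans[rotated])
    next
      case no_last: False
      show ?thesis
        unfolding transfinite_image_limit[OF less.hyps no_last]
        by (rule order_trans[OF INF_lower[where f = "\<lambda>a. transfinite_image f (ord_below r a)", OF b(3)] IH[OF b]])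
    qed
  qed
qed

section \<open>Even stages of the transfinite images belong to the family of the square\<close>

context
  fixes f :: "'v \<Rightarrow> 'v" and q :: "'v \<Rightarrow> 'v"
  assumes q: "q = (\<lambda>x. f (f x))"
begin

lemma image_square: "q ` X = f ` f ` X"
  by (auto simp: q)

lemma square_iterated_images: "X \<in> iterated_images q \<Longrightarrow> X \<in> iterated_images f"
  using iterated_images_funpow2[of X f] by (simp add: q)

text \<open>Two successive applications of \<open>f\<close> make one of \<open>q\<close>. Below a
  limit, a stage outside the family of \<open>q\<close> has its image in that family, and the image
  still contains the limit stage; so the limit stage is an intersection of members.\<close>

lemma transfinite_image_square_cases:
  assumes "Well_order r"
  shows "transfinite_image f r \<in> iterated_images q \<or>
    (\<exists>m. is_last r m \<and> transfinite_image f (ord_below r m) \<in> iterated_images q)"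
  using assms
proof (induction r rule: ordLess_induct)
  case (less r)
  show ?case
  proof (cases "\<exists>m. is_last r m")
    case True
    then obtain m where m: "is_last r m" by blast
    then have mF: "m \<in> Field r" by (simp add: is_last_def)
    note Vr = transfinite_image_last[OF less.hyps m, of f]
    from less.IH[OF mF] show ?thesis
    proof
      assume "\<exists>m'. is_last (ord_below r m) m' \<and>
        transfinite_image f (ord_below (ord_below r m) m') \<in> iterated_images q"
      then obtain m' where m': "is_last (ord_below r m) m'"
        "transfinite_image f (ord_below (ord_below r m) m') \<in> iterated_images q" by blast
      have "transfinite_image f r = q ` transfinite_image f (ord_below (ord_below r m) m')"
        unfolding Vr image_square
        using transfinite_image_last[OF Well_order_ord_below[OF less.hyps] m'(1), of f] by (simp only:)
      then show ?thesis using iterated_images.image[OF m'(2)] by simp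
    qed (use m in blast)
  next
    case False
    note Vr = transfinite_image_limit[OF less.hyps False, of f]
    have "\<exists>X\<in>iterated_images q. transfinite_image f r \<subseteq> X \<and> X \<subseteq> transfinite_image f (ord_below r a)"
      if a: "a \<in> Field r" for a
      using less.IH[OF a]
    proof
      assume "transfinite_image f (ord_below r a) \<in> iterated_images q"
      then show ?thesis using Vr a by blast
    next
      assume "\<exists>m'. is_last (ord_below r a) m' \<and>
        transfinite_image f (ord_below (ord_below r a) m') \<in> iterated_images q"
      then obtain m' where m': "is_last (ord_below r a) m'"
        "transfinite_image f (ord_below (ord_below r a) m') \<in> iterated_images q" by blast
      have "q ` transfinite_image f (ord_below (ord_below r a) m') = f ` transfinite_image f (ord_below r a)"
        unfolding image_square
        using transfinite_image_last[OF Well_order_ord_below[OF less.hyps] m'(1), of f] by (simp only:)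
      then have "f ` transfinite_image f (ord_below r a) \<in> iterated_images q"
        using iterated_images.image[OF m'(2)] by simp
      moreover have "f ` transfinite_image f (ord_below r a) \<subseteq> transfinite_image f (ord_below r a)"
        by (intro image_subset_iterated_images transfinite_image_in_iterated_images
            Well_order_ord_below less.hyps)
      ultimately show ?thesis
        using transfinite_image_subset_image_below[OF less.hyps a, of f] by blast
    qed
    then have "\<forall>a\<in>Field r. \<exists>X. X \<in> iterated_images q \<and> transfinite_image f r \<subseteq> X \<and>
        X \<subseteq> transfinite_image f (ord_below r a)" by blast
    then obtain X where X: "\<And>a. a \<in> Field r \<Longrightarrow> X a \<in> iterated_images q \<and> transfinite_image f r \<subseteq> X a \<and>
        X a \<subseteq> transfinite_image f (ord_below r a)" by metis
    have "\<Inter>(X ` Field r) \<subseteq> transfinite_image f r"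
      unfolding Vr by (rule INF_superset_mono[OF subset_refl]) (simp only: X)
    moreover have "transfinite_image f r \<subseteq> \<Inter>(X ` Field r)"
      by (rule INF_greatest) (simp only: X)
    ultimately have "transfinite_image f r = \<Inter>(X ` Field r)" by (rule subset_antisym[rotated])
    moreover have "\<Inter>(X ` Field r) \<in> iterated_images q"
      by (rule iterated_images.Inter) (use X in blast)
    ultimately show ?thesis by simp
  qed
qed

text \<open>The \<open>n\<close> elements above \<open>D\<close> are peeled off one at a time. For
  \<open>n = 0\<close> the order has no last element, which leaves only the first alternative of
  \<open>transfinite_image_square_cases\<close>.\<close>

lemma transfinite_image_parity:
  assumes "Well_order r" "ofilter r D" "\<nexists>m. is_last (Restr r D) m"
    and "finite (Field r - D)" "card (Field r - D) = n"
  shows "(even n \<longrightarrow> transfinite_image f r \<in> iterated_images q) \<and>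
    (odd n \<longrightarrow> (\<exists>X\<in>iterated_images q. transfinite_image f r = f ` X))"
  using assms
proof (induction n arbitrary: r)
  case 0
  then have "Field r = D"
    by (auto simp: ofilter_def)
  then have "Restr r D = r" by (auto simp: Field_def)
  then show ?case
    using transfinite_image_square_cases[OF 0(1)] 0(3) by auto
next
  case (Suc n)
  have r: "trans r" "antisym r" "\<And>x. x \<in> Field r \<Longrightarrow> (x, x) \<in> r" "total_on (Field r) r"
    using Suc.prems(1) by (auto simp: order_on_defs refl_on_def)
  have D: "D \<subseteq> Field r" "\<And>a b. a \<in> D \<Longrightarrow> (b, a) \<in> r \<Longrightarrow> b \<in> D"
    using Suc.prems(2) unfolding ofilter_def under_def by blast+
  define S where "S = Field r - D"
  have S: "finite S" "S \<noteq> {}" "S \<subseteq> Field r"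
    using Suc.prems(4,5) unfolding S_def by (simp, metis card.empty nat.distinct(1), blast)
  \<comment> \<open>Applied to the finite set above the initial segment \<open>D\<close>, this
    yields the last element of \<open>r\<close>.\<close>
  have fin_max: "\<exists>m\<in>T. \<forall>x\<in>T. (x, m) \<in> r" if "finite T" "T \<noteq> {}" "T \<subseteq> Field r" for T
    using that
  proof (induction T rule: finite_ne_induct)
    case (singleton x)
    then show ?case using r(3) by blast
  next
    case (insert x T)
    then obtain m where m: "m \<in> T" "\<forall>y\<in>T. (y, m) \<in> r" by blast
    show ?case
    proof (cases "(x, m) \<in> r")
      case True
      then show ?thesis using m by blast
    next
      case False
      then have "(m, x) \<in> r"
        using r(3,4) insert.prems m(1) unfolding total_on_def by (metis insert_subset subsetD)
      moreover have "(x, x) \<in> r" using r(3) insert.prems by blast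
      ultimately show ?thesis
        using m(2) transD[OF r(1)] by (intro bexI[of _ x] ballI) blast+
    qed
  qed
  obtain m where m: "m \<in> S" "\<And>x. x \<in> S \<Longrightarrow> (x, m) \<in> r"
    using bspec fin_max[OF S] by metis
  have below: "(x, m) \<in> r" if "x \<in> Field r" for x
  proof (cases "x \<in> D")
    case True
    then have "(m, x) \<notin> r" using D(2) m(1) S_def by blast
    then show ?thesis
      using r(3,4) m(1) that S(3) unfolding total_on_def by (metis subsetD)
  qed (use m that S_def in blast)
  have last: "is_last r m"
    unfolding is_last_def using below m(1) S(3) by blast
  let ?r = "ord_below r m"
  have F: "Field ?r = Field r - {m}"
  proof -
    have "underS r m = Field r - {m}"
      unfolding underS_def using below by (auto simp: Field_def)
    then have eq: "?r = Restr r (Field r - {m})" by (simp only: ord_below_def)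
    show ?thesis
    proof (intro equalityI subsetI)
      fix x assume "x \<in> Field ?r"
      then show "x \<in> Field r - {m}" unfolding eq by (auto simp: Field_def)
    next
      fix x assume "x \<in> Field r - {m}"
      then have "(x, x) \<in> ?r" unfolding eq using r(3) by blast
      then show "x \<in> Field ?r" by (rule FieldI1)
    qed
  qed
  have r_eq: "(x, y) \<in> ?r \<longleftrightarrow> (x, y) \<in> r \<and> x \<noteq> m \<and> y \<noteq> m" for x y
    unfolding ord_below_def underS_def using below by (auto simp: Field_def)
  have mD: "m \<notin> D" using m(1) by (simp add: S_def)
  have 1: "ofilter ?r D"
    unfolding ofilter_def under_def using D mD by (auto simp: F r_eq)
  have "Restr ?r D = Restr r D" using mD by (auto simp: r_eq)
  then have 2: "\<nexists>m. is_last (Restr ?r D) m" using Suc.prems(3) by simp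
  have 3: "Field ?r - D = S - {m}" by (auto simp: F S_def)
  have IH: "(even n \<longrightarrow> transfinite_image f ?r \<in> iterated_images q) \<and>
    (odd n \<longrightarrow> (\<exists>X\<in>iterated_images q. transfinite_image f ?r = f ` X))"
    by (rule Suc.IH[OF Well_order_ord_below[OF Suc.prems(1)] 1 2])
      (use S(1) m(1) Suc.prems(5) in \<open>simp_all add: 3 S_def[symmetric]\<close>)
  note Vr = transfinite_image_last[OF Suc.prems(1) last, of f]
  show ?case
  proof (cases "even n")
    case True
    then show ?thesis using IH Vr by auto
  next
    case False
    then obtain X where "X \<in> iterated_images q" "transfinite_image f ?r = f ` X" using IH by blast
    then have "transfinite_image f r \<in> iterated_images q"
      using Vr image_square[of X] iterated_images.image[of X q] by simp
    then show ?thesis using False by simp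
  qed
qed

lemma even_transfinite_image:
  "Well_order r \<Longrightarrow> even_ordinal r \<Longrightarrow> transfinite_image f r \<in> iterated_images q"
  unfolding even_ordinal_def using transfinite_image_parity by blast

end

section \<open>Well-orders that realize given members of the family\<close>

definition above :: "('v \<Rightarrow> 'v) \<Rightarrow> 'v set \<Rightarrow> 'v set set"
  where "above f X = {D \<in> iterated_images f. X \<subset> D}"

text \<open>Reverse inclusion on the members strictly above \<open>X\<close>, carried over to the
  index type by the labelling \<open>g\<close>. Larger sets come earlier, so the order type is the
  stage at which the transfinite images reach \<open>X\<close>.\<close>

definition chain_order :: "('v \<Rightarrow> 'v) \<Rightarrow> ('v set \<Rightarrow> 'o) \<Rightarrow> 'v set \<Rightarrow> 'o rel"
  where "chain_order f g X = {(g D, g E) | D E. D \<in> above f X \<and> E \<in> above f X \<and> E \<subseteq> D}"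

context
  fixes f :: "'v \<Rightarrow> 'v" and g :: "'v set \<Rightarrow> 'o" and C :: "'v set"
  assumes inj: "inj_on g (above f C)"
begin

lemma above_mono: "X \<subseteq> Y \<Longrightarrow> above f Y \<subseteq> above f X"
  unfolding above_def by blast

lemma Field_chain_order: "Field (chain_order f g X) = g ` above f X"
  unfolding chain_order_def Field_def by blast

lemma chain_order_iff:
  assumes "C \<subseteq> X" "D \<in> above f X" "E \<in> above f X"
  shows "(g D, g E) \<in> chain_order f g X \<longleftrightarrow> E \<subseteq> D"
proof -
  have "inj_on g (above f X)" using inj above_mono[OF assms(1)] by (rule inj_on_subset)
  then show ?thesis
    unfolding chain_order_def using assms(2,3) by (auto dest: inj_onD)
qed

text \<open>Totality is the comparability of members, and well-foundedness is the existence of a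
  greatest member in each nonempty subfamily.\<close>

lemma Well_order_chain_order:
  assumes X: "C \<subseteq> X"
  shows "Well_order (chain_order f g X)"
proof -
  let ?r = "chain_order f g X"
  have lin: "D \<subseteq> E \<or> E \<subseteq> D" if "D \<in> above f X" "E \<in> above f X" for D E
    using that iterated_images_linear[of D f E] unfolding above_def by blast
  have fieldE: "\<exists>D\<in>above f X. x = g D" if "(x, y) \<in> ?r \<or> (y, x) \<in> ?r" for x y
    using that unfolding chain_order_def by blast
  have "trans ?r"
  proof (rule transI)
    fix x y z assume "(x, y) \<in> ?r" "(y, z) \<in> ?r"
    then obtain D E F where *: "x = g D" "y = g E" "z = g F" "D \<in> above f X" "E \<in> above f X" "F \<in> above f X"
      using fieldE[of x y] fieldE[of y z] fieldE[of z y] by blast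
    then have "E \<subseteq> D" "F \<subseteq> E"
      using \<open>(x, y) \<in> ?r\<close> \<open>(y, z) \<in> ?r\<close> chain_order_iff[OF X] by auto
    then show "(x, z) \<in> ?r" using * chain_order_iff[OF X] by auto
  qed
  moreover have "antisym ?r"
  proof (rule antisymI)
    fix x y assume "(x, y) \<in> ?r" "(y, x) \<in> ?r"
    then obtain D E where *: "x = g D" "y = g E" "D \<in> above f X" "E \<in> above f X"
      using fieldE[of x y] fieldE[of y x] by blast
    then have "E \<subseteq> D" "D \<subseteq> E"
      using \<open>(x, y) \<in> ?r\<close> \<open>(y, x) \<in> ?r\<close> chain_order_iff[OF X] by auto
    then show "x = y" using * by simp
  qed
  moreover have "refl_on (Field ?r) ?r"
    unfolding refl_on_def Field_chain_order
    using chain_order_iff[OF X] by (auto simp: chain_order_def)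
  moreover have "total_on (Field ?r) ?r"
  proof (rule total_onI)
    fix x y assume "x \<in> Field ?r" "y \<in> Field ?r"
    then obtain D E where *: "x = g D" "y = g E" "D \<in> above f X" "E \<in> above f X"
      unfolding Field_chain_order by blast
    show "(x, y) \<in> ?r \<or> (y, x) \<in> ?r"
      unfolding *(1,2) chain_order_iff[OF X *(3,4)] chain_order_iff[OF X *(4,3)] using lin[OF *(4,3)] .
  qed
  moreover have "wf (?r - Id)"
  proof (rule wfI_min)
    fix x Q assume x: "x \<in> (Q :: 'o set)"
    show "\<exists>z\<in>Q. \<forall>y. (y, z) \<in> ?r - Id \<longrightarrow> y \<notin> Q"
    proof (cases "{D \<in> above f X. g D \<in> Q} = {}")
      case True
      have "y \<notin> Q" if "(y, x) \<in> ?r" for y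
        using that True unfolding chain_order_def by blast
      then show ?thesis using x by blast
    next
      case False
      obtain U where U: "U \<in> {D \<in> above f X. g D \<in> Q}" "\<And>D. D \<in> {D \<in> above f X. g D \<in> Q} \<Longrightarrow> D \<subseteq> U"
        by (rule iterated_images_greatest[OF _ False, of f]) (auto simp: above_def)
      have "y \<notin> Q" if y: "(y, g U) \<in> ?r - Id" for y
      proof
        assume yQ: "y \<in> Q"
        obtain D where D: "y = g D" "D \<in> above f X"
          using y unfolding chain_order_def by blast
        then have "U \<subseteq> D" using y U(1) chain_order_iff[OF X] by auto
        moreover have "D \<subseteq> U" using U(2) D yQ by blast
        ultimately show False using y D(1) by auto
      qed
      then show ?thesis using U(1) by blast
    qed
  qed
  ultimately show ?thesis
    by (auto simp: order_on_defs chain_order_def Field_def refl_on_def)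
qed

lemma is_last_chain_order:
  assumes "C \<subseteq> X"
  shows "is_last (chain_order f g X) m \<longleftrightarrow> (\<exists>Y\<in>above f X. m = g Y \<and> (\<forall>D\<in>above f X. Y \<subseteq> D))"
proof -
  have 1: "is_last (chain_order f g X) (g D) \<longleftrightarrow> (\<forall>E\<in>above f X. D \<subseteq> E)" if "D \<in> above f X" for D
    unfolding is_last_def Field_chain_order using that chain_order_iff[OF assms _ that] by simp
  have 2: "\<exists>D\<in>above f X. m = g D" if "is_last (chain_order f g X) m"
  proof -
    have "m \<in> g ` above f X"
      using that unfolding is_last_def Field_chain_order by (rule conjunct1)
    then show ?thesis by (elim imageE) (intro bexI)
  qed
  show ?thesis
  proof
    assume m: "is_last (chain_order f g X) m"
    then obtain D where D: "D \<in> above f X" "m = g D" using 2 by (elim bexE[OF 2])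
    then show "\<exists>Y\<in>above f X. m = g Y \<and> (\<forall>D\<in>above f X. Y \<subseteq> D)"
      using m 1[OF D(1)] by (intro bexI[of _ D]) simp_all
  next
    assume "\<exists>Y\<in>above f X. m = g Y \<and> (\<forall>D\<in>above f X. Y \<subseteq> D)"
    then show "is_last (chain_order f g X) m"
      by (elim bexE conjE) (simp only: 1)
  qed
qed

lemma chain_order_Restr:
  assumes "C \<subseteq> X" "X \<subseteq> D"
  shows "Restr (chain_order f g X) (g ` above f D) = chain_order f g D"
proof -
  have i: "inj_on g (above f X)" using inj above_mono[OF assms(1)] by (rule inj_on_subset)
  have "A \<in> above f D" if "g A \<in> g ` above f D" "A \<in> above f X" for A
    using that above_mono[OF assms(2)] by (meson i inj_on_image_mem_iff)
  then show ?thesis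
    unfolding chain_order_def using above_mono[OF assms(2)] by blast
qed

lemma ord_below_chain_order:
  assumes "C \<subseteq> X" "D \<in> above f X"
  shows "ord_below (chain_order f g X) (g D) = chain_order f g D"
proof -
  have i: "inj_on g (above f X)" using inj above_mono[OF assms(1)] by (rule inj_on_subset)
  have "underS (chain_order f g X) (g D) = {g E | E. E \<in> above f X \<and> D \<subset> E}"
    unfolding underS_def
  proof (intro equalityI subsetI)
    fix y assume "y \<in> {b. b \<noteq> g D \<and> (b, g D) \<in> chain_order f g X}"
    then obtain E where E: "y = g E" "E \<in> above f X" "(g E, g D) \<in> chain_order f g X" "g E \<noteq> g D"
      unfolding chain_order_def by blast
    then have "D \<subset> E" using chain_order_iff[OF assms(1) E(2) assms(2)] by blast
    then show "y \<in> {g E | E. E \<in> above f X \<and> D \<subset> E}" using E by blast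
  next
    fix y assume "y \<in> {g E | E. E \<in> above f X \<and> D \<subset> E}"
    then obtain E where E: "y = g E" "E \<in> above f X" "D \<subset> E" by blast
    then have "g E \<noteq> g D" using i assms(2) by (auto dest: inj_onD)
    then show "y \<in> {b. b \<noteq> g D \<and> (b, g D) \<in> chain_order f g X}"
      using E chain_order_iff[OF assms(1) E(2) assms(2)] by (simp add: psubset_imp_subset)
  qed
  also have "\<dots> = g ` above f D"
    using assms(2) unfolding above_def by blast
  finally have eq: "underS (chain_order f g X) (g D) = g ` above f D" .
  have "X \<subseteq> D" using assms(2) unfolding above_def by blast
  then show ?thesis
    unfolding ord_below_def eq by (rule chain_order_Restr[OF assms(1)])
qed

text \<open>If \<open>X\<close> were not the image of \<open>Y\<close>, that image would again lie
  strictly above \<open>X\<close> and so equal \<open>Y\<close>. But a fixed member is contained in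
  all others and cannot lie strictly above \<open>X\<close>.\<close>

lemma above_minimum:
  assumes "X \<in> iterated_images f" "Y \<in> above f X" "\<And>D. D \<in> above f X \<Longrightarrow> Y \<subseteq> D"
  shows "X = f ` Y"
proof -
  have Y: "Y \<in> iterated_images f" "X \<subset> Y" using assms(2) by (auto simp: above_def)
  have sub: "X \<subseteq> f ` Y" by (rule iterated_images_extreme[OF assms(1) Y])
  show ?thesis
  proof (rule ccontr)
    assume "X \<noteq> f ` Y"
    then have "f ` Y \<in> above f X"
      using sub iterated_images.image[OF Y(1)] by (auto simp: above_def)
    then have "f ` Y = Y"
      using assms(3) image_subset_iterated_images[OF Y(1)] by blast
    then show False
      using iterated_images_fixed_least[of f Y X] assms(1) Y(2) by blast
  qed
qed

lemma above_no_minimum: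
  assumes "X \<in> iterated_images f" "\<not> (\<exists>Y\<in>above f X. \<forall>D\<in>above f X. Y \<subseteq> D)"
  shows "X = \<Inter>(above f X)"
proof -
  have "\<Inter>(above f X) \<in> iterated_images f"
    by (rule iterated_images.Inter) (simp add: above_def)
  moreover have "X \<subseteq> \<Inter>(above f X)" by (auto simp: above_def)
  ultimately have "\<Inter>(above f X) \<in> above f X \<or> X = \<Inter>(above f X)"
    unfolding above_def[of f X] mem_Collect_eq psubset_eq by (simp only: simp_thms)
  then show ?thesis
  proof
    assume "\<Inter>(above f X) \<in> above f X"
    then have "\<exists>Y\<in>above f X. \<forall>D\<in>above f X. Y \<subseteq> D"
      by (rule bexI[rotated]) (intro ballI Inter_lower)
    then show ?thesis using assms(2) by (rule notE[rotated])
  qed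
qed

text \<open>Induction downwards from the top of the family: among the counterexamples that contain
  \<open>C\<close> there is a greatest one, \<open>U\<close>, and the claim holds for all members
  strictly above it. Whether \<open>above f U\<close> has a least element decides between the
  successor and the limit equation.\<close>

lemma transfinite_image_chain_order:
  assumes "X \<in> iterated_images f" "C \<subseteq> X"
  shows "transfinite_image f (chain_order f g X) = X"
proof (rule ccontr)
  assume "transfinite_image f (chain_order f g X) \<noteq> X"
  define B where "B = {X \<in> iterated_images f. C \<subseteq> X \<and> transfinite_image f (chain_order f g X) \<noteq> X}"
  have "X \<in> B" unfolding B_def using assms \<open>transfinite_image f (chain_order f g X) \<noteq> X\<close> by simp
  then have "B \<noteq> {}" by (metis empty_iff)
  moreover have "B \<subseteq> iterated_images f" unfolding B_def by (rule Collect_subset)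
  ultimately obtain U where U: "U \<in> B" and greatest: "\<And>X. X \<in> B \<Longrightarrow> X \<subseteq> U"
    by (metis iterated_images_greatest)
  have CU: "C \<subseteq> U" and UI: "U \<in> iterated_images f" and
    bad: "transfinite_image f (chain_order f g U) \<noteq> U"
    using U unfolding B_def by simp_all
  have IH: "transfinite_image f (ord_below (chain_order f g U) (g D)) = D" if D: "D \<in> above f U" for D
  proof -
    have "U \<subset> D" "D \<in> iterated_images f" using D unfolding above_def by simp_all
    moreover have "D \<notin> B" using greatest[of D] \<open>U \<subset> D\<close> by (meson less_le_not_le)
    moreover have "C \<subseteq> D" using CU \<open>U \<subset> D\<close> by (meson less_imp_le order_trans)
    ultimately show ?thesis
      unfolding ord_below_chain_order[OF CU D] B_def by simp
  qed
  have "transfinite_image f (chain_order f g U) = U"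
  proof (cases "\<exists>Y\<in>above f U. \<forall>D\<in>above f U. Y \<subseteq> D")
    case True
    then obtain Y where Y: "Y \<in> above f U" "\<forall>D\<in>above f U. Y \<subseteq> D" by blast
    then have "is_last (chain_order f g U) (g Y)"
      unfolding is_last_chain_order[OF CU] by (intro bexI[of _ Y] conjI refl)
    then have "transfinite_image f (chain_order f g U) = f ` Y"
      using transfinite_image_last[OF Well_order_chain_order[OF CU], of "g Y" f] IH[OF Y(1)] by (simp only:)
    also have "\<dots> = U"
      by (rule above_minimum[OF UI Y(1), symmetric]) (rule Y(2)[rule_format])
    finally show ?thesis .
  next
    case False
    then have "\<nexists>m. is_last (chain_order f g U) m"
      unfolding is_last_chain_order[OF CU] by (metis (no_types, lifting))
    then have "transfinite_image f (chain_order f g U) =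
        (\<Inter>a\<in>g ` above f U. transfinite_image f (ord_below (chain_order f g U) a))"
      unfolding Field_chain_order[symmetric] by (rule transfinite_image_limit[OF Well_order_chain_order[OF CU]])
    also have "\<dots> = (\<Inter>D\<in>above f U. D)"
      unfolding image_image by (rule INF_cong[OF refl IH])
    also have "\<dots> = U"
      using above_no_minimum[OF UI False] by simp
    finally show ?thesis .
  qed
  with bad show False by (rule notE)
qed

text \<open>\<open>Z\<close> is the limit stage from which \<open>X\<close> is reached by finitely
  many images. No member containing \<open>C\<close> is fixed, so passing from \<open>Y\<close> to
  its image under \<open>q\<close> adds exactly two sets to those above, namely \<open>Y\<close> and
  its image under \<open>f\<close>. An intersection that is not attained is itself a limit stage,
  and the count restarts at zero.\<close>

lemma square_above_even:
  assumes q: "q = (\<lambda>x. f (f x))" and nonfixed: "C \<in> iterated_images f" "f ` C \<noteq> C"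
    and "X \<in> iterated_images q" "C \<subseteq> X"
  shows "\<exists>Z\<in>iterated_images f. X \<subseteq> Z \<and> \<not> (\<exists>Y\<in>above f Z. \<forall>D\<in>above f Z. Y \<subseteq> D) \<and>
    finite (above f X - above f Z) \<and> even (card (above f X - above f Z))"
  using assms(4,5)
proof (induction rule: iterated_images.induct)
  case (image Y)
  have YI: "Y \<in> iterated_images f"
    using square_iterated_images[OF q] image.hyps by blast
  have fYI: "f ` Y \<in> iterated_images f" and qYI: "q ` Y \<in> iterated_images f"
    unfolding image_square[OF q] by (rule iterated_images.image[OF YI], rule iterated_images.image[OF iterated_images.image[OF YI]])
  have nf: "f ` X \<noteq> X" if "X \<in> iterated_images f" "C \<subseteq> X" for X
    using iterated_images_fixed_least[of f X C] that nonfixed by blast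
  have sub: "q ` Y \<subseteq> f ` Y" "f ` Y \<subseteq> Y"
    unfolding image_square[OF q] using image_subset_iterated_images YI fYI by blast+
  then have CfY: "C \<subseteq> f ` Y" "C \<subseteq> Y" using image.prems by blast+
  have strict: "q ` Y \<subset> f ` Y" "f ` Y \<subset> Y"
    using sub nf[OF YI CfY(2)] nf[OF fYI CfY(1)] by (auto simp: image_square[OF q])
  obtain Z where Z: "Z \<in> iterated_images f" "Y \<subseteq> Z" "\<not> (\<exists>Y\<in>above f Z. \<forall>D\<in>above f Z. Y \<subseteq> D)"
    "finite (above f Y - above f Z)" "even (card (above f Y - above f Z))"
    using image.IH CfY(2) by blast
  have "above f (q ` Y) = {Y, f ` Y} \<union> above f Y"
  proof (intro equalityI subsetI)
    fix D assume "D \<in> above f (q ` Y)"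
    then have D: "D \<in> iterated_images f" "q ` Y \<subset> D" by (auto simp: above_def)
    have "\<not> D \<subset> f ` Y"
      using iterated_images_extreme[OF D(1) fYI] D(2) by (auto simp: image_square[OF q])
    moreover have "D \<subset> Y \<Longrightarrow> D \<subseteq> f ` Y"
      using iterated_images_extreme[OF D(1) YI] by blast
    moreover have "D \<subseteq> Y \<or> Y \<subseteq> D" by (rule iterated_images_linear[OF D(1) YI])
    ultimately show "D \<in> {Y, f ` Y} \<union> above f Y"
      using D(1) unfolding above_def by blast
  qed (use strict YI fYI in \<open>auto simp: above_def\<close>)
  moreover have "Y \<notin> above f Y" "f ` Y \<notin> above f Y" "Y \<notin> above f Z" "f ` Y \<notin> above f Z"
    using strict Z(2) by (auto simp: above_def)
  ultimately have "above f (q ` Y) - above f Z = {Y, f ` Y} \<union> (above f Y - above f Z)"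
    and disj: "{Y, f ` Y} \<inter> (above f Y - above f Z) = {}" by blast+
  then have "card (above f (q ` Y) - above f Z) = 2 + card (above f Y - above f Z)"
    "finite (above f (q ` Y) - above f Z)"
    using Z(4) strict(2) by (simp_all add: card_Un_disjoint)
  then show ?case
    using Z sub by (intro bexI[of _ Z]) auto
next
  case (Inter M)
  show ?case
  proof (cases "\<Inter>M \<in> M")
    case True
    then show ?thesis using Inter.IH[OF True] Inter.prems by blast
  next
    case False
    have I: "\<Inter>M \<in> iterated_images f"
      by (rule iterated_images.Inter) (use square_iterated_images[OF q] Inter.hyps in blast)
    have "\<not> (\<exists>Y\<in>above f (\<Inter>M). \<forall>D\<in>above f (\<Inter>M). Y \<subseteq> D)"
    proof
      assume "\<exists>Y\<in>above f (\<Inter>M). \<forall>D\<in>above f (\<Inter>M). Y \<subseteq> D"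
      then obtain Y where Y: "Y \<in> above f (\<Inter>M)" "\<And>D. D \<in> above f (\<Inter>M) \<Longrightarrow> Y \<subseteq> D" by blast
      have "X \<in> above f (\<Inter>M)" if "X \<in> M" for X
        using that False square_iterated_images[OF q] Inter.hyps[OF that] unfolding above_def by blast
      then have "Y \<subseteq> \<Inter>M" using Y(2) by blast
      then show False using Y(1) by (auto simp: above_def)
    qed
    then show ?thesis using I by (intro bexI[of _ "\<Inter>M"]) auto
  qed
qed

lemma even_ordinal_chain_order:
  assumes q: "q = (\<lambda>x. f (f x))" and "f ` C \<noteq> C" "C \<in> iterated_images q"
  shows "even_ordinal (chain_order f g C)"
proof -
  have CI: "C \<in> iterated_images f" using square_iterated_images[OF q] assms(3) by blast
  obtain Z where Z: "C \<subseteq> Z" "\<not> (\<exists>Y\<in>above f Z. \<forall>D\<in>above f Z. Y \<subseteq> D)"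
    "finite (above f C - above f Z)" "even (card (above f C - above f Z))"
    using square_above_even[OF q CI assms(2,3)] by blast
  have "Field (chain_order f g C) - g ` above f Z = g ` (above f C - above f Z)"
    unfolding Field_chain_order
    using inj_on_image_set_diff[OF inj, of "above f C" "above f Z"] above_mono[OF Z(1)] by simp
  moreover have "card (g ` (above f C - above f Z)) = card (above f C - above f Z)"
    by (rule card_image) (rule inj_on_subset[OF inj], blast)
  moreover have "ofilter (chain_order f g C) (g ` above f Z)"
    unfolding ofilter_def
  proof (intro conjI ballI)
    show "g ` above f Z \<subseteq> Field (chain_order f g C)"
      unfolding Field_chain_order using above_mono[OF Z(1)] by blast
    fix a assume "a \<in> g ` above f Z"
    then obtain A where A: "a = g A" "A \<in> above f Z" "A \<in> above f C" using above_mono[OF Z(1)] by blast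
    show "under (chain_order f g C) a \<subseteq> g ` above f Z"
    proof
      fix b assume "b \<in> under (chain_order f g C) a"
      then obtain B where B: "b = g B" "B \<in> above f C" "(g B, g A) \<in> chain_order f g C"
        unfolding under_def chain_order_def A(1) by blast
      then have "A \<subseteq> B" using chain_order_iff[OF subset_refl B(2) A(3)] by blast
      then have "B \<in> above f Z" using A(2) B(2) unfolding above_def by blast
      then show "b \<in> g ` above f Z" using B(1) by blast
    qed
  qed
  moreover have "\<nexists>m. is_last (Restr (chain_order f g C) (g ` above f Z)) m"
    unfolding chain_order_Restr[OF subset_refl Z(1)] is_last_chain_order[OF Z(1)] using Z(2) by blast
  ultimately show ?thesis
    unfolding even_ordinal_def using Z(3,4) by (intro exI[of _ "g ` above f Z"]) simp
qed

end

text \<open>Countably many members above \<open>C\<close> can be labelled in any infinite type,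
  through an embedding of the natural numbers.\<close>

lemma square_iterated_image_eq_even_transfinite_image:
  assumes q: "q = (\<lambda>x. f (f x))" and "f ` C \<noteq> C" "C \<in> iterated_images q" "countable (above f C)"
  obtains r :: "'o::infinite rel" where "Well_order r" "even_ordinal r" "transfinite_image f r = C"
proof -
  obtain h :: "nat \<Rightarrow> 'o" where h: "inj h"
    using infinite_countable_subset[OF infinite_UNIV] by blast
  obtain k :: "'a set \<Rightarrow> nat" where k: "inj_on k (above f C)"
    using assms(4) unfolding countable_def by blast
  have inj: "inj_on (h \<circ> k) (above f C)"
    using comp_inj_on[OF k inj_on_subset[OF h subset_UNIV]] .
  show thesis
    by (rule that[OF Well_order_chain_order[OF inj subset_refl] even_ordinal_chain_order[OF inj q assms(2,3)]
        transfinite_image_chain_order[OF inj square_iterated_images[OF q assms(3)] subset_refl]])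
qed

subsection \<open>Polynomials of pure parity\<close>

text \<open>The Boolean is the parity of the exponents, \<open>True\<close> for odd. Parities add by
  exclusive or, which is written \<open>a \<noteq> b\<close> throughout; the zero polynomial has
  both parities.\<close>

definition homogeneous :: "bool \<Rightarrow> 'a::zero poly \<Rightarrow> bool"
  where "homogeneous b f \<longleftrightarrow> (\<forall>i. coeff f i \<noteq> 0 \<longrightarrow> odd i = b)"

definition part :: "bool \<Rightarrow> 'a::comm_monoid_add poly \<Rightarrow> 'a poly"
  where "part b f = (\<Sum>i\<le>degree f. if odd i = b then monom (coeff f i) i else 0)"

lemma coeff_part: "coeff (part b f) i = (if odd i = b then coeff f i else 0)"
proof -
  have "coeff (part b f) i = (\<Sum>j\<le>degree f. if j = i then (if odd i = b then coeff f i else 0) else 0)"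
    unfolding part_def coeff_sum by (rule sum.cong) auto
  also have "\<dots> = (if odd i = b then coeff f i else 0)"
    by (simp add: coeff_eq_0)
  finally show ?thesis .
qed

lemma part_add_part: "part b f + part (\<not> b) f = f"
  by (rule poly_eqI) (simp add: coeff_part)

lemma part_add: "part b (f + g) = part b f + part b g"
  by (rule poly_eqI) (simp add: coeff_part)

lemma homogeneous_part: "homogeneous b (part b f)"
  unfolding homogeneous_def by (simp add: coeff_part)

lemma homogeneous_0 [simp]: "homogeneous b 0"
  unfolding homogeneous_def by simp

lemma homogeneous_1 [simp]: "homogeneous False 1"
  unfolding homogeneous_def by (auto simp: one_pCons coeff_pCons split: nat.splits)

lemma homogeneous_add: "homogeneous b f \<Longrightarrow> homogeneous b g \<Longrightarrow> homogeneous b (f + g)"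
  unfolding homogeneous_def by (metis add_0 coeff_add)

lemma part_homogeneous: "homogeneous b f \<Longrightarrow> part c f = (if c = b then f else 0)"
  unfolding homogeneous_def by (intro poly_eqI) (auto simp: coeff_part)

lemma homogeneous_mult:
  fixes f g :: "'a::comm_semiring_0 poly"
  assumes "homogeneous a f" "homogeneous b g"
  shows "homogeneous (a \<noteq> b) (f * g)"
  unfolding homogeneous_def
proof (intro allI impI)
  fix n assume "coeff (f * g) n \<noteq> 0"
  then obtain i where i: "i \<le> n" "coeff f i * coeff g (n - i) \<noteq> 0"
    unfolding coeff_mult by (meson atMost_iff sum.neutral)
  then have "coeff f i \<noteq> 0" "coeff g (n - i) \<noteq> 0" by auto
  then have "odd i = a" "odd (n - i) = b"
    using assms unfolding homogeneous_def by blast+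
  moreover have "odd n = (odd i \<noteq> odd (n - i))"
    using i(1) by auto
  ultimately show "odd n = (a \<noteq> b)" by blast
qed

lemma part_mult_homogeneous:
  fixes f g :: "'a::comm_semiring_0 poly"
  assumes "homogeneous b f"
  shows "part c (f * g) = f * part (c \<noteq> b) g"
proof -
  have "f * g = f * part (c \<noteq> b) g + f * part (\<not> (c \<noteq> b)) g"
    unfolding distrib_left[symmetric] part_add_part ..
  then have "part c (f * g) = part c (f * part (c \<noteq> b) g) + part c (f * part (\<not> (c \<noteq> b)) g)"
    by (simp only: part_add)
  also have "part c (f * part (c \<noteq> b) g) = f * part (c \<noteq> b) g"
    using part_homogeneous[OF homogeneous_mult[OF assms homogeneous_part[of "c \<noteq> b" g]], of c] by auto
  also have "part c (f * part (\<not> (c \<noteq> b)) g) = 0"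
    using part_homogeneous[OF homogeneous_mult[OF assms homogeneous_part[of "\<not> (c \<noteq> b)" g]], of c] by auto
  finally show ?thesis by simp
qed

text \<open>Multiplication by a homogeneous \<open>f\<close> preserves or exchanges the two
  parities, so each part of \<open>f * g\<close> is \<open>f\<close> times a part of
  \<open>g\<close>.\<close>

lemma dvd_part:
  fixes f g :: "'a::comm_semiring_1 poly"
  assumes "homogeneous b f" "f dvd g"
  shows "f dvd part c g"
  using assms(2) part_mult_homogeneous[OF assms(1)] by (metis dvd_def)

text \<open>The even part of a Bezout identity is again one, since 1 is even. Even coefficients are
  required later for spaces on which only even polynomials act.\<close>

lemma comaximal_homogeneous_even:
  fixes f g :: "'a::comm_ring_1 poly"
  assumes "homogeneous False f" "homogeneous False g" "comaximal f g"
  obtains k l where "homogeneous False k" "homogeneous False l" "k * f + l * g = 1"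
proof -
  obtain k l where kl: "k * f + l * g = 1"
    using assms(3) unfolding comaximal_def by blast
  have "part False (k * f + l * g) = part False k * f + part False l * g"
    using part_mult_homogeneous[OF assms(1), of False k] part_mult_homogeneous[OF assms(2), of False l]
    by (simp add: part_add mult.commute)
  then have "part False k * f + part False l * g = 1"
    using part_homogeneous[OF homogeneous_1, of False] unfolding kl by metis
  then show thesis using that homogeneous_part by blast
qed

lemma even_poly_iff_homogeneous:
  fixes p :: "'a::field poly"
  shows "even_poly p \<longleftrightarrow> homogeneous False p"
proof
  assume "even_poly p"
  then obtain r where r: "p = pcompose r (monom 1 2)" unfolding even_poly_def by blast
  have c: "homogeneous False [:a:]" for a :: 'a
    unfolding homogeneous_def by (auto simp: coeff_pCons split: nat.splits)
  have m: "homogeneous False (monom (1 :: 'a) 2)"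
    unfolding homogeneous_def by auto
  show "homogeneous False p"
    unfolding r
  proof (induction r)
    case (pCons a r)
    then show ?case
      using homogeneous_mult[OF m pCons.IH] c by (auto simp: pcompose_pCons intro: homogeneous_add)
  qed simp
next
  show "homogeneous False p \<Longrightarrow> even_poly p"
  proof (induction "degree p" arbitrary: p rule: less_induct)
    case less
    obtain a f where f: "p = pCons a f" by (cases p)
    obtain b g where g: "f = pCons b g" by (cases f)
    have cp: "coeff p (Suc 0) = b" "\<And>i. coeff p (Suc (Suc i)) = coeff g i"
      by (simp_all add: f g)
    have b: "b = 0"
      using less.prems cp(1) unfolding homogeneous_def by (metis One_nat_def odd_one)
    show ?case
    proof (cases "g = 0")
      case True
      then have "p = pcompose [:a:] (monom 1 2)" using f g b by simp
      then show ?thesis unfolding even_poly_def by blast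
    next
      case False
      have "homogeneous False g"
        using less.prems cp(2) unfolding homogeneous_def by (metis even_Suc_Suc_iff)
      moreover have "degree g < degree p"
        using False b by (simp add: f g)
      ultimately obtain r where r: "g = pcompose r (monom 1 2)"
        using less.hyps unfolding even_poly_def by blast
      have "p = pcompose (pCons a r) (monom 1 2)"
        unfolding pcompose_pCons r[symmetric] f g b
        by (simp add: monom_Suc numeral_2_eq_2)
      then show ?thesis unfolding even_poly_def by blast
    qed
  qed
qed

section \<open>Derivatives and squares in characteristic 2\<close>

lemma char_two_add_self:
  fixes a :: "'a::ring_1"
  assumes "CHAR('a) = 2"
  shows "a + a = 0"
proof -
  have "(of_nat 2 :: 'a) = 0" using of_nat_CHAR[where ?'a = 'a] assms by simp
  then have "(2 :: 'a) = 0" by simp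
  then show ?thesis by (metis mult_2 mult_zero_left)
qed

lemma char_two_poly_add_self:
  fixes f :: "'a::comm_ring_1 poly"
  assumes "CHAR('a) = 2"
  shows "f + f = 0"
  by (rule poly_eqI) (simp only: coeff_add coeff_0 char_two_add_self[OF assms])

lemma pderiv_eq_0_imp_homogeneous:
  fixes f :: "'a::field poly"
  assumes "CHAR('a) = 2" "pderiv f = 0"
  shows "homogeneous False f"
  unfolding homogeneous_def
proof (intro allI impI)
  fix i assume i: "coeff f i \<noteq> 0"
  show "odd i = False"
  proof (rule ccontr)
    assume "odd i \<noteq> False"
    then obtain n where n: "i = Suc n" "odd (Suc n)" by (cases i) auto
    have "of_nat (Suc n) * coeff f (Suc n) = 0"
      using assms(2) coeff_pderiv[of f n] by simp
    then have "(of_nat (Suc n) :: 'a) = 0" using i n(1) by simp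
    then have "even (Suc n)"
      using assms(1) by (metis of_nat_eq_0_iff_char_dvd)
    then show False using n(2) by blast
  qed
qed

lemma pderiv_homogeneous_even:
  fixes f :: "'a::field poly"
  assumes "CHAR('a) = 2" "homogeneous False f"
  shows "pderiv f = 0"
proof (rule poly_eqI)
  fix n
  show "coeff (pderiv f) n = coeff 0 n"
  proof (cases "odd (Suc n)")
    case True
    then have "coeff f (Suc n) = 0" using assms(2) unfolding homogeneous_def by blast
    then show ?thesis by (simp add: coeff_pderiv)
  next
    case False
    then have "(of_nat (Suc n) :: 'a) = 0"
      using assms(1) by (metis of_nat_eq_0_iff_char_dvd)
    then show ?thesis by (simp only: coeff_pderiv) simp
  qed
qed

lemma homogeneous_square:
  fixes f :: "'a::comm_ring_1 poly"
  assumes "CHAR('a) = 2"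
  shows "homogeneous False (f * f)"
proof -
  let ?e = "part False f" and ?o = "part True f"
  have "f = ?e + ?o" using part_add_part[of False f] by simp
  then have "f * f = (?e + ?o) * (?e + ?o)" by (metis (no_types))
  also have "\<dots> = ?e * ?e + ?o * ?o + (?e * ?o + ?e * ?o)" by (simp add: algebra_simps)
  also have "\<dots> = ?e * ?e + ?o * ?o" using char_two_poly_add_self[OF assms] by simp
  also have "homogeneous False \<dots>"
    using homogeneous_mult[OF homogeneous_part[of False f] homogeneous_part[of False f]]
      homogeneous_mult[OF homogeneous_part[of True f] homogeneous_part[of True f]]
    by (intro homogeneous_add) simp_all
  finally show ?thesis .
qed

text \<open>In characteristic 2 a polynomial that is not even has a nonzero derivative, whose
  smaller degree keeps \<open>p\<close> from dividing it.\<close>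

lemma comaximal_pderiv:
  fixes p :: "'a::field poly"
  assumes "CHAR('a) = 2" "irreducible p" "\<not> homogeneous False p"
  shows "comaximal (pderiv p) p"
proof (rule irreducible_comaximal[OF assms(2)])
  have nz: "pderiv p \<noteq> 0" using pderiv_eq_0_imp_homogeneous assms by blast
  have "degree (pderiv p) < degree p"
  proof -
    have "degree p \<noteq> 0"
      using nz by (metis degree_eq_zeroE pderiv_pCons pderiv_0 add_0 pCons_0_0)
    moreover have "degree (pderiv p) \<le> degree p - 1"
      by (rule degree_le) (auto simp: coeff_pderiv coeff_eq_0)
    ultimately show ?thesis by linarith
  qed
  then show "\<not> p dvd pderiv p" using nz dvd_imp_degree_le[of p "pderiv p"] by linarith
qed

lemma comaximal_X:
  fixes p :: "'a::field poly"
  assumes "p \<in> Irr - {monom 1 1}"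
  shows "comaximal [:0, 1:] p"
proof (rule irreducible_comaximal)
  show irr: "irreducible p" using assms by (simp add: Irr_def)
  show "\<not> p dvd [:0, 1:]"
  proof
    assume "p dvd [:0, 1:]"
    then obtain k where k: "[:0, 1:] = p * k" by (elim dvdE)
    have "p \<noteq> 0" "k \<noteq> 0" using k by auto
    then have "degree p + degree k = 1"
      using degree_mult_eq[of p k] k[symmetric] by simp
    moreover have "degree p \<noteq> 0"
      using irr \<open>p \<noteq> 0\<close> unfolding irreducible_def by (simp add: is_unit_iff_degree)
    ultimately have "degree k = 0" by simp
    then obtain c where c: "k = [:c:]" by (metis degree_eq_zeroE)
    then have "lead_coeff [:0, 1:] = lead_coeff p * c"
      unfolding k lead_coeff_mult by simp
    then have "c = 1" using assms by (simp add: Irr_def)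
    then have "p = monom 1 1" using k c by (simp add: monom_altdef)
    then show False using assms by simp
  qed
qed

text \<open>If \<open>p\<close> divides its odd part, degrees force the odd part to be a nonzero
  constant multiple of \<open>p\<close>, and then \<open>p\<close> has only odd exponents.\<close>

lemma comaximal_part_True:
  fixes p :: "'a::field poly"
  assumes "irreducible p" "\<not> homogeneous False p"
  shows "comaximal (part True p) p \<or> homogeneous True p"
proof -
  have le: "degree (part True p) \<le> degree p"
    by (rule degree_le) (simp add: coeff_part coeff_eq_0)
  have nz: "part True p \<noteq> 0"
    using assms(2) part_add_part[of True p] homogeneous_part[of False p] by auto
  show ?thesis
  proof (cases "p dvd part True p")
    case False
    then show ?thesis using irreducible_comaximal[OF assms(1)] by blast
  next
    case True
    then obtain k where k: "part True p = p * k" by (elim dvdE)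
    then have "p \<noteq> 0" "k \<noteq> 0" using nz by auto
    then have "degree p + degree k \<le> degree p" using le degree_mult_eq[of p k] k by simp
    then have "degree k = 0" by simp
    then obtain c where "k = [:c:]" by (metis degree_eq_zeroE)
    then have "part True p = Polynomial.smult c p" using k by simp
    then have *: "(if odd i then coeff p i else 0) = c * coeff p i" for i
      using coeff_part[of True p i] by simp
    have "odd i" if "coeff p i \<noteq> 0" for i
    proof (rule ccontr)
      assume "\<not> odd i"
      then have "c = 0" using *[of i] that by simp
      then show False using nz \<open>part True p = Polynomial.smult c p\<close> by simp
    qed
    then show ?thesis unfolding homogeneous_def by blast
  qed
qed

subsection \<open>Necessity of the conditions\<close>

context endomorphism
begin

lemma act_square: "act (p * p) = (\<lambda>x. p \<cdot> p \<cdot> x)"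
  by (rule ext) (rule act_mult)

lemma kaplansky_invariant_eq_czero_iff:
  fixes r :: "'o rel"
  assumes "irreducible p" "Well_order r"
  shows "kaplansky_invariant scale r u p =o (czero :: 'z rel) \<longleftrightarrow>
    (\<forall>x\<in>transfinite_image (act p) r. p \<cdot> x = 0 \<longrightarrow> x \<in> act p ` transfinite_image (act p) r)"
proof -
  have "act.subspace (transfinite_image (act p) r)"
    by (rule act_subspace_iterated_images) (rule transfinite_image_in_iterated_images[OF assms(2)])
  moreover have "poly_end scale p u = act p"
    by (rule ext) (simp only: act_def)
  ultimately show ?thesis
    unfolding kaplansky_invariant_def by (simp only:)
      (rule layer_kernel_dim_eq_czero_iff[OF assms(1)])
qed

text \<open>Let \<open>f\<close> and \<open>g\<close> be the projections onto the two summands. The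
  compositions of \<open>u\<close> with them add up to \<open>u\<close>, and each squares to zero
  because \<open>u\<close> carries a summand into the other one, where the projection onto the
  former vanishes.\<close>

lemma exchange_imp_sum:
  assumes "exchange_property scale u"
  shows "sum_of_two_square_zero scale u"
proof -
  obtain A B where A: "subspace A" and B: "subspace B" and AB: "A \<inter> B = {0}"
    and dec: "\<And>x. \<exists>y\<in>A. \<exists>z\<in>B. x = y + z" and uA: "u ` A \<subseteq> B" and uB: "u ` B \<subseteq> A"
    using assms unfolding exchange_property_def by blast
  obtain f g where f: "\<And>x. f x \<in> A" and g: "\<And>x. g x \<in> B" and fg: "\<And>x. x = f x + g x"
    using dec by metis
  have uniq: "f x = y \<and> g x = z" if "y \<in> A" "z \<in> B" "x = y + z" for x y z
  proof -
    have "f x - y = z - g x" using fg[of x] that(3) by (simp add: algebra_simps)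
    moreover have "f x - y \<in> A" "z - g x \<in> B"
      using that f g A B by (auto intro: subspace_diff)
    ultimately have "z - g x \<in> A \<inter> B" "f x - y = z - g x" by simp_all
    then have "f x - y = 0" "z - g x = 0" unfolding AB by simp_all
    then show ?thesis by simp
  qed
  have add: "f (x + y) = f x + f y \<and> g (x + y) = g x + g y" for x y
    by (rule uniq) (use f g A B fg[of x] fg[of y] in \<open>auto intro: subspace_add simp: algebra_simps\<close>)
  have sc: "f (scale c x) = scale c (f x) \<and> g (scale c x) = scale c (g x)" for c x
    by (rule uniq) (use f g A B in \<open>auto intro: subspace_scale simp flip: scale_right_distrib fg\<close>)
  have f0: "f x = 0" if "x \<in> B" for x
    using uniq[of 0 x x] that subspace_0[OF A] by simp
  have g0: "g x = 0" if "x \<in> A" for x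
    using uniq[of x 0 x] that subspace_0[OF B] by simp
  have "square_zero_end scale (\<lambda>x. u (f x))"
    unfolding square_zero_end_def
  proof
    show "Vector_Spaces.linear scale scale (\<lambda>x. u (f x))"
      by unfold_locales (simp_all add: add sc u.add u.scale)
    show "\<forall>x. u (f (u (f x))) = 0" using f0 f uA u.zero by (metis image_subset_iff)
  qed
  moreover have "square_zero_end scale (\<lambda>x. u (g x))"
    unfolding square_zero_end_def
  proof
    show "Vector_Spaces.linear scale scale (\<lambda>x. u (g x))"
      by unfold_locales (simp_all add: add sc u.add u.scale)
    show "\<forall>x. u (g (u (g x))) = 0" using g0 g uB u.zero by (metis image_subset_iff)
  qed
  moreover have "u x = u (f x) + u (g x)" for x
    using fg[of x] u.add by metis
  ultimately show ?thesis unfolding sum_of_two_square_zero_def by blast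
qed

lemma char_two_add_self_vector:
  assumes "CHAR('f) = 2"
  shows "x + x = (0 :: 'v)"
  by (metis assms char_two_add_self scale_left_distrib scale_one scale_zero_left)

text \<open>If \<open>u = a + b\<close> with \<open>a\<^sup>2 = b\<^sup>2 = 0\<close>, then \<open>a u = u a + u\<^sup>2\<close> in characteristic 2: up to the factor \<open>u\<^sup>2\<close>,
  commutation with \<open>a\<close> acts on the polynomials in \<open>u\<close> as the derivation. In particular \<open>a\<close> commutes
  with \<open>p(u)\<^sup>2\<close>.\<close>

lemma square_zero_summand_act:
  assumes ch: "CHAR('f) = 2" and "square_zero_end scale a" "square_zero_end scale b"
    and u: "\<And>x. u x = a x + b x"
  shows "a (f \<cdot> x) = f \<cdot> a x + pderiv f \<cdot> u (u x)"
proof -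
  interpret a: Vector_Spaces.linear scale scale a
    using assms(2) by (simp add: square_zero_end_def)
  interpret b: Vector_Spaces.linear scale scale b
    using assms(3) by (simp add: square_zero_end_def)
  have aa: "a (a x) = 0" "b (b x) = 0" for x
    using assms(2,3) by (simp_all add: square_zero_end_def)
  have au: "a (u x) = u (a x) + u (u x)" for x
  proof -
    have "u (a x) + u (u x) = b (a x) + (a (b x) + b (a x))"
      by (simp add: u a.add b.add aa)
    also have "\<dots> = a (b x) + (b (a x) + b (a x))" by (simp add: add_ac)
    also have "\<dots> = a (u x)"
      unfolding char_two_add_self_vector[OF ch] by (simp add: u a.add aa)
    finally show ?thesis by simp
  qed
  show ?thesis
    by (induction f)
      (simp_all add: act_pCons pderiv_pCons act_add_poly a.add a.scale a.zero au u.add act_u u.zero add_ac)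
qed

lemma sum_imp_torsion_condition:
  assumes ch: "CHAR('f) = 2" and "sum_of_two_square_zero scale u"
    and p: "p \<in> Irr - {monom 1 1}" "\<not> even_poly p" and C: "C \<in> iterated_images (act (p * p))"
    and x: "x \<in> C" "p \<cdot> x = 0"
  shows "x \<in> act p ` C"
proof -
  obtain a b where a: "square_zero_end scale a" and b: "square_zero_end scale b"
    and u: "\<And>x. u x = a x + b x"
    using assms(2) unfolding sum_of_two_square_zero_def by blast
  note a_act = square_zero_summand_act[OF ch a b u]
  interpret a: Vector_Spaces.linear scale scale a
    using a by (simp add: square_zero_end_def)
  have irr: "irreducible p" using p by (simp add: Irr_def)
  have nh: "\<not> homogeneous False p" using p(2) by (simp add: even_poly_iff_homogeneous)
  have "pderiv (p * p) = 0"
    by (rule pderiv_homogeneous_even[OF ch homogeneous_square[OF ch]])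
  then have comm: "a ((p * p) \<cdot> x) = (p * p) \<cdot> a x" for x
    using a_act[of "p * p" x] by simp
  have stable: "a y \<in> C" if "y \<in> C" for y
    using C that
  proof (induction arbitrary: y rule: iterated_images.induct)
    case (image X)
    then obtain z where "z \<in> X" "y = (p * p) \<cdot> z" by blast
    then show ?case using image.IH[of z] comm[of z] by simp
  next
    case (Inter M)
    show ?case
    proof
      fix X assume "X \<in> M"
      then show "a y \<in> X" using Inter.IH[of X y] Inter.prems by simp
    qed
  qed
  have C': "act.subspace C" by (rule act_subspace_iterated_images[OF C])
  have "comaximal (pderiv p * ([:0, 1:] * [:0, 1:])) p"
    by (intro comaximal_mult comaximal_pderiv[OF ch irr nh] comaximal_X[OF p(1)])
  then obtain k l where kl: "k * (pderiv p * ([:0, 1:] * [:0, 1:])) + l * p = 1"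
    unfolding comaximal_def by blast
  have "x = (k * (pderiv p * ([:0, 1:] * [:0, 1:])) + l * p) \<cdot> x"
    unfolding kl act_1 ..
  also have "\<dots> = k \<cdot> pderiv p \<cdot> u (u x) + l \<cdot> p \<cdot> x"
    by (simp only: act_add_poly act_mult act_X)
  also have "\<dots> = k \<cdot> pderiv p \<cdot> u (u x)"
    unfolding x(2) act.scale_zero_right by (rule add_0_right)
  also have "pderiv p \<cdot> u (u x) = p \<cdot> a x"
  proof -
    \<comment> \<open>The left side is \<open>a\<close> applied to \<open>p \<cdot> x\<close>, which
      vanishes. In characteristic 2 the two terms on the right are then equal.\<close>
    have "0 = p \<cdot> a x + pderiv p \<cdot> u (u x)"
      using a_act[of p x] unfolding x(2) a.zero .
    then have "p \<cdot> a x = p \<cdot> a x + (p \<cdot> a x + pderiv p \<cdot> u (u x))" by simp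
    also have "\<dots> = pderiv p \<cdot> u (u x)"
      unfolding add.assoc[symmetric] char_two_add_self_vector[OF ch] by (rule add_0_left)
    finally show ?thesis by (rule sym)
  qed
  also have "k \<cdot> p \<cdot> a x = p \<cdot> k \<cdot> a x" by (rule act.scale_left_commute)
  finally show ?thesis
    using stable[OF x(1)] act.subspace_scale[OF C'] by (metis imageI)
qed

end

subsection \<open>Finite-dimensional subspaces and countable dimension\<close>

context endomorphism
begin

text \<open>Finiteness is expressed by a finite set whose span contains \<open>S\<close>, since
  \<open>dim\<close> is 0 on spaces with an infinite basis.\<close>

definition fin_dim_subspace :: "'v set \<Rightarrow> bool"
  where "fin_dim_subspace S \<longleftrightarrow> subspace S \<and> (\<exists>E. finite E \<and> S \<subseteq> span E)"

lemma fin_dim_subspace_subset: "fin_dim_subspace S \<Longrightarrow> subspace T \<Longrightarrow> T \<subseteq> S \<Longrightarrow> fin_dim_subspace T"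
  unfolding fin_dim_subspace_def by (meson subset_trans)

lemma dim_strict_mono:
  assumes "fin_dim_subspace B" "subspace A" "A \<subset> B"
  shows "dim A < dim B"
proof -
  obtain E where E: "finite E" "B \<subseteq> span E"
    using assms(1) unfolding fin_dim_subspace_def by blast
  obtain BA where BA: "BA \<subseteq> A" "independent BA" "A \<subseteq> span BA"
    by (rule maximal_independent_subset)
  obtain x where x: "x \<in> B" "x \<notin> A" using assms(3) by blast
  have "span BA \<subseteq> A" by (rule span_minimal[OF BA(1) assms(2)])
  then have xs: "x \<notin> span BA" using x(2) by blast
  then have ind: "independent (insert x BA)"
    using BA(2) by (simp add: independent_insertI)
  have "insert x BA \<subseteq> B" using x(1) BA(1) assms(3) by blast
  then obtain BB where BB: "insert x BA \<subseteq> BB" "BB \<subseteq> B" "independent BB" "B \<subseteq> span BB"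
    using maximal_independent_subset_extend ind by blast
  have fin: "finite BB"
    using independent_span_bound[OF E(1) BB(3)] BB(2) E(2) by blast
  have "x \<notin> BA" using xs span_base by blast
  then have "BA \<subset> BB" using BB(1) by blast
  then have "card BA < card BB" by (rule psubset_card_mono[OF fin])
  then show ?thesis
    using basis_card_eq_dim[OF BA(1,3,2)] basis_card_eq_dim[OF BB(2,4,3)] by simp
qed

text \<open>Take \<open>D\<close> with \<open>dim (S \<inter> D)\<close> minimal. The chain
  \<open>M\<close> may have no least member, but its least trace on a finite-dimensional space is
  attained.\<close>

lemma chain_min_meet:
  assumes "fin_dim_subspace S" "M \<noteq> {}" "\<And>D. D \<in> M \<Longrightarrow> subspace D"
    and "\<And>D E. D \<in> M \<Longrightarrow> E \<in> M \<Longrightarrow> D \<subseteq> E \<or> E \<subseteq> D"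
  obtains D where "D \<in> M" "\<And>E. E \<in> M \<Longrightarrow> S \<inter> D \<subseteq> E"
proof -
  obtain D0 where "D0 \<in> M" using assms(2) by (metis ex_in_conv)
  then obtain D where D: "D \<in> M" "\<And>E. E \<in> M \<Longrightarrow> dim (S \<inter> D) \<le> dim (S \<inter> E)"
    using ex_has_least_nat[of "\<lambda>D. D \<in> M" D0 "\<lambda>D. dim (S \<inter> D)"] by metis
  have S: "subspace S" using assms(1) by (simp add: fin_dim_subspace_def)
  have "S \<inter> D \<subseteq> E" if E: "E \<in> M" for E
  proof (rule ccontr)
    assume not: "\<not> S \<inter> D \<subseteq> E"
    then have "E \<subseteq> D" using assms(4)[OF D(1) E] by blast
    with not have "S \<inter> E \<subset> S \<inter> D" by blast
    then have "dim (S \<inter> E) < dim (S \<inter> D)"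
      by (intro dim_strict_mono fin_dim_subspace_subset[OF assms(1)] subspace_inter S assms(3) D(1) E) auto
    then show False using D(2)[OF E] by simp
  qed
  then show thesis by (rule that[OF D(1)])
qed

lemma countable_dim_exhaustion:
  assumes "countable_dim scale"
  obtains V where "\<And>n. fin_dim_subspace (V n)" "\<And>x. \<exists>n::nat. x \<in> V n"
proof -
  obtain B where B: "span B = UNIV" "countable B"
    using assms unfolding countable_dim_def by blast
  \<comment> \<open>\<open>insert 0 B\<close> keeps the enumerated set nonempty even if the basis is
    empty.\<close>
  define V where "V n = span (from_nat_into (insert 0 B) ` {..<n})" for n :: nat
  have "fin_dim_subspace (V n)" for n
    unfolding fin_dim_subspace_def V_def by blast
  moreover have "\<exists>n. x \<in> V n" for x
  proof -
    have "x \<in> span B" using B(1) by simp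
    then obtain T where T: "finite T" "T \<subseteq> B" "x \<in> span T"
      unfolding span_explicit by (force intro: span_sum span_scale span_base)
    have "\<exists>n. b = from_nat_into (insert 0 B) n" if "b \<in> T" for b
      using from_nat_into_surj[of "insert 0 B" b] B(2) T(2) that by blast
    then obtain k where k: "\<And>b. b \<in> T \<Longrightarrow> b = from_nat_into (insert 0 B) (k b)" by metis
    obtain n where n: "\<And>b. b \<in> T \<Longrightarrow> k b < n"
      using finite_nat_set_iff_bounded[of "k ` T"] T(1) by auto
    have "T \<subseteq> from_nat_into (insert 0 B) ` {..<n}"
      using k n by (metis imageI lessThan_iff subsetI)
    then have "span T \<subseteq> V n" unfolding V_def by (rule span_mono)
    then show ?thesis using T(3) by blast
  qed
  ultimately show thesis by (rule that)
qed

text \<open>The traces on \<open>U\<close> of a finite-dimensional exhaustion have finite bases, and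
  the union of these spans \<open>U\<close>.\<close>

lemma countable_dim_subspace_sequence:
  assumes "countable_dim scale" "subspace U"
  obtains e :: "nat \<Rightarrow> 'v" where "\<And>n. e n \<in> U" "U \<subseteq> span (range e)"
proof -
  obtain V where V: "\<And>n. fin_dim_subspace (V n)" "\<And>x. \<exists>n::nat. x \<in> V n"
    using countable_dim_exhaustion[OF assms(1)] by blast
  have "\<exists>B. finite B \<and> B \<subseteq> U \<and> U \<inter> V n \<subseteq> span B" for n
  proof -
    obtain B where B: "B \<subseteq> U \<inter> V n" "independent B" "U \<inter> V n \<subseteq> span B"
      by (rule maximal_independent_subset)
    obtain E where E: "finite E" "V n \<subseteq> span E"
      using V(1)[of n] unfolding fin_dim_subspace_def by blast
    have "finite B" using independent_span_bound[OF E(1) B(2)] B(1) E(2) by blast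
    then show ?thesis using B by blast
  qed
  then obtain B where B: "\<And>n. finite (B n)" "\<And>n. B n \<subseteq> U" "\<And>n. U \<inter> V n \<subseteq> span (B n)" by metis
  define C where "C = insert 0 (\<Union>n. B n)"
  have C: "countable C" "C \<noteq> {}" "C \<subseteq> U"
    unfolding C_def using B(1,2) subspace_0[OF assms(2)] by (auto intro: countable_finite)
  have "from_nat_into C n \<in> U" for n
    using from_nat_into[OF C(2), of n] C(3) by blast
  moreover have "U \<subseteq> span (range (from_nat_into C))"
  proof
    fix x assume x: "x \<in> U"
    obtain n where "x \<in> V n" using V(2) by blast
    then have "x \<in> span (B n)" using x B(3) by blast
    moreover have "B n \<subseteq> range (from_nat_into C)"
      using range_from_nat_into[OF C(2,1)] unfolding C_def by auto
    ultimately show "x \<in> span (range (from_nat_into C))" using span_mono by blast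
  qed
  ultimately show thesis by (rule that)
qed

end

context endomorphism
begin

lemma subspace_iterated_images: "W \<in> iterated_images (act f) \<Longrightarrow> subspace W"
  by (rule act_subspace_imp_subspace[OF act_subspace_iterated_images])

text \<open>A chain of subspaces which strictly decrease under \<open>act f\<close> is countable, because each of them
  is separated from its image by some member of an exhaustion by finite-dimensional subspaces, in which
  its trace is determined by the dimension.\<close>

lemma countable_above:
  assumes "countable_dim scale" "C \<in> iterated_images (act f)"
  shows "countable (above (act f) C)"
proof -
  obtain V where V: "\<And>n. fin_dim_subspace (V n)" "\<And>x. \<exists>n::nat. x \<in> V n"
    using countable_dim_exhaustion[OF assms(1)] by blast
  have "\<exists>n. \<not> V n \<inter> D \<subseteq> act f ` D" if D: "D \<in> above (act f) C" for D
  proof -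
    have "D \<in> iterated_images (act f)" "C \<subset> D" using D by (simp_all add: above_def)
    then have "act f ` D \<noteq> D"
      using iterated_images_fixed_least[of "act f" D C] assms(2) by (metis less_le_not_le)
    then obtain x where "x \<in> D" "x \<notin> act f ` D"
      using image_subset_iterated_images[OF \<open>D \<in> iterated_images (act f)\<close>]
      by (metis subsetI subset_antisym)
    then show ?thesis using V(2)[of x] by (metis IntI subsetD)
  qed
  then obtain n where n: "\<And>D. D \<in> above (act f) C \<Longrightarrow> \<not> V (n D) \<inter> D \<subseteq> act f ` D" by metis
  have less: "dim (V (n D) \<inter> E) < dim (V (n D) \<inter> D)"
    if "D \<in> above (act f) C" "E \<in> above (act f) C" "E \<subset> D" for D E
  proof (rule dim_strict_mono)
    have DE: "D \<in> iterated_images (act f)" "E \<in> iterated_images (act f)"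
      using that by (simp_all add: above_def)
    have sV: "subspace (V (n D))" using V(1) by (simp add: fin_dim_subspace_def)
    show "subspace (V (n D) \<inter> E)"
      by (intro subspace_inter sV subspace_iterated_images[OF DE(2)])
    show "fin_dim_subspace (V (n D) \<inter> D)"
      by (rule fin_dim_subspace_subset[OF V(1)[of "n D"] subspace_inter[OF sV subspace_iterated_images[OF DE(1)]]])
        (rule Int_lower1)
    have "E \<subseteq> act f ` D" by (rule iterated_images_extreme[OF DE(2,1) that(3)])
    then have "\<not> V (n D) \<inter> D \<subseteq> E" using n[OF that(1)] by (metis order_trans)
    then show "V (n D) \<inter> E \<subset> V (n D) \<inter> D" using that(3) by blast
  qed
  have "inj_on (\<lambda>D. (n D, dim (V (n D) \<inter> D))) (above (act f) C)"
  proof (rule inj_onI)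
    fix D E assume DE: "D \<in> above (act f) C" "E \<in> above (act f) C"
      and eq: "(n D, dim (V (n D) \<inter> D)) = (n E, dim (V (n E) \<inter> E))"
    have "n D = n E" "dim (V (n D) \<inter> D) = dim (V (n E) \<inter> E)"
      using eq prod.inject by blast+
    then have e: "n D = n E" "dim (V (n D) \<inter> D) = dim (V (n D) \<inter> E)" by metis+
    have "D \<subseteq> E \<or> E \<subseteq> D"
      using DE iterated_images_linear[of D "act f" E] by (simp add: above_def)
    then show "D = E"
    proof
      assume "D \<subseteq> E"
      show ?thesis
      proof (rule ccontr)
        assume "D \<noteq> E"
        then have "D \<subset> E" using \<open>D \<subseteq> E\<close> by (rule psubsetI[rotated])
        then show False using less[OF DE(2,1)] e by (metis less_irrefl)
      qed
    next
      assume "E \<subseteq> D"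
      show ?thesis
      proof (rule ccontr)
        assume "D \<noteq> E"
        then have "E \<subset> D" using \<open>E \<subseteq> D\<close> by (metis psubsetI)
        then show False using less[OF DE(1,2)] e by (metis less_irrefl)
      qed
    qed
  qed
  then show ?thesis by (rule countableI'[of "\<lambda>D. (n D, dim (V (n D) \<inter> D))"]) 
qed

subsection \<open>Exchanged pairs of subspaces\<close>

definition swap_pair :: "'v set \<Rightarrow> 'v set \<Rightarrow> bool"
  where "swap_pair A B \<longleftrightarrow> subspace A \<and> subspace B \<and> A \<inter> B = {0} \<and> u ` A \<subseteq> B \<and> u ` B \<subseteq> A"

definition swap_split :: "'v set \<Rightarrow> bool"
  where "swap_split U \<longleftrightarrow>
    (\<exists>A B. swap_pair A B \<and> A \<subseteq> U \<and> B \<subseteq> U \<and> (\<forall>x\<in>U. \<exists>a\<in>A. \<exists>b\<in>B. x = a + b))"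

text \<open>\<open>P\<close> stands for the partial splittings that can be enlarged further.
  Dependent choice absorbs a spanning sequence of \<open>U\<close> one vector at a time; only the
  properties in \<open>swap_pair\<close>, not \<open>P\<close>, have to pass to the union.\<close>

lemma exhaust_swap_split:
  assumes cd: "countable_dim scale" and U: "subspace U" and P0: "P {0} {0}"
    and P: "\<And>A B. P A B \<Longrightarrow> swap_pair A B \<and> A \<subseteq> U \<and> B \<subseteq> U"
    and step: "\<And>A B x. P A B \<Longrightarrow> x \<in> U \<Longrightarrow>
      \<exists>A' B'. P A' B' \<and> A \<subseteq> A' \<and> B \<subseteq> B' \<and> (\<exists>a\<in>A'. \<exists>b\<in>B'. x = a + b)"
  shows "swap_split U"
proof -
  obtain e :: "nat \<Rightarrow> 'v" where e: "\<And>n. e n \<in> U" "U \<subseteq> span (range e)"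
    using countable_dim_subspace_sequence[OF cd U] by blast
  have "\<exists>S. \<forall>n. P (fst (S n)) (snd (S n)) \<and> (fst (S n) \<subseteq> fst (S (Suc n)) \<and>
      snd (S n) \<subseteq> snd (S (Suc n)) \<and> (\<exists>a\<in>fst (S (Suc n)). \<exists>b\<in>snd (S (Suc n)). e n = a + b))"
  proof (rule dependent_nat_choice)
    show "\<exists>x. P (fst x) (snd x)" using P0 by (intro exI[of _ "({0}, {0})"]) simp
    fix x n assume "P (fst x) (snd x)"
    from step[OF this e(1)[of n]] obtain A' B' where
      "P A' B'" "fst x \<subseteq> A'" "snd x \<subseteq> B'" "\<exists>a\<in>A'. \<exists>b\<in>B'. e n = a + b" by blast
    then show "\<exists>y. P (fst y) (snd y) \<and> (fst x \<subseteq> fst y \<and> snd x \<subseteq> snd y \<and>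
        (\<exists>a\<in>fst y. \<exists>b\<in>snd y. e n = a + b))"
      by (intro exI[of _ "(A', B')"]) simp
  qed
  then obtain S where S: "\<And>n. P (fst (S n)) (snd (S n))" "\<And>n. fst (S n) \<subseteq> fst (S (Suc n))"
    "\<And>n. snd (S n) \<subseteq> snd (S (Suc n))" "\<And>n. \<exists>a\<in>fst (S (Suc n)). \<exists>b\<in>snd (S (Suc n)). e n = a + b"
    by blast
  define A where "A = (\<Union>n. fst (S n))"
  define B where "B = (\<Union>n. snd (S n))"
  have sp: "subspace (fst (S n))" "subspace (snd (S n))" "fst (S n) \<inter> snd (S n) = {0}"
    "u ` fst (S n) \<subseteq> snd (S n)" "u ` snd (S n) \<subseteq> fst (S n)" "fst (S n) \<subseteq> U" "snd (S n) \<subseteq> U" for n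
    using P[OF S(1)[of n]] unfolding swap_pair_def by blast+
  have mono: "fst (S m) \<subseteq> fst (S n)" "snd (S m) \<subseteq> snd (S n)" if "m \<le> n" for m n
    using lift_Suc_mono_le[of "\<lambda>n. fst (S n)", OF S(2) that]
      lift_Suc_mono_le[of "\<lambda>n. snd (S n)", OF S(3) that] by blast+
  have union: "subspace (\<Union>n. T n)" if T: "\<And>n. subspace (T n)" "\<And>m n. m \<le> n \<Longrightarrow> T m \<subseteq> T n"
    for T :: "nat \<Rightarrow> 'v set"
  proof (rule subspaceI)
    show "0 \<in> (\<Union>n. T n)" using subspace_0[OF T(1)] by blast
    show "x + y \<in> (\<Union>n. T n)" if xy: "x \<in> (\<Union>n. T n)" "y \<in> (\<Union>n. T n)" for x y
    proof -
      obtain m n where "x \<in> T m" "y \<in> T n" using xy by blast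
      then have "x \<in> T (max m n)" "y \<in> T (max m n)"
        using T(2)[of m "max m n"] T(2)[of n "max m n"] by auto
      then show ?thesis using subspace_add[OF T(1)] by blast
    qed
    show "scale c x \<in> (\<Union>n. T n)" if "x \<in> (\<Union>n. T n)" for c x
      using that subspace_scale[OF T(1)] by blast
  qed
  have AB: "subspace A" "subspace B"
    unfolding A_def B_def by (rule union[OF sp(1) mono(1)], assumption, rule union[OF sp(2) mono(2)], assumption)
  have zero: "x = 0" if AB: "x \<in> A" "x \<in> B" for x
  proof -
    obtain m n where "x \<in> fst (S m)" "x \<in> snd (S n)" using AB unfolding A_def B_def by blast
    then have "x \<in> fst (S (max m n)) \<inter> snd (S (max m n))"
      using mono(1)[of m "max m n"] mono(2)[of n "max m n"] by auto
    then show ?thesis unfolding sp(3) by simp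
  qed
  have "swap_pair A B"
    unfolding swap_pair_def
  proof (intro conjI AB)
    show "A \<inter> B = {0}" using zero subspace_0[OF AB(1)] subspace_0[OF AB(2)] by auto
    show "u ` A \<subseteq> B" "u ` B \<subseteq> A"
      using sp(4,5) unfolding A_def B_def by fast+
  qed
  moreover have "A \<subseteq> U" "B \<subseteq> U" using sp(6,7) unfolding A_def B_def by blast+
  moreover have "\<exists>a\<in>A. \<exists>b\<in>B. x = a + b" if "x \<in> U" for x
  proof -
    have "e n \<in> {a + b | a b. a \<in> A \<and> b \<in> B}" for n
      using S(4)[of n] unfolding A_def B_def by blast
    then have "span (range e) \<subseteq> {a + b | a b. a \<in> A \<and> b \<in> B}"
      by (intro span_minimal subspace_sums AB) auto
    then show ?thesis using that e(2) by blast
  qed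
  ultimately show ?thesis unfolding swap_split_def by blast
qed

subsection \<open>Primary decomposition\<close>

definition primary :: "'f poly \<Rightarrow> 'v set"
  where "primary p = {x. \<exists>n. p ^ n \<cdot> x = 0}"

lemma act_subspace_primary: "act.subspace (primary p)"
proof (rule act.subspaceI)
  show "0 \<in> primary p" by (simp add: primary_def)
  show "x + y \<in> primary p" if xy: "x \<in> primary p" "y \<in> primary p" for x y
  proof -
    obtain m n where mn: "p ^ m \<cdot> x = 0" "p ^ n \<cdot> y = 0" using xy by (auto simp: primary_def)
    have "p ^ (m + n) \<cdot> x = p ^ n \<cdot> p ^ m \<cdot> x" "p ^ (m + n) \<cdot> y = p ^ m \<cdot> p ^ n \<cdot> y"
      by (simp_all only: power_add act_mult[symmetric] mult.commute)
    then have "p ^ (m + n) \<cdot> (x + y) = 0" by (simp only: act_add mn act.scale_zero_right add_0_right)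
    then show ?thesis by (auto simp: primary_def)
  qed
  show "f \<cdot> x \<in> primary p" if x: "x \<in> primary p" for f x
  proof -
    obtain n where "p ^ n \<cdot> x = 0" using x by (auto simp: primary_def)
    then have "p ^ n \<cdot> f \<cdot> x = 0"
      using act.scale_left_commute[of "p ^ n" f x] by (simp only: act.scale_zero_right)
    then show ?thesis unfolding primary_def by blast
  qed
qed

lemma subspace_primary: "subspace (primary p)"
  by (rule act_subspace_imp_subspace[OF act_subspace_primary])

text \<open>On a vector killed by a power of \<open>p\<close>, the Bezout coefficient of
  \<open>f\<close> inverts \<open>f\<close>. It depends on the vector, because the exponents need
  not be bounded on the whole component.\<close>

lemma comaximal_primary:
  assumes "comaximal f p"
  shows "x \<in> primary p \<Longrightarrow> f \<cdot> x = 0 \<Longrightarrow> x = 0"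
    and "x \<in> primary p \<Longrightarrow> \<exists>k. x = f \<cdot> k \<cdot> x"
proof -
  have *: "\<exists>k. x = k \<cdot> f \<cdot> x" if x: "x \<in> primary p" for x
  proof -
    obtain n where n: "p ^ n \<cdot> x = 0" using x by (auto simp: primary_def)
    have "comaximal f (p ^ n)"
      using comaximal_power[OF comaximal_sym[OF assms]] comaximal_sym by blast
    then obtain k l where kl: "k * f + l * p ^ n = 1" unfolding comaximal_def by blast
    have "x = (k * f + l * p ^ n) \<cdot> x" unfolding kl by (rule act_1[symmetric])
    also have "\<dots> = k \<cdot> f \<cdot> x"
      by (simp only: act_add_poly act_mult n act.scale_zero_right add_0_right)
    finally show ?thesis by blast
  qed
  show "x \<in> primary p \<Longrightarrow> f \<cdot> x = 0 \<Longrightarrow> x = 0"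
    using * by (metis act.scale_zero_right)
  show "x \<in> primary p \<Longrightarrow> \<exists>k. x = f \<cdot> k \<cdot> x"
    using * by (metis act.scale_left_commute)
qed

end

lemma Irr_comaximal:
  assumes "p \<in> Irr" "q \<in> Irr" "p \<noteq> q"
  shows "comaximal p (q :: 'a::field poly)"
proof (rule irreducible_comaximal)
  show "irreducible q" using assms by (simp add: Irr_def)
  show "\<not> q dvd p"
  proof
    assume "q dvd p"
    then obtain k where k: "p = q * k" by (elim dvdE)
    have "\<not> is_unit q" "irreducible p" using assms by (auto simp: Irr_def irreducible_def)
    then have "is_unit k" using k unfolding irreducible_def by blast
    then obtain c where c: "k = [:c:]" by (auto simp: is_unit_poly_iff)
    have "c = 1" using arg_cong[OF k, of lead_coeff] assms unfolding c lead_coeff_mult by (simp add: Irr_def)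
    then show False using k c assms(3) by simp
  qed
qed

text \<open>A nonconstant divisor of least degree is irreducible, and it can be made monic.\<close>

lemma ex_Irr_dvd:
  fixes f :: "'a::field poly"
  assumes "degree f \<noteq> 0"
  obtains p where "p \<in> Irr" "p dvd f" "degree p \<noteq> 0"
proof -
  obtain d where d: "d dvd f" "degree d \<noteq> 0"
    and least: "\<And>e. e dvd f \<Longrightarrow> degree e \<noteq> 0 \<Longrightarrow> degree d \<le> degree e"
    using ex_has_least_nat[of "\<lambda>d. d dvd f \<and> degree d \<noteq> 0" f degree] assms by auto
  have d0: "d \<noteq> 0" using d(2) by auto
  define p where "p = Polynomial.smult (inverse (lead_coeff d)) d"
  have p: "p dvd f" "degree p = degree d" "lead_coeff p = 1" "p \<noteq> 0"
    unfolding p_def using d0 d(1) by (simp_all add: smult_dvd)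
  have "irreducible p"
    unfolding irreducible_def
  proof (intro conjI allI impI)
    show "p \<noteq> 0" by (rule p(4))
    show "\<not> is_unit p" using p(2,4) d(2) by (simp add: is_unit_iff_degree)
    fix a b assume ab: "p = a * b"
    then have nz: "a \<noteq> 0" "b \<noteq> 0" using p(4) by auto
    have "degree a + degree b = degree d" using degree_mult_eq[OF nz] ab p(2) by simp
    moreover have "a dvd f" using ab p(1) by (metis dvd_mult_left)
    ultimately have "degree a = 0 \<or> degree b = 0" using least[of a] by linarith
    then show "is_unit a \<or> is_unit b" using nz by (simp add: is_unit_iff_degree)
  qed
  then have "p \<in> Irr" using p(3) by (simp add: Irr_def)
  then show thesis using that p(1,2) d(2) by simp
qed

context endomorphism
begin

lemma locally_finite_annihilator:
  assumes "locally_finite_end scale u"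
  obtains f where "f \<noteq> 0" "f \<cdot> x = 0"
proof -
  obtain S :: "nat set" and c where S: "finite S" "(\<Sum>k\<in>S. scale (c k) ((u ^^ k) x)) = 0" "\<exists>k\<in>S. c k \<noteq> 0"
    using assms[unfolded locally_finite_end_def, rule_format, of x] by (elim exE conjE)
  define f where "f = (\<Sum>k\<in>S. monom (c k) k)"
  have coeff_f: "coeff f k = (if k \<in> S then c k else 0)" for k
    unfolding f_def coeff_sum using S(1) by (simp add: coeff_monom)
  obtain n where n: "\<And>k. k \<in> S \<Longrightarrow> k \<le> n" "degree f \<le> n"
    using finite_nat_set_iff_bounded_le[of "insert (degree f) S"] S(1) by auto
  have "f \<cdot> x = (\<Sum>k\<le>n. if k \<in> S then scale (c k) ((u ^^ k) x) else 0)"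
    unfolding act_eq_sum[OF n(2)] coeff_f by (rule sum.cong) auto
  also have "\<dots> = (\<Sum>k\<in>{..n} \<inter> S. scale (c k) ((u ^^ k) x))"
    by (simp add: sum.inter_restrict)
  also have "{..n} \<inter> S = S" using n(1) by auto
  finally have "f \<cdot> x = 0" using S(2) by simp
  moreover have "f \<noteq> 0" using S(3) coeff_f by (metis coeff_0)
  ultimately show thesis by (rule that[rotated])
qed

text \<open>Induction on the degree of an annihilator. After an irreducible factor p is split off, p
  x lies in the span, and it equals p y for some y in the span up to a p-primary error; then y - x
  is itself p-primary.\<close>

lemma primary_span:
  assumes "locally_finite_end scale u"
  shows "x \<in> span (\<Union>p\<in>Irr. primary p)"
proof -
  let ?U = "\<Union>p\<in>Irr. primary p"
  \<comment> \<open>Division by \<open>p\<close> inside the span, up to a p-primary error: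
    \<open>p\<close> is invertible on the other components, and on its own component 0 serves as
    quotient.\<close>
  have lift: "\<exists>x\<in>span ?U. p \<cdot> x - y \<in> primary p" if p: "p \<in> Irr" and y: "y \<in> span ?U" for p y
    using y
  proof (induction rule: span_induct_alt)
    case base
    show ?case
      using act.subspace_0[OF act_subspace_primary] by (intro bexI[of _ 0]) (simp_all add: span_zero)
  next
    case (step c b z)
    then obtain x where x: "x \<in> span ?U" "p \<cdot> x - z \<in> primary p" by blast
    obtain q where q: "q \<in> Irr" "b \<in> primary q" using step.hyps by blast
    have "\<exists>w\<in>span ?U. p \<cdot> w - b \<in> primary p"
    proof (cases "q = p")
      case True
      then show ?thesis
        using q(2) act.subspace_neg[OF act_subspace_primary] by (intro bexI[of _ 0]) (simp_all add: span_zero)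
    next
      case False
      then obtain k where k: "b = p \<cdot> k \<cdot> b"
        using comaximal_primary(2)[OF Irr_comaximal[OF p q(1)] q(2)] by blast
      have "k \<cdot> b \<in> ?U" using q act.subspace_scale[OF act_subspace_primary q(2)] by blast
      then show ?thesis
        using k[symmetric] act.subspace_0[OF act_subspace_primary]
        by (intro bexI[of _ "k \<cdot> b"] span_base) (simp_all only: diff_self)
    qed
    then obtain w where w: "w \<in> span ?U" "p \<cdot> w - b \<in> primary p" by blast
    have "p \<cdot> (scale c w + x) - (scale c b + z) = scale c (p \<cdot> w - b) + (p \<cdot> x - z)"
      by (simp add: act_add act_scale scale_right_diff_distrib)
    also have "\<dots> \<in> primary p"
      using w(2) x(2) by (intro subspace_add[OF subspace_primary] subspace_scale[OF subspace_primary])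
    finally show ?case
      using w(1) x(1) by (intro bexI[of _ "scale c w + x"] span_add span_scale)
  qed
  have "x \<in> span ?U" if "f \<noteq> 0" "f \<cdot> x = 0" for f x
    using that
  proof (induction "degree f" arbitrary: f x rule: less_induct)
    case less
    show ?case
    proof (cases "degree f = 0")
      case True
      then obtain c where "f = [:c:]" by (metis degree_eq_zeroE)
      then have "x = 0" using less.prems by (simp add: act_const)
      then show ?thesis by (simp add: span_zero)
    next
      case False
      then obtain p where p: "p \<in> Irr" "p dvd f" "degree p \<noteq> 0" by (rule ex_Irr_dvd)
      then obtain g where g: "f = p * g" by (elim dvdE)
      have "p \<noteq> 0" "g \<noteq> 0" using g less.prems(1) by auto
      then have "degree g < degree f" using p(3) g by (simp add: degree_mult_eq)
      moreover have "g \<cdot> p \<cdot> x = 0" using less.prems(2) g by (metis act_mult mult.commute)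
      ultimately have "p \<cdot> x \<in> span ?U" using less.hyps \<open>g \<noteq> 0\<close> by blast
      then obtain y where y: "y \<in> span ?U" "p \<cdot> y - p \<cdot> x \<in> primary p" using lift[OF p(1)] by blast
      then obtain n where "p ^ n \<cdot> (p \<cdot> y - p \<cdot> x) = 0" by (auto simp: primary_def)
      then have "p ^ Suc n \<cdot> (y - x) = 0"
        by (metis act_mult act.scale_right_diff_distrib power_Suc2)
      then have "y - x \<in> primary p" unfolding primary_def by blast
      then have "y - x \<in> span ?U" using p(1) by (blast intro: span_base)
      then have "y - (y - x) \<in> span ?U" by (rule span_diff[OF y(1)])
      then show ?thesis by (simp only: diff_diff_eq2 add_diff_cancel_left')
    qed
  qed
  then show ?thesis using locally_finite_annihilator[OF assms, of x] by blast
qed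

text \<open>The product \<open>g\<close> of the powers that kill the other terms also kills
  \<open>x p\<close>, which is minus their sum; and \<open>g\<close> is comaximal to
  \<open>p\<close>.\<close>

lemma primary_independent:
  assumes "finite F" "F \<subseteq> Irr" "\<And>p. p \<in> F \<Longrightarrow> x p \<in> primary p" "(\<Sum>p\<in>F. x p) = 0" "p \<in> F"
  shows "x p = 0"
proof -
  have "\<exists>n. q ^ n \<cdot> x q = 0" if "q \<in> F" for q
    using assms(3)[OF that] by (simp add: primary_def)
  then obtain n where n: "\<And>q. q \<in> F \<Longrightarrow> q ^ n q \<cdot> x q = 0" by metis
  define g where "g = (\<Prod>q\<in>F - {p}. q ^ n q)"
  have "g \<cdot> x q = 0" if q: "q \<in> F - {p}" for q
  proof -
    have "g = (\<Prod>q\<in>F - {p} - {q}. q ^ n q) * q ^ n q"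
      unfolding g_def using prod.remove[OF _ q, of "\<lambda>q. q ^ n q"] assms(1) by (simp add: mult.commute)
    then have "g \<cdot> x q = (\<Prod>q\<in>F - {p} - {q}. q ^ n q) \<cdot> q ^ n q \<cdot> x q"
      by (simp only: act_mult)
    also have "q ^ n q \<cdot> x q = 0" using n q by blast
    finally show ?thesis by (simp only: act.scale_zero_right)
  qed
  then have "g \<cdot> (\<Sum>q\<in>F - {p}. x q) = 0"
    by (simp add: act.scale_sum_right)
  moreover have "x p + (\<Sum>q\<in>F - {p}. x q) = 0"
    using assms(4) sum.remove[OF assms(1,5), of x] by simp
  then have "x p = - (\<Sum>q\<in>F - {p}. x q)" by (simp add: eq_neg_iff_add_eq_0)
  ultimately have "g \<cdot> x p = 0" by (simp only: act.scale_minus_right neg_0_equal_iff_equal minus_zero)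
  moreover have "comaximal (\<Prod>q\<in>G. q ^ n q) p" if "finite G" "G \<subseteq> F - {p}" for G
    using that
  proof (induction G rule: finite_induct)
    case empty
    have "1 * 1 + 0 * p = 1" by simp
    then show ?case unfolding comaximal_def prod.empty by blast
  next
    case (insert q G)
    have "comaximal (q ^ n q) p"
      using insert.prems assms(2,5) by (intro comaximal_power Irr_comaximal) auto
    then show ?case
      using insert comaximal_mult[of "q ^ n q" p "\<Prod>q\<in>G. q ^ n q"] by simp
  qed
  then have "comaximal g p" unfolding g_def using assms(1) by simp
  ultimately show ?thesis using comaximal_primary(1) assms(3,5) by blast
qed

text \<open>The family \<open>a\<close> is zero off \<open>F\<close>, so that two such
  representations can be compared over the union of their index sets.\<close>

lemma span_UN_rep:
  assumes "\<And>p. p \<in> I \<Longrightarrow> subspace (A p)" "x \<in> span (\<Union>p\<in>I. A p)"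
  shows "\<exists>F a. finite F \<and> F \<subseteq> I \<and> (\<forall>p\<in>I. a p \<in> A p) \<and> (\<forall>p. p \<notin> F \<longrightarrow> a p = 0) \<and> x = (\<Sum>p\<in>F. a p)"
  using assms(2)
proof (induction rule: span_induct_alt)
  case base
  show ?case using assms(1) subspace_0 by (intro exI[of _ "{}"] exI[of _ "\<lambda>_. 0"]) auto
next
  case (step c b y)
  then obtain F a where Fa: "finite F" "F \<subseteq> I" "\<And>p. p \<in> I \<Longrightarrow> a p \<in> A p" "\<And>p. p \<notin> F \<Longrightarrow> a p = 0"
    "y = (\<Sum>p\<in>F. a p)" by blast
  obtain p where p: "p \<in> I" "b \<in> A p" using step.hyps by blast
  define a' where "a' = a(p := scale c b + a p)"
  have "(\<Sum>q\<in>insert p F. a' q) = a' p + (\<Sum>q\<in>F - {p}. a' q)"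
    using Fa(1) by (simp add: sum.insert_remove)
  also have "(\<Sum>q\<in>F - {p}. a' q) = (\<Sum>q\<in>F - {p}. a q)"
    by (rule sum.cong) (auto simp: a'_def)
  also have "a' p + (\<Sum>q\<in>F - {p}. a q) = scale c b + (a p + (\<Sum>q\<in>F - {p}. a q))"
    by (simp add: a'_def add.assoc)
  also have "a p + (\<Sum>q\<in>F - {p}. a q) = y"
    using Fa(1,4,5) by (cases "p \<in> F") (simp_all add: sum.remove)
  finally have "scale c b + y = (\<Sum>q\<in>insert p F. a' q)" by simp
  moreover have "\<forall>q\<in>I. a' q \<in> A q"
    unfolding a'_def using Fa(3) p assms(1) by (auto intro: subspace_add subspace_scale)
  moreover have "\<forall>q. q \<notin> insert p F \<longrightarrow> a' q = 0" using Fa(4) by (simp add: a'_def)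
  ultimately show ?case using Fa(1,2) p(1) by (intro exI[of _ "insert p F"] exI[of _ a']) simp
qed

lemma exchange_from_primary:
  assumes lf: "locally_finite_end scale u" and split: "\<And>p. p \<in> Irr \<Longrightarrow> swap_split (primary p)"
  shows "exchange_property scale u"
proof -
  have "\<forall>p\<in>Irr. \<exists>A B. swap_pair A B \<and> A \<subseteq> primary p \<and> B \<subseteq> primary p \<and>
      (\<forall>x\<in>primary p. \<exists>a\<in>A. \<exists>b\<in>B. x = a + b)"
    using split unfolding swap_split_def by blast
  then obtain A B where sp: "\<And>p. p \<in> Irr \<Longrightarrow> swap_pair (A p) (B p)"
    and sub: "\<And>p. p \<in> Irr \<Longrightarrow> A p \<subseteq> primary p" "\<And>p. p \<in> Irr \<Longrightarrow> B p \<subseteq> primary p"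
    and dec: "\<And>p x. p \<in> Irr \<Longrightarrow> x \<in> primary p \<Longrightarrow> \<exists>a\<in>A p. \<exists>b\<in>B p. x = a + b"
    by metis
  define VA where "VA = span (\<Union>p\<in>Irr. A p)"
  define VB where "VB = span (\<Union>p\<in>Irr. B p)"
  have s: "subspace VA" "subspace VB" unfolding VA_def VB_def by (rule subspace_span)+
  have sA: "subspace (A p)" and sB: "subspace (B p)" and int: "A p \<inter> B p = {0}"
    and uA: "u ` A p \<subseteq> B p" and uB: "u ` B p \<subseteq> A p" if "p \<in> Irr" for p
    using sp[OF that] by (simp_all add: swap_pair_def)
  have zero: "x = 0" if x: "x \<in> VA" "x \<in> VB" for x
  proof -
    obtain F a where F: "finite F" "F \<subseteq> Irr" "\<And>p. p \<in> Irr \<Longrightarrow> a p \<in> A p" "\<And>p. p \<notin> F \<Longrightarrow> a p = 0"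
      "x = (\<Sum>p\<in>F. a p)"
      using span_UN_rep[OF sA x(1)[unfolded VA_def]] by blast
    obtain G b where G: "finite G" "G \<subseteq> Irr" "\<And>p. p \<in> Irr \<Longrightarrow> b p \<in> B p" "\<And>p. p \<notin> G \<Longrightarrow> b p = 0"
      "x = (\<Sum>p\<in>G. b p)"
      using span_UN_rep[OF sB x(2)[unfolded VB_def]] by blast
    have "(\<Sum>p\<in>F. a p) = (\<Sum>p\<in>F \<union> G. a p)"
      by (rule sum.mono_neutral_left) (use F(1,4) G(1) in auto)
    moreover have "(\<Sum>p\<in>G. b p) = (\<Sum>p\<in>F \<union> G. b p)"
      by (rule sum.mono_neutral_left) (use G(1,4) F(1) in auto)
    ultimately have "(\<Sum>p\<in>F \<union> G. a p - b p) = 0"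
      using F(5) G(5) by (simp only: sum_subtractf) (simp only: diff_self)
    moreover have "a p - b p \<in> primary p" if "p \<in> F \<union> G" for p
    proof -
      have "p \<in> Irr" using that F(2) G(2) by blast
      then show ?thesis
        using F(3) G(3) sub by (intro subspace_diff[OF subspace_primary]) blast+
    qed
    ultimately have "a p - b p = 0" if "p \<in> F \<union> G" for p
      using primary_independent[of "F \<union> G" "\<lambda>p. a p - b p" p] F(1,2) G(1,2) that by simp
    then have "a p \<in> A p \<inter> B p" if "p \<in> F" for p
      using that F(3)[of p] G(3)[of p] F(2) by (metis IntI UnI1 eq_iff_diff_eq_0 subsetD)
    then have "a p = 0" if "p \<in> F" for p using int F(2) that by (metis singletonD subsetD)
    then show ?thesis using F(5) by simp
  qed
  have "u x \<in> VB" if "x \<in> VA" for x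
    using that unfolding VA_def
  proof (induction rule: span_induct_alt)
    case (step c b y)
    then have "u b \<in> VB" using uA unfolding VB_def by (blast intro: span_base)
    then show ?case using step.IH s(2) by (simp add: u.add u.scale subspace_add subspace_scale)
  qed (simp add: u.zero subspace_0[OF s(2)])
  moreover have "u x \<in> VA" if "x \<in> VB" for x
    using that unfolding VB_def
  proof (induction rule: span_induct_alt)
    case (step c b y)
    then have "u b \<in> VA" using uB unfolding VA_def by (blast intro: span_base)
    then show ?case using step.IH s(1) by (simp add: u.add u.scale subspace_add subspace_scale)
  qed (simp add: u.zero subspace_0[OF s(1)])
  moreover have "\<exists>a\<in>VA. \<exists>b\<in>VB. x = a + b" for x
  proof -
    have "y \<in> {a + b | a b. a \<in> VA \<and> b \<in> VB}" if "y \<in> primary p" "p \<in> Irr" for y p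
      using dec[OF that(2,1)] that(2) unfolding VA_def VB_def by (blast intro: span_base)
    then have "span (\<Union>p\<in>Irr. primary p) \<subseteq> {a + b | a b. a \<in> VA \<and> b \<in> VB}"
      by (intro span_minimal subspace_sums s) blast
    then have "x \<in> {a + b | a b. a \<in> VA \<and> b \<in> VB}" using primary_span[OF lf] by (rule subsetD)
    then show ?thesis by blast
  qed
  moreover have "VA \<inter> VB = {0}"
    using zero subspace_0[OF s(1)] subspace_0[OF s(2)] by auto
  ultimately show ?thesis
    unfolding exchange_property_def using s
    by (intro exI[of _ VA] exI[of _ VB] conjI allI image_subsetI)
qed

end

subsection \<open>Primary components of pure parity\<close>

lemma (in endomorphism) primary_lift: "p \<cdot> x \<in> primary p \<Longrightarrow> x \<in> primary p"
  unfolding primary_def mem_Collect_eq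
proof (elim exE)
  fix n assume n: "p ^ n \<cdot> p \<cdot> x = 0"
  have "p ^ Suc n \<cdot> x = p ^ n \<cdot> p \<cdot> x"
    by (simp only: power_Suc2 act_mult)
  then show "\<exists>n. p ^ n \<cdot> x = 0" using n by (intro exI[of _ "Suc n"]) (simp only:)
qed

lemma (in endomorphism) fin_dim_cyclic:
  assumes "g \<noteq> 0" "g \<cdot> e = 0"
  obtains E where "finite E" "\<And>f. f \<cdot> e \<in> span E"
proof -
  let ?E = "(\<lambda>i. (u ^^ i) e) ` {..degree g}"
  have "f \<cdot> e \<in> span ?E" for f
  proof -
    have "f \<cdot> e = (f div g * g + f mod g) \<cdot> e" by simp
    also have "\<dots> = (f mod g) \<cdot> e"
      by (simp only: act_add_poly act_mult assms(2) act.scale_zero_right add_0_left)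
    also have "degree (f mod g) \<le> degree g"
      using degree_mod_less[OF assms(1), of f] by auto
    then have "(f mod g) \<cdot> e = (\<Sum>i\<le>degree g. scale (coeff (f mod g) i) ((u ^^ i) e))"
      by (rule act_eq_sum)
    also have "\<dots> \<in> span ?E"
      by (intro span_sum span_scale span_base imageI)
    finally show ?thesis .
  qed
  then show thesis using that[of ?E] by simp
qed

text \<open>Serves both constructions: with \<open>c\<close> depending on the summand in the graded
  one, and with \<open>c = False\<close> for modules over the even polynomials.\<close>

lemma (in endomorphism) fin_dim_adjoin_homogeneous:
  fixes c :: bool
  assumes "fin_dim_subspace T" "T \<subseteq> primary p" "p \<noteq> 0" "w \<in> primary p"
  defines "T' \<equiv> {t + f \<cdot> w | t f. t \<in> T \<and> homogeneous c f}"
  shows "fin_dim_subspace T'" "T' \<subseteq> primary p" "T \<subseteq> T'"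
proof -
  have sT: "subspace T" using assms(1) by (simp add: fin_dim_subspace_def)
  have T'I: "t + f \<cdot> w \<in> T'" if "t \<in> T" "homogeneous c f" for t f
    unfolding T'_def using that by blast
  have T'E: "\<exists>t f. v = t + f \<cdot> w \<and> t \<in> T \<and> homogeneous c f" if "v \<in> T'" for v
    using that unfolding T'_def by simp
  show sub: "T \<subseteq> T'"
    using T'I[OF _ homogeneous_0] by (metis act.scale_zero_left add_0_right subsetI)
  obtain n where "p ^ n \<cdot> w = 0" using assms(4) unfolding primary_def by blast
  moreover have "p ^ n \<noteq> 0" using assms(3) by simp
  ultimately obtain E where E: "finite E" "\<And>f. f \<cdot> w \<in> span E" using fin_dim_cyclic by metis
  obtain F where F: "finite F" "T \<subseteq> span F"
    using assms(1) unfolding fin_dim_subspace_def by metis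
  have "span E \<subseteq> span (E \<union> F)" "span F \<subseteq> span (E \<union> F)" by (intro span_mono; simp)+
  then have "T' \<subseteq> span (E \<union> F)"
    unfolding T'_def using E(2) F(2) by (auto intro!: span_add)
  moreover have "finite (E \<union> F)" using E(1) F(1) by simp
  moreover have "subspace T'"
  proof (rule subspaceI)
    show "0 \<in> T'" using subspace_0[OF sT] sub by blast
    show "v + v' \<in> T'" if v: "v \<in> T'" "v' \<in> T'" for v v'
    proof -
      obtain t f t' f' where *: "v = t + f \<cdot> w" "t \<in> T" "homogeneous c f"
        "v' = t' + f' \<cdot> w" "t' \<in> T" "homogeneous c f'" using T'E[OF v(1)] T'E[OF v(2)] by blast
      have "v + v' = (t + t') + (f + f') \<cdot> w" by (simp add: * act_add_poly algebra_simps)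
      then show ?thesis using T'I[OF subspace_add[OF sT *(2,5)] homogeneous_add[OF *(3,6)]] by simp
    qed
    show "scale d v \<in> T'" if v: "v \<in> T'" for d v
    proof -
      obtain t f where *: "v = t + f \<cdot> w" "t \<in> T" "homogeneous c f" using T'E[OF v] by blast
      have "scale d v = scale d t + (Polynomial.smult d f) \<cdot> w"
        by (simp add: * act_smult_poly scale_right_distrib)
      moreover have "homogeneous c (Polynomial.smult d f)"
        using *(3) unfolding homogeneous_def by auto
      ultimately show ?thesis using T'I[OF subspace_scale[OF sT *(2)]] by simp
    qed
  qed
  ultimately show "fin_dim_subspace T'"
    unfolding fin_dim_subspace_def by (intro conjI exI)
  show "T' \<subseteq> primary p"
    unfolding T'_def using assms(2,4)
    by (auto intro: act.subspace_add[OF act_subspace_primary] act.subspace_scale[OF act_subspace_primary])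
qed

text \<open>The parity \<open>\<pi>\<close> of \<open>p\<close> is the shift of the grading caused
  by p(u); it is \<open>False\<close> for even \<open>p\<close> and \<open>True\<close> for p =
  t.\<close>

locale homogeneous_prime = endomorphism scale u
  for scale :: "'f::field \<Rightarrow> 'v::ab_group_add \<Rightarrow> 'v" and u +
  fixes p :: "'f poly" and \<pi> :: bool
  assumes irr: "irreducible p" and hom: "homogeneous \<pi> p"
begin

abbreviation "fam \<equiv> iterated_images (act p)"

lemma fam_image: "C \<in> fam \<Longrightarrow> act p ` C \<in> fam" and fam_image_subset: "C \<in> fam \<Longrightarrow> act p ` C \<subseteq> C"
  by (rule iterated_images.image, assumption) (rule image_subset_iterated_images)

lemma fam_cases: "C \<in> fam \<Longrightarrow> E \<in> fam \<Longrightarrow> \<not> C \<subseteq> E \<Longrightarrow> E \<subseteq> act p ` C"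
  using iterated_images_cases by metis

lemmas fam_act = act_subspace_iterated_images[of _ p]
lemmas fam_subspace = subspace_iterated_images[of _ p]

lemma fam_add: "C \<in> fam \<Longrightarrow> x \<in> C \<Longrightarrow> y \<in> C \<Longrightarrow> x + y \<in> C"
  by (rule subspace_add[OF fam_subspace])

lemma fam_diff: "C \<in> fam \<Longrightarrow> x \<in> C \<Longrightarrow> y \<in> C \<Longrightarrow> x - y \<in> C"
  by (rule subspace_diff[OF fam_subspace])

lemma fam_scale: "C \<in> fam \<Longrightarrow> x \<in> C \<Longrightarrow> f \<cdot> x \<in> C"
  by (rule act.subspace_scale[OF fam_act])

definition total :: "(bool \<Rightarrow> 'v set) \<Rightarrow> 'v set"
  where "total S = {a + b | a b. a \<in> S False \<and> b \<in> S True}"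

text \<open>\<open>S False\<close> and \<open>S True\<close> are the two summands of a partial splitting, the even and the odd part of
  \<open>total S\<close>.\<close>

definition graded :: "(bool \<Rightarrow> 'v set) \<Rightarrow> bool"
  where "graded S \<longleftrightarrow> (\<forall>i. fin_dim_subspace (S i) \<and> S i \<subseteq> primary p \<and> u ` S i \<subseteq> S (\<not> i)) \<and>
    S False \<inter> S True = {0}"

text \<open>The second clause says that every member of the chain meets \<open>total S\<close> in a
  graded subspace: a sum is never deeper in the chain than its parts.\<close>

definition nice :: "(bool \<Rightarrow> 'v set) \<Rightarrow> bool"
  where "nice S \<longleftrightarrow> graded S \<and>
    (\<forall>C\<in>fam. \<forall>i. \<forall>a\<in>S i. \<forall>b\<in>S (\<not> i). a + b \<in> C \<longrightarrow> a \<in> C)"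

lemma totalE:
  assumes "y \<in> total S"
  obtains a b where "a \<in> S i" "b \<in> S (\<not> i)" "y = a + b"
  using assms unfolding total_def by (cases i) (auto simp: add.commute)

lemma totalI: "a \<in> S i \<Longrightarrow> b \<in> S (\<not> i) \<Longrightarrow> a + b \<in> total S"
  unfolding total_def by (cases i) (auto, metis add.commute)

context
  fixes S :: "bool \<Rightarrow> 'v set"
  assumes gr: "graded S"
begin

lemma graded_subspace: "subspace (S i)" and graded_primary: "x \<in> S i \<Longrightarrow> x \<in> primary p"
  and graded_u: "x \<in> S i \<Longrightarrow> u x \<in> S (\<not> i)" and graded_fin: "fin_dim_subspace (S i)"
  using gr unfolding graded_def fin_dim_subspace_def by blast+

lemma graded_0: "0 \<in> S i"
  by (rule subspace_0[OF graded_subspace])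

lemma graded_disjoint: "x \<in> S i \<Longrightarrow> x \<in> S (\<not> i) \<Longrightarrow> x = 0"
  using gr unfolding graded_def by (cases i) auto

lemma total_component: "a \<in> S i \<Longrightarrow> a \<in> total S"
  using totalI[of a S i 0] graded_0 by simp

lemma graded_act:
  assumes "homogeneous b f" "x \<in> S i"
  shows "f \<cdot> x \<in> S (i \<noteq> b)"
proof -
  have pw: "(u ^^ n) x \<in> S (i \<noteq> odd n)" for n
  proof (induction n)
    case (Suc n)
    have "(\<not> (i \<noteq> odd n)) = (i \<noteq> odd (Suc n))" by auto
    then show ?case using graded_u[OF Suc.IH] by simp
  qed (use assms(2) in simp)
  have "scale (coeff f n) ((u ^^ n) x) \<in> S (i \<noteq> b)" for n
  proof (cases "coeff f n = 0")
    case True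
    then show ?thesis using graded_0 by simp
  next
    case False
    then have "odd n = b" using assms(1) unfolding homogeneous_def by blast
    then show ?thesis using subspace_scale[OF graded_subspace pw[of n]] by simp
  qed
  then show ?thesis
    unfolding act_def poly_end_def by (intro subspace_sum graded_subspace)
qed

lemma subspace_total: "subspace (total S)"
  unfolding total_def by (rule subspace_sums[OF graded_subspace graded_subspace])

lemma act_subspace_total: "act.subspace (total S)"
proof (rule act_subspaceI[OF subspace_total])
  fix x assume "x \<in> total S"
  then obtain a b where "a \<in> S False" "b \<in> S (\<not> False)" "x = a + b" by (rule totalE)
  then show "u x \<in> total S"
    using totalI[of "u b" S False "u a"] graded_u[of a False] graded_u[of b True]
    by (simp add: u.add add.commute)
qed

lemma total_add: "x \<in> total S \<Longrightarrow> y \<in> total S \<Longrightarrow> x + y \<in> total S"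
  and total_diff: "x \<in> total S \<Longrightarrow> y \<in> total S \<Longrightarrow> x - y \<in> total S"
  and total_scale: "x \<in> total S \<Longrightarrow> f \<cdot> x \<in> total S"
  and total_0: "0 \<in> total S"
  using act_subspace_total act.subspace_add act.subspace_diff act.subspace_scale act.subspace_0 by metis+

lemma fin_dim_total: "fin_dim_subspace (total S)"
proof -
  obtain E F where "finite E" "S False \<subseteq> span E" "finite F" "S True \<subseteq> span F"
    using graded_fin unfolding fin_dim_subspace_def by metis
  moreover have "span E \<subseteq> span (E \<union> F)" "span F \<subseteq> span (E \<union> F)" by (intro span_mono; simp)+
  ultimately have "total S \<subseteq> span (E \<union> F)" "finite (E \<union> F)"
    unfolding total_def by (auto intro!: span_add)
  then show ?thesis unfolding fin_dim_subspace_def using subspace_total by blast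
qed

end

lemma nice_graded: "nice S \<Longrightarrow> graded S"
  by (simp add: nice_def)

lemma nice_component:
  assumes "nice S" "C \<in> fam" "a \<in> S i" "b \<in> S (\<not> i)" "a + b \<in> C"
  shows "a \<in> C" "b \<in> C"
proof -
  show a: "a \<in> C" using assms unfolding nice_def by blast
  show "b \<in> C" using fam_diff[OF assms(2,5) a] by simp
qed

text \<open>\<open>e\<close> has the greatest height in its coset modulo \<open>S\<close>.\<close>

definition proper :: "(bool \<Rightarrow> 'v set) \<Rightarrow> 'v \<Rightarrow> bool"
  where "proper S e \<longleftrightarrow> (\<forall>C\<in>fam. \<forall>s\<in>total S. e + s \<in> C \<longrightarrow> e \<in> C)"

text \<open>As p(u) shifts degrees by \<open>\<pi>\<close> and \<open>p \<cdot> e\<close> has degree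
  \<open>i\<close>, the vector \<open>e\<close> receives degree \<open>i \<noteq> \<pi>\<close>,
  which explains the parity of \<open>f\<close> in \<open>S'\<close>. Since \<open>p\<close> is
  irreducible, a coefficient at \<open>e\<close> is either divisible by \<open>p\<close>, and its
  term lies in \<open>S\<close>, or invertible modulo \<open>p\<close>, and then properness controls
  the position of \<open>e\<close>.\<close>

lemma adjoin:
  assumes S: "nice S" and e: "e \<notin> total S" "p \<cdot> e \<in> S i" and pr: "proper S e"
  defines "S' \<equiv> \<lambda>k. {a + f \<cdot> e | a f. a \<in> S k \<and> homogeneous (k \<noteq> (i \<noteq> \<pi>)) f}"
  shows "nice S'"
proof -
  note gr = nice_graded[OF S]
  have dvd: "p dvd h" if "h \<cdot> e \<in> total S" for h
  proof (rule ccontr)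
    assume "\<not> p dvd h"
    then obtain k l where kl: "k * h + l * p = 1"
      using irreducible_comaximal[OF irr] unfolding comaximal_def by metis
    have "e = (k * h + l * p) \<cdot> e" unfolding kl by (rule act_1[symmetric])
    also have "\<dots> = k \<cdot> h \<cdot> e + l \<cdot> p \<cdot> e" by (simp only: act_add_poly act_mult)
    also have "\<dots> \<in> total S"
      by (intro total_add[OF gr] total_scale[OF gr] that total_component[OF gr e(2)])
    finally show False using e(1) by blast
  qed
  have collapse: "f \<cdot> e \<in> S k" if f: "homogeneous (k \<noteq> (i \<noteq> \<pi>)) f" "p dvd f" for f k
  proof -
    let ?c = "k \<noteq> (i \<noteq> \<pi>)"
    obtain g where g: "f = p * g" using f(2) by (elim dvdE)
    have "f = p * part (?c \<noteq> \<pi>) g"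
      using part_homogeneous[OF f(1), of ?c] part_mult_homogeneous[OF hom, of ?c g] g by simp
    then have "f \<cdot> e = part (?c \<noteq> \<pi>) g \<cdot> p \<cdot> e"
      by (metis act_mult mult.commute)
    also have "\<dots> \<in> S (i \<noteq> (?c \<noteq> \<pi>))"
      by (rule graded_act[OF gr homogeneous_part e(2)])
    also have "(i \<noteq> (?c \<noteq> \<pi>)) = k" by blast
    finally show ?thesis .
  qed
  have parts: "p dvd f \<and> p dvd g"
    if h: "homogeneous (k \<noteq> (i \<noteq> \<pi>)) f" "homogeneous ((\<not> k) \<noteq> (i \<noteq> \<pi>)) g" "p dvd f + g" for f g k
  proof -
    have "part (k \<noteq> (i \<noteq> \<pi>)) (f + g) = f" "part ((\<not> k) \<noteq> (i \<noteq> \<pi>)) (f + g) = g"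
      using part_homogeneous[OF h(1)] part_homogeneous[OF h(2)] by (auto simp: part_add)
    then show ?thesis using dvd_part[OF hom h(3)] by metis
  qed
  have eP: "e \<in> primary p"
    using graded_primary[OF gr e(2)] by (rule primary_lift)
  have "p \<noteq> 0" "S k \<subseteq> primary p" for k using irr graded_primary[OF gr] by auto
  then have ext: "fin_dim_subspace (S' k)" "S' k \<subseteq> primary p" "S k \<subseteq> S' k" for k
    unfolding S'_def using fin_dim_adjoin_homogeneous[OF graded_fin[OF gr] _ _ eP] by blast+
  have graded': "graded S'"
    unfolding graded_def
  proof (intro conjI allI)
    fix k
    let ?c = "k \<noteq> (i \<noteq> \<pi>)"
    show "fin_dim_subspace (S' k)" "S' k \<subseteq> primary p" by (rule ext)+
    show "u ` S' k \<subseteq> S' (\<not> k)"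
    proof (rule image_subsetI)
      fix x assume "x \<in> S' k"
      then obtain a f where *: "x = a + f \<cdot> e" "a \<in> S k" "homogeneous ?c f"
        unfolding S'_def by blast
      have "u x = u a + ([:0, 1:] * f) \<cdot> e" by (simp only: * u.add act_mult act_X)
      moreover have "homogeneous ((\<not> k) \<noteq> (i \<noteq> \<pi>)) ([:0, 1:] * f)"
      proof -
        have "homogeneous True [:0, 1 :: 'f:]"
          unfolding homogeneous_def by (auto simp: coeff_pCons split: nat.splits)
        from homogeneous_mult[OF this *(3)] show ?thesis by (auto elim: back_subst[of "\<lambda>b. homogeneous b _"])
      qed
      ultimately show "u x \<in> S' (\<not> k)"
        unfolding S'_def using graded_u[OF gr *(2)] by blast
    qed
  next
    have "x = 0" if x: "x \<in> S' False" "x \<in> S' True" for x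
    proof -
      obtain a f b g where *: "x = a + f \<cdot> e" "a \<in> S False" "homogeneous (False \<noteq> (i \<noteq> \<pi>)) f"
          "x = b + g \<cdot> e" "b \<in> S True" "homogeneous (True \<noteq> (i \<noteq> \<pi>)) g"
        using x unfolding S'_def by blast
      have hg: "homogeneous ((\<not> False) \<noteq> (i \<noteq> \<pi>)) (- g)"
        using *(6) unfolding homogeneous_def by auto
      have "(f + - g) \<cdot> e = b - a"
        using *(1,4) by (simp add: act.scale_left_diff_distrib algebra_simps)
      also have "\<dots> \<in> total S"
        by (intro total_diff[OF gr] total_component[OF gr *(2)] total_component[OF gr *(5)])
      finally have "p dvd f + - g" by (rule dvd)
      then have "p dvd f" "p dvd g" using parts[OF *(3) hg] by simp_all
      then have "x \<in> S False" "x \<in> S True"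
        unfolding *(1) using subspace_add[OF graded_subspace[OF gr]] *(2) collapse[OF *(3)] apply blast
        unfolding *(1)[symmetric] *(4) using subspace_add[OF graded_subspace[OF gr]] *(5) collapse[OF *(6)] \<open>p dvd g\<close> by blast
      then show ?thesis using graded_disjoint[OF gr, of x False] by simp
    qed
    moreover have "0 \<in> S' k" for k using graded_0[OF gr, of k] ext(3) by blast
    ultimately show "S' False \<inter> S' True = {0}" by blast
  qed
  show "nice S'"
    unfolding nice_def
  proof (intro conjI graded' ballI allI impI)
    fix C k x y assume C: "C \<in> fam" and x: "x \<in> S' k" and y: "y \<in> S' (\<not> k)" and xy: "x + y \<in> C"
    obtain a f where x: "x = a + f \<cdot> e" "a \<in> S k" "homogeneous (k \<noteq> (i \<noteq> \<pi>)) f"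
      using x unfolding S'_def by blast
    obtain b g where y: "y = b + g \<cdot> e" "b \<in> S (\<not> k)" "homogeneous ((\<not> k) \<noteq> (i \<noteq> \<pi>)) g"
      using y unfolding S'_def by blast
    show "x \<in> C"
    proof (cases "p dvd f + g")
      case True
      then have "f \<cdot> e \<in> S k" "g \<cdot> e \<in> S (\<not> k)"
        using parts[OF x(3) y(3)] collapse[OF x(3)] collapse[OF y(3)] by blast+
      then have "x \<in> S k" "y \<in> S (\<not> k)"
        unfolding x(1) y(1) using subspace_add[OF graded_subspace[OF gr]] x(2) y(2) by blast+
      then show ?thesis using nice_component(1)[OF S C _ _ xy] by blast
    next
      case False
      then obtain m l where ml: "m * (f + g) + l * p = 1"
        using irreducible_comaximal[OF irr] unfolding comaximal_def by metis
      \<comment> \<open>The inverse \<open>m\<close> of \<open>f + g\<close> modulo \<open>p\<close>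
        turns \<open>x + y\<close> into \<open>e\<close> plus this correction from
        \<open>total S\<close>.\<close>
      define s where "s = m \<cdot> (a + b) - l \<cdot> p \<cdot> e"
      have "s \<in> total S"
        unfolding s_def by (intro total_diff[OF gr] total_scale[OF gr] totalI[of a S k b] x(2) y(2)
            total_component[OF gr e(2)])
      moreover have "e + s = m \<cdot> (x + y)"
      proof -
        have "e = (m * (f + g) + l * p) \<cdot> e" unfolding ml by (rule act_1[symmetric])
        also have "\<dots> = m \<cdot> (f \<cdot> e + g \<cdot> e) + l \<cdot> p \<cdot> e" by (simp only: act_add_poly act_mult act_add)
        finally have "e + s = m \<cdot> (f \<cdot> e + g \<cdot> e) + l \<cdot> p \<cdot> e + s" by (rule arg_cong)
        also have "\<dots> = m \<cdot> (x + y)"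
          unfolding s_def x(1) y(1) by (simp only: act_add algebra_simps)
        finally show ?thesis .
      qed
      ultimately have eC: "e \<in> C"
        using pr C fam_scale[OF C xy, of m] unfolding proper_def by metis
      have "a + b = (x + y) - (f \<cdot> e + g \<cdot> e)" unfolding x(1) y(1) by (simp add: algebra_simps)
      also have "\<dots> \<in> C" by (intro fam_diff[OF C] fam_add[OF C] fam_scale[OF C] xy eC)
      finally have "a \<in> C" using nice_component(1)[OF S C x(2) y(2)] by blast
      then show ?thesis unfolding x(1) by (intro fam_add[OF C] fam_scale[OF C] eC)
    qed
  qed
qed

lemma adjoin_total:
  assumes S: "nice S" and e: "p \<cdot> e \<in> S i" and pr: "proper S e"
  obtains S' where "nice S'" "\<And>k. S k \<subseteq> S' k" "e \<in> total S'"
    "\<And>y. y \<in> total S' \<Longrightarrow> \<exists>s\<in>total S. \<exists>f. y = s + f \<cdot> e"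
proof (cases "e \<in> total S")
  case True
  have "\<exists>s\<in>total S. \<exists>f. y = s + f \<cdot> e" if "y \<in> total S" for y
    using that by (intro bexI[of _ y] exI[of _ 0]) simp_all
  then show thesis using that[OF S subset_refl True] by blast
next
  case False
  define S' where "S' = (\<lambda>k. {a + f \<cdot> e | a f. a \<in> S k \<and> homogeneous (k \<noteq> (i \<noteq> \<pi>)) f})"
  have n: "nice S'" unfolding S'_def by (rule adjoin[OF S False e pr])
  have sub: "S k \<subseteq> S' k" for k
  proof
    fix a assume "a \<in> S k"
    moreover have "a = a + 0 \<cdot> e" by simp
    ultimately show "a \<in> S' k" unfolding S'_def using homogeneous_0 by blast
  qed
  have "e = 0 + 1 \<cdot> e" by (simp only: act_1 add_0_left)
  moreover have "homogeneous ((i \<noteq> \<pi>) \<noteq> (i \<noteq> \<pi>)) (1 :: 'f poly)" by simp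
  ultimately have "e \<in> S' (i \<noteq> \<pi>)"
    unfolding S'_def using graded_0[OF nice_graded[OF S], of "i \<noteq> \<pi>"] by blast
  then have "e \<in> total S'" by (rule total_component[OF nice_graded[OF n]])
  moreover have "\<exists>s\<in>total S. \<exists>f. y = s + f \<cdot> e" if y: "y \<in> total S'" for y
  proof -
    obtain x z where xz: "x \<in> S' False" "z \<in> S' (\<not> False)" "y = x + z" using totalE[OF y] by blast
    obtain a f where a: "x = a + f \<cdot> e" "a \<in> S False" using xz(1) unfolding S'_def by blast
    obtain b g where b: "z = b + g \<cdot> e" "b \<in> S (\<not> False)" using xz(2) unfolding S'_def by blast
    have "y = (a + b) + (f + g) \<cdot> e" unfolding xz(3) a(1) b(1) by (simp add: act_add_poly algebra_simps)
    then show ?thesis using totalI[of a S False b] a(2) b(2) by blast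
  qed
  ultimately show thesis by (rule that[OF n sub])
qed

lemma total_mono: "(\<And>k. S k \<subseteq> S' k) \<Longrightarrow> total S \<subseteq> total S'"
  unfolding total_def by blast

text \<open>A graded submodule that has to contain the image under p(u) of the whole splitting. It
  stays fixed while \<open>S\<close> grows, so the dimensions of its traces on the chain can measure
  the progress of the recursions in \<open>solve\<close> and \<open>reach\<close>.\<close>

definition target :: "(bool \<Rightarrow> 'v set) \<Rightarrow> 'v set \<Rightarrow> bool"
  where "target S Z \<longleftrightarrow> act.subspace Z \<and> Z \<subseteq> total S \<and> (\<forall>y\<in>total S. p \<cdot> y \<in> Z) \<and>
    (\<forall>i. \<forall>a\<in>S i. \<forall>b\<in>S (\<not> i). a + b \<in> Z \<longrightarrow> a \<in> Z)"

lemma targetD: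
  assumes "target S Z"
  shows "act.subspace Z" "Z \<subseteq> total S" "y \<in> total S \<Longrightarrow> p \<cdot> y \<in> Z"
    "a \<in> S i \<Longrightarrow> b \<in> S (\<not> i) \<Longrightarrow> a + b \<in> Z \<Longrightarrow> a \<in> Z"
  using assms unfolding target_def by blast+

text \<open>The elements of \<open>Z\<close> already decompose in \<open>S\<close>, and by
  uniqueness their parts in \<open>S'\<close> are the same.\<close>

lemma target_extend:
  assumes Z: "target S Z" and n: "nice S" "nice S'" and sub: "\<And>k. S k \<subseteq> S' k"
    and p: "\<And>y. y \<in> total S' \<Longrightarrow> p \<cdot> y \<in> Z"
  shows "target S' Z"
  unfolding target_def
proof (intro conjI allI ballI impI)
  show "act.subspace Z" by (rule targetD(1)[OF Z])
  show "Z \<subseteq> total S'" using targetD(2)[OF Z] total_mono[OF sub] by (rule order_trans)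
  fix i a b assume a: "a \<in> S' i" and b: "b \<in> S' (\<not> i)" and ab: "a + b \<in> Z"
  note gr' = nice_graded[OF n(2)]
  obtain a' b' where a': "a' \<in> S i" "b' \<in> S (\<not> i)" "a + b = a' + b'"
    using totalE[of "a + b" S i] ab targetD(2)[OF Z] by blast
  have "a - a' = b' - b" using a'(3) by (simp add: algebra_simps)
  moreover have "a - a' \<in> S' i"
    by (rule subspace_diff[OF graded_subspace[OF gr'] a]) (rule subsetD[OF sub a'(1)])
  moreover have "b' - b \<in> S' (\<not> i)"
    by (rule subspace_diff[OF graded_subspace[OF gr'] _ b]) (rule subsetD[OF sub a'(2)])
  ultimately have "a - a' = 0" using graded_disjoint[OF gr'] by metis
  then show "a \<in> Z" using targetD(4)[OF Z a'(1,2)] ab a'(3) by simp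
qed (rule p)

lemma fin_dim_target:
  assumes "nice S" "target S Z" "C \<in> fam"
  shows "fin_dim_subspace (Z \<inter> C)"
  by (rule fin_dim_subspace_subset[OF fin_dim_total[OF nice_graded[OF assms(1)]]
      subspace_inter[OF act_subspace_imp_subspace[OF targetD(1)[OF assms(2)]] fam_subspace[OF assms(3)]]])
    (use targetD(2)[OF assms(2)] in blast)

lemma dim_target_less:
  assumes "nice S" "target S Z" "C \<in> fam" "E \<in> fam" "E \<subseteq> C" "z \<in> Z" "z \<in> act p ` C" "z \<notin> act p ` E"
  shows "dim (Z \<inter> act p ` E) < dim (Z \<inter> act p ` C)"
proof (rule dim_strict_mono)
  show "fin_dim_subspace (Z \<inter> act p ` C)"
    by (rule fin_dim_target[OF assms(1,2) fam_image[OF assms(3)]])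
  show "subspace (Z \<inter> act p ` E)"
    using fin_dim_target[OF assms(1,2) fam_image[OF assms(4)]] unfolding fin_dim_subspace_def by (rule conjunct1)
  show "Z \<inter> act p ` E \<subset> Z \<inter> act p ` C"
    using image_mono[OF assms(5), of "act p"] assms(6-8) by blast
qed

text \<open>If the members of \<open>fam\<close> whose image contains \<open>z\<close> have a least element, a preimage of \<open>z\<close> in it is proper unless
  it can be moved deeper by an element of \<open>S\<close>, and then the trace of the chain on \<open>Z\<close> shrinks. If not, a
  preimage in a member that meets \<open>S\<close> in the least possible subspace is proper.\<close>

lemma solve:
  assumes S: "nice S" and Z: "target S Z"
    and "C \<in> fam" "z \<in> S i" "z \<in> Z" "z \<in> act p ` C"
  shows "\<exists>S' e. nice S' \<and> (\<forall>k. S k \<subseteq> S' k) \<and> (\<forall>y\<in>total S'. \<exists>s\<in>total S. y - s \<in> C) \<and>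
    (\<forall>y\<in>total S'. p \<cdot> y \<in> Z) \<and> e \<in> total S' \<and> e \<in> C \<and> p \<cdot> e = z"
  using assms(3-6)
proof (induction "dim (Z \<inter> act p ` C)" arbitrary: C z rule: less_induct)
  case less
  note C = less.prems(1) and z = less.prems(2-4)
  note gr = nice_graded[OF S]
  \<comment> \<open>Adjoining a proper preimage of \<open>z\<close> that lies in \<open>C\<close>
    settles the claim.\<close>
  have adj: ?case if D: "D \<in> fam" "D \<subseteq> C" "e \<in> D" "p \<cdot> e = z" "proper S e" for e D
  proof -
    have "p \<cdot> e \<in> S i" using D(4) z(1) by simp
    from adjoin_total[OF S this D(5)] obtain S' where S': "nice S'" "\<And>k. S k \<subseteq> S' k" "e \<in> total S'"
      "\<And>y. y \<in> total S' \<Longrightarrow> \<exists>s\<in>total S. \<exists>f. y = s + f \<cdot> e" by metis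
    have "(\<exists>s\<in>total S. y - s \<in> C) \<and> p \<cdot> y \<in> Z" if y: "y \<in> total S'" for y
    proof -
      obtain s f where s: "s \<in> total S" "y = s + f \<cdot> e" using S'(4)[OF y] by blast
      have "f \<cdot> e \<in> C" using fam_scale[OF D(1,3)] D(2) by blast
      then have "y - s \<in> C" unfolding s(2) by simp
      moreover have "p \<cdot> y = p \<cdot> s + f \<cdot> z"
        unfolding s(2) act_add D(4)[symmetric] by (simp only: act.scale_left_commute)
      moreover have "p \<cdot> s + f \<cdot> z \<in> Z"
        by (intro act.subspace_add[OF targetD(1)[OF Z]] act.subspace_scale[OF targetD(1)[OF Z]]
            targetD(3)[OF Z] s(1) z(2))
      ultimately show ?thesis using s(1) by metis
    qed
    moreover have "e \<in> C" using D(2,3) by blast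
    ultimately show ?thesis using S'(1-3) D(4) by blast
  qed
  define M where "M = {D \<in> fam. D \<subseteq> C \<and> z \<in> act p ` D}"
  have M: "D \<in> fam" "D \<subseteq> C" "z \<in> act p ` D" if "D \<in> M" for D
    using that unfolding M_def by blast+
  have CM: "C \<in> M" unfolding M_def using C z(3) by blast
  define D0 where "D0 = \<Inter>M"
  have D0: "D0 \<in> fam" unfolding D0_def by (rule iterated_images.Inter) (rule M(1))
  have D0C: "D0 \<subseteq> C" unfolding D0_def by (rule Inter_lower[OF CM])
  show ?case
  proof (cases "z \<in> act p ` D0")
    case True
    then obtain e where e: "e \<in> D0" "p \<cdot> e = z" by blast
    show ?thesis
    proof (cases "act p ` D0 \<noteq> D0 \<and> (\<exists>s\<in>total S. e + s \<in> act p ` D0)")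
      case False
      have "proper S e"
        unfolding proper_def
      proof (intro ballI impI)
        fix E s assume E: "E \<in> fam" and s: "s \<in> total S" and es: "e + s \<in> E"
        show "e \<in> E"
        proof (cases "D0 \<subseteq> E")
          case True
          then show ?thesis using e(1) by blast
        next
          case not: False
          then have "E \<subseteq> act p ` D0" by (rule fam_cases[OF D0 E])
          then have "act p ` D0 = D0" using False s es by blast
          then have "D0 \<subseteq> E" using iterated_images_fixed_least E by metis
          then show ?thesis using not by blast
        qed
      qed
      then show ?thesis by (rule adj[OF D0 D0C e])
    next
      case True
      then obtain s where ne: "act p ` D0 \<noteq> D0" and s: "s \<in> total S" "e + s \<in> act p ` D0" by blast
      \<comment> \<open>The degree \<open>i \<noteq> \<pi>\<close> is the one that p(u) carries to
        \<open>i\<close>, so \<open>z + p \<cdot> a\<close> remains homogeneous of degree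
        \<open>i\<close>; niceness then separates it from \<open>p \<cdot> b\<close>.\<close>
      obtain a b where ab: "a \<in> S (i \<noteq> \<pi>)" "b \<in> S (\<not> (i \<noteq> \<pi>))" "s = a + b" using totalE[OF s(1)] by blast
      note pD0 = fam_image[OF D0]
      note ppD0 = fam_image[OF pD0]
      have pa: "p \<cdot> a \<in> S i" "p \<cdot> b \<in> S (\<not> i)"
        using graded_act[OF gr hom ab(1)] graded_act[OF gr hom ab(2)] by (auto elim: back_subst[of "\<lambda>b. _ \<in> S b"])
      have za: "z + p \<cdot> a \<in> S i" by (rule subspace_add[OF graded_subspace[OF gr] z(1) pa(1)])
      have "(z + p \<cdot> a) + p \<cdot> b = p \<cdot> (e + s)" by (simp add: ab(3) act_add e(2) add.assoc)
      also have "\<dots> \<in> act p ` act p ` D0" using s(2) by (rule imageI)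
      finally have zpp: "z + p \<cdot> a \<in> act p ` act p ` D0" by (rule nice_component(1)[OF S ppD0 za pa(2)])
      have zZ: "z + p \<cdot> a \<in> Z"
        by (intro act.subspace_add[OF targetD(1)[OF Z]] z(2) targetD(3)[OF Z] total_component[OF gr ab(1)])
      \<comment> \<open>If \<open>z\<close> were in p^2(D0), then p(D0) would belong to
        \<open>M\<close>, although it is strictly smaller than the intersection \<open>D0\<close>.
        So \<open>z\<close> drops out of the trace, whose dimension decreases.\<close>
      have "z \<notin> act p ` act p ` D0"
      proof
        assume "z \<in> act p ` act p ` D0"
        then have "act p ` D0 \<in> M"
          unfolding M_def using pD0 fam_image_subset[OF D0] D0C by blast
        then have "D0 \<subseteq> act p ` D0" unfolding D0_def by (rule Inter_lower)
        then show False using ne fam_image_subset[OF D0] by blast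
      qed
      moreover have pC: "act p ` D0 \<subseteq> C" using fam_image_subset[OF D0] D0C by (rule order_trans)
      ultimately have "dim (Z \<inter> act p ` act p ` D0) < dim (Z \<inter> act p ` C)"
        using dim_target_less[OF S Z C pD0 _ z(2,3)] by blast
      from less.hyps[OF this pD0 za zZ zpp] obtain S' e' where S': "nice S'" "\<forall>k. S k \<subseteq> S' k"
        "\<forall>y\<in>total S'. \<exists>s\<in>total S. y - s \<in> act p ` D0" "\<forall>y\<in>total S'. p \<cdot> y \<in> Z"
        "e' \<in> total S'" "e' \<in> act p ` D0" "p \<cdot> e' = z + p \<cdot> a" by (elim exE conjE)
      \<comment> \<open>This puts \<open>s\<close>, and with it the part \<open>a\<close>, into
        \<open>C\<close>. Subtracting \<open>a\<close> from the solution \<open>e'\<close> for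
        \<open>z + p \<cdot> a\<close> then gives a solution for \<open>z\<close> inside
        \<open>C\<close>.\<close>
      have "s = (e + s) - e" by simp
      also have "\<dots> \<in> C" using s(2) pC e(1) D0C by (intro fam_diff[OF C]) blast+
      finally have "a \<in> C" using nice_component(1)[OF S C ab(1,2)] ab(3) by blast
      then have "e' - a \<in> C" using S'(6) pC by (intro fam_diff[OF C]) blast+
      moreover have "e' - a \<in> total S'"
        using S'(5) total_component[OF gr ab(1)] total_mono[of S S'] S'(2)
        by (intro total_diff[OF nice_graded[OF S'(1)]]) blast+
      moreover have "p \<cdot> (e' - a) = z" by (simp add: act.scale_right_diff_distrib S'(7))
      moreover have "\<forall>y\<in>total S'. \<exists>s\<in>total S. y - s \<in> C" using S'(3) pC by blast
      ultimately show ?thesis using S'(1,2,4) by blast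
    qed
  next
    case False
    have "M \<noteq> {}" using CM by blast
    moreover have "subspace D" if "D \<in> M" for D by (rule fam_subspace[OF M(1)[OF that]])
    moreover have "D \<subseteq> E \<or> E \<subseteq> D" if "D \<in> M" "E \<in> M" for D E
      by (rule iterated_images_linear[OF M(1)[OF that(1)] M(1)[OF that(2)]])
    ultimately obtain D where D: "D \<in> M" "\<And>E. E \<in> M \<Longrightarrow> total S \<inter> D \<subseteq> E"
      using chain_min_meet[OF fin_dim_total[OF gr], of M] by metis
    have DD0: "total S \<inter> D \<subseteq> D0" unfolding D0_def by (rule Inter_greatest) (rule D(2))
    note Df = M(1)[OF D(1)]
    obtain e where e: "e \<in> D" "p \<cdot> e = z" using M(3)[OF D(1)] by blast
    have "proper S e"
      unfolding proper_def
    proof (intro ballI impI)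
      fix E s assume E: "E \<in> fam" and s: "s \<in> total S" and es: "e + s \<in> E"
      show "e \<in> E"
      proof (cases "D \<subseteq> E")
        case True
        then show ?thesis using e(1) by blast
      next
        case not: False
        then have "E \<subseteq> D" using iterated_images_linear[OF Df E] by blast
        then have "(e + s) - e \<in> D" using es e(1) by (intro fam_diff[OF Df]) blast+
        then have sD0: "s \<in> D0" using DD0 s by auto
        \<comment> \<open>If \<open>E\<close> were contained in p(D0), both
          \<open>p \<cdot> (e + s)\<close> and \<open>p \<cdot> s\<close> would lie in p(D0), and so
          would \<open>z\<close>.\<close>
        have "D0 \<subseteq> E"
        proof (rule ccontr)
          assume "\<not> D0 \<subseteq> E"
          then have "e + s \<in> act p ` D0" using fam_cases[OF D0 E] es by blast
          then have "p \<cdot> (e + s) \<in> act p ` D0" by (rule fam_scale[OF fam_image[OF D0]])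
          moreover have "p \<cdot> s \<in> act p ` D0" using sD0 by (rule imageI)
          ultimately have "p \<cdot> (e + s) - p \<cdot> s \<in> act p ` D0" by (rule fam_diff[OF fam_image[OF D0]])
          then show False using False e(2) by (simp add: act_add)
        qed
        then have "(e + s) - s \<in> E" using sD0 es by (intro fam_diff[OF E]) blast+
        then show ?thesis by simp
      qed
    qed
    then show ?thesis by (rule adj[OF Df M(2)[OF D(1)] e])
  qed
qed

end

text \<open>The coset of \<open>x\<close> modulo \<open>S\<close> attains its greatest height. For a
  member with the least trace on \<open>S\<close>, one translate \<open>x + s\<close> in it serves
  all members that meet the coset: it differs from a translate in a smaller member by an element of
  that trace.\<close>

lemma (in endomorphism) least_meeting_translate:
  assumes S: "fin_dim_subspace S" and C: "C \<in> iterated_images (act g)" "x \<in> C"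
  obtains D s where "D \<in> iterated_images (act g)" "D \<subseteq> C" "s \<in> S" "x + s \<in> D"
    "\<And>E t. E \<in> iterated_images (act g) \<Longrightarrow> t \<in> S \<Longrightarrow> x + t \<in> E \<Longrightarrow> D \<subseteq> E"
proof -
  have sS: "subspace S" using S by (simp add: fin_dim_subspace_def)
  define M where "M = {E \<in> iterated_images (act g). \<exists>t\<in>S. x + t \<in> E}"
  have MI: "E \<in> M" if "E \<in> iterated_images (act g)" "t \<in> S" "x + t \<in> E" for E t
    unfolding M_def using that by blast
  have ME: "E \<in> iterated_images (act g)" "\<exists>t\<in>S. x + t \<in> E" if "E \<in> M" for E
    using that unfolding M_def by simp_all
  have CM: "C \<in> M" by (rule MI[OF C(1) subspace_0[OF sS]]) (simp add: C(2))
  then have "M \<noteq> {}" by (metis empty_iff)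
  moreover have sub: "subspace D" if "D \<in> M" for D by (rule subspace_iterated_images[OF ME(1)[OF that]])
  moreover have "D \<subseteq> E \<or> E \<subseteq> D" if "D \<in> M" "E \<in> M" for D E
    by (rule iterated_images_linear[OF ME(1)[OF that(1)] ME(1)[OF that(2)]])
  ultimately obtain D where D: "D \<in> M" "\<And>E. E \<in> M \<Longrightarrow> S \<inter> D \<subseteq> E"
    using chain_min_meet[OF S, of M] by metis
  obtain s where s: "s \<in> S" "x + s \<in> D" using ME(2)[OF D(1)] by blast
  have inE: "x + s \<in> E" if E: "E \<in> M" for E
  proof (cases "D \<subseteq> E")
    case True
    then show ?thesis using s(2) by blast
  next
    case False
    then have "E \<subseteq> D" using iterated_images_linear[OF ME(1)[OF D(1)] ME(1)[OF E]] by blast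
    obtain t where t: "t \<in> S" "x + t \<in> E" using ME(2)[OF E] by blast
    have "(x + t) - (x + s) \<in> D"
      using \<open>E \<subseteq> D\<close> t(2) s(2) by (intro subspace_diff[OF sub[OF D(1)]]) blast+
    then have "t - s \<in> S \<inter> D" using subspace_diff[OF sS t(1) s(1)] by simp
    then have "t - s \<in> E" using D(2)[OF E] by blast
    then have "(x + t) - (t - s) \<in> E" by (rule subspace_diff[OF sub[OF E] t(2)])
    then show ?thesis by (simp add: algebra_simps)
  qed
  have I: "\<Inter>M \<in> iterated_images (act g)" by (rule iterated_images.Inter) (rule ME(1))
  have "x + s \<in> \<Inter>M" by (rule InterI) (rule inE)
  moreover have "\<Inter>M \<subseteq> E" if "E \<in> iterated_images (act g)" "t \<in> S" "x + t \<in> E" for E t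
    by (rule Inter_lower) (rule MI[OF that])
  ultimately show thesis using that[OF I Inter_lower[OF CM] s(1)] by metis
qed

section \<open>Absorbing a vector of the primary component into a graded splitting\<close>

context homogeneous_prime
begin

text \<open>Let y be a deepest vector in the coset of \<open>x\<close> modulo
  \<open>total S\<close>. If vectors of \<open>S\<close> in \<open>D\<close> can move p y into
  p^2(D), the two parts are solved inside p(D), and the remainder, killed by p, is adjoined.
  Otherwise one part of p y cannot be moved there, and a preimage of it in \<open>D\<close> is
  proper and can be adjoined. What remains is then proper as well, or it has a deeper translate,
  where the trace on \<open>Z\<close> is smaller.\<close>

lemma reach:
  assumes "nice S" "target S Z" "p \<cdot> x \<in> Z" "C \<in> fam" "x \<in> C"
  shows "\<exists>S'. nice S' \<and> (\<forall>k. S k \<subseteq> S' k) \<and> x \<in> total S'"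
  using assms
proof (induction "dim (Z \<inter> act p ` C)" arbitrary: S x C rule: less_induct)
  case less
  note S = less.prems(1) and Z = less.prems(2)
  note gr = nice_graded[OF S]
  obtain D s where D: "D \<in> fam" "D \<subseteq> C" and s: "s \<in> total S" and yD: "x + s \<in> D"
    and least: "\<And>E t. E \<in> fam \<Longrightarrow> t \<in> total S \<Longrightarrow> x + t \<in> E \<Longrightarrow> D \<subseteq> E"
    using least_meeting_translate[OF fin_dim_total[OF gr] less.prems(4,5)] by metis
  define y where "y = x + s"
  note yD = yD[folded y_def]
  have x_from_y: "?case" if S': "nice S'" "\<And>k. S k \<subseteq> S' k" "y \<in> total S'" for S'
  proof -
    have "y - s \<in> total S'"
      using total_mono[of S S', OF S'(2)] s by (intro total_diff[OF nice_graded[OF S'(1)] S'(3)]) blast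
    then show ?thesis using S'(1,2) unfolding y_def by (intro exI[of _ S']) simp
  qed
  note pD = fam_image[OF D(1)]
  note ppD = fam_image[OF pD]
  \<comment> \<open>The coset of \<open>x\<close> meets p(D) only if \<open>D\<close> is fixed, and
    a fixed member is contained in all others.\<close>
  have no_pD: "D \<subseteq> E" if E: "E \<in> fam" "x + t \<in> act p ` D" "t \<in> total S" for E t
  proof -
    have "D \<subseteq> act p ` D" by (rule least[OF pD E(3,2)])
    then have "act p ` D = D" using fam_image_subset[OF D(1)] by (intro subset_antisym)
    then show ?thesis by (rule iterated_images_fixed_least[OF _ E(1)])
  qed
  have pyZ: "p \<cdot> y \<in> Z"
    unfolding y_def act_add by (intro act.subspace_add[OF targetD(1)[OF Z]] less.prems(3) targetD(3)[OF Z] s)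
  have pyD: "p \<cdot> y \<in> act p ` D" using yD by (rule imageI)
  show ?case
  proof (cases "\<exists>t\<in>total S. t \<in> D \<and> p \<cdot> (y + t) \<in> act p ` act p ` D")
    case True
    then obtain t where t: "t \<in> total S" "t \<in> D" "p \<cdot> (y + t) \<in> act p ` act p ` D" by blast
    have ptZ: "p \<cdot> (y + t) \<in> Z"
      unfolding act_add by (intro act.subspace_add[OF targetD(1)[OF Z]] pyZ targetD(3)[OF Z] t(1))
    obtain a b where ab: "a \<in> S False" "b \<in> S (\<not> False)" "p \<cdot> (y + t) = a + b"
      using totalE[of "p \<cdot> (y + t)" S False] ptZ targetD(2)[OF Z] by blast
    have aZ: "a \<in> Z" using targetD(4)[OF Z ab(1,2)] ptZ ab(3) by simp
    have "(a + b) - a \<in> Z" using ptZ ab(3) aZ by (intro act.subspace_diff[OF targetD(1)[OF Z]]) simp_all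
    then have bZ: "b \<in> Z" by simp
    have app: "a \<in> act p ` act p ` D" "b \<in> act p ` act p ` D"
      using nice_component[OF S ppD ab(1,2)] t(3) ab(3) by simp_all
    obtain S1 e where S1: "nice S1" "\<And>k. S k \<subseteq> S1 k" "\<And>v. v \<in> total S1 \<Longrightarrow> \<exists>w\<in>total S. v - w \<in> act p ` D"
      "\<And>v. v \<in> total S1 \<Longrightarrow> p \<cdot> v \<in> Z" "e \<in> total S1" "e \<in> act p ` D" "p \<cdot> e = a"
      using solve[OF S Z pD ab(1) aZ app(1)] by blast
    have Z1: "target S1 Z" by (rule target_extend[OF Z S S1(1,2,4)])
    have bS1: "b \<in> S1 (\<not> False)" using S1(2) ab(2) by blast
    obtain S2 e' where S2: "nice S2" "\<And>k. S1 k \<subseteq> S2 k" "\<And>v. v \<in> total S2 \<Longrightarrow> \<exists>w\<in>total S1. v - w \<in> act p ` D"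
      "\<And>v. v \<in> total S2 \<Longrightarrow> p \<cdot> v \<in> Z" "e' \<in> total S2" "e' \<in> act p ` D" "p \<cdot> e' = b"
      using solve[OF S1(1) Z1 pD bS1 bZ app(2)] by blast
    note gr2 = nice_graded[OF S2(1)]
    define w where "w = y + t - e - e'"
    have "p \<cdot> w = a + b - a - b"
      unfolding w_def act.scale_right_diff_distrib ab(3) S1(7) S2(7) ..
    then have pw: "p \<cdot> w = 0" by simp
    have eD: "e \<in> D" "e' \<in> D" using S1(6) S2(6) fam_image_subset[OF D(1)] by blast+
    have wD: "w \<in> D" unfolding w_def by (intro fam_diff[OF D(1)] fam_add[OF D(1)] yD t(2) eD)
    \<comment> \<open>Both uses of \<open>solve\<close> enlarge the splitting only by vectors of
      p(D) modulo \<open>total S\<close>, so a translate of \<open>w\<close> in p(D) would give a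
      translate of \<open>x\<close> there.\<close>
    have "proper S2 w"
      unfolding proper_def
    proof (intro ballI impI)
      fix E v assume E: "E \<in> fam" and v: "v \<in> total S2" and wE: "w + v \<in> E"
      have "D \<subseteq> E"
      proof (rule ccontr)
        assume not: "\<not> D \<subseteq> E"
        then have EpD: "E \<subseteq> act p ` D" by (rule fam_cases[OF D(1) E])
        obtain v1 where v1: "v1 \<in> total S1" "v - v1 \<in> act p ` D" using S2(3)[OF v] by blast
        obtain v0 where v0: "v0 \<in> total S" "v1 - v0 \<in> act p ` D" using S1(3)[OF v1(1)] by blast
        have "x + (s + t + v0) = (w + v) + e + e' - (v - v1) - (v1 - v0)"
          unfolding w_def y_def by (simp add: algebra_simps)
        also have "\<dots> \<in> act p ` D"
          by (intro fam_diff[OF pD] fam_add[OF pD] subsetD[OF EpD wE] S1(6) S2(6) v1(2) v0(2))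
        finally have "D \<subseteq> E" by (rule no_pD[OF E]) (intro total_add[OF gr] s t(1) v0(1))
        then show False using not by blast
      qed
      then show "w \<in> E" using wD by blast
    qed
    \<comment> \<open>Zero lies in both summands, so the degree assigned to \<open>w\<close> is a
      free choice.\<close>
    moreover have "p \<cdot> w \<in> S2 False" unfolding pw by (rule graded_0[OF gr2])
    ultimately obtain S3 where S3: "nice S3" "\<And>k. S2 k \<subseteq> S3 k" "w \<in> total S3"
      using adjoin_total[OF S2(1)] by metis
    note gr3 = nice_graded[OF S3(1)]
    have sub: "S k \<subseteq> S3 k" for k using S1(2) S2(2) S3(2) by blast
    have "e \<in> total S3" using S1(5) total_mono[of S1 S3] S2(2) S3(2) by blast
    moreover have "e' \<in> total S3" using S2(5) total_mono[of S2 S3] S3(2) by blast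
    moreover have "t \<in> total S3" using t(1) total_mono[of S S3] sub by blast
    ultimately have "w + e + e' - t \<in> total S3"
      by (intro total_diff[OF gr3] total_add[OF gr3] S3(3))
    then have "y \<in> total S3" unfolding w_def by (simp add: algebra_simps)
    then show ?thesis by (rule x_from_y[OF S3(1) sub])
  next
    case False
    \<comment> \<open>If both parts of \<open>p \<cdot> y\<close> could be moved into p^2(D), the
      sum of the two corrections would move \<open>p \<cdot> y\<close> itself.\<close>
    have split: "\<exists>i a b. a \<in> S i \<and> b \<in> S (\<not> i) \<and> p \<cdot> y = a + b \<and>
        \<not> (\<exists>t\<in>total S. t \<in> D \<and> a + p \<cdot> t \<in> act p ` act p ` D)"
    proof (rule ccontr)
      assume neg: "\<not> ?thesis"
      obtain a b where ab: "a \<in> S False" "b \<in> S (\<not> False)" "p \<cdot> y = a + b"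
        using totalE[of "p \<cdot> y" S False] pyZ targetD(2)[OF Z] by blast
      obtain t where t: "t \<in> total S" "t \<in> D" "a + p \<cdot> t \<in> act p ` act p ` D"
        using neg ab by blast
      have "b \<in> S True" "a \<in> S (\<not> True)" "p \<cdot> y = b + a" using ab by (simp_all add: add.commute)
      then obtain t' where t': "t' \<in> total S" "t' \<in> D" "b + p \<cdot> t' \<in> act p ` act p ` D"
        using neg by blast
      have "p \<cdot> (y + (t + t')) = (a + p \<cdot> t) + (b + p \<cdot> t')"
        unfolding act_add ab(3) by (simp add: algebra_simps)
      also have "\<dots> \<in> act p ` act p ` D" by (rule fam_add[OF ppD t(3) t'(3)])
      finally show False
        using False total_add[OF gr t(1) t'(1)] fam_add[OF D(1) t(2) t'(2)] by blast
    qed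
    then obtain i a b where ab: "a \<in> S i" "b \<in> S (\<not> i)" "p \<cdot> y = a + b"
      and na: "\<And>t. t \<in> total S \<Longrightarrow> t \<in> D \<Longrightarrow> a + p \<cdot> t \<notin> act p ` act p ` D" by blast
    have aZ: "a \<in> Z" using targetD(4)[OF Z ab(1,2)] pyZ ab(3) by simp
    have "a \<in> act p ` D" using nice_component(1)[OF S pD ab(1,2)] pyD ab(3) by simp
    then obtain e where e: "e \<in> D" "p \<cdot> e = a" by blast
    have "proper S e"
      unfolding proper_def
    proof (intro ballI impI)
      fix E v assume E: "E \<in> fam" and v: "v \<in> total S" and eE: "e + v \<in> E"
      have "D \<subseteq> E"
      proof (rule ccontr)
        assume "\<not> D \<subseteq> E"
        then have ev: "e + v \<in> act p ` D" using fam_cases[OF D(1) E] eE by blast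
        then have "(e + v) - e \<in> D"
          using fam_image_subset[OF D(1)] by (intro fam_diff[OF D(1) _ e(1)]) blast
        then have "v \<in> D" by simp
        moreover have "a + p \<cdot> v \<in> act p ` act p ` D"
          using imageI[OF ev, of "act p"] by (simp only: act_add e(2))
        ultimately show False using na[OF v] by blast
      qed
      then show "e \<in> E" using e(1) by blast
    qed
    moreover have "p \<cdot> e \<in> S i" using e(2) ab(1) by simp
    ultimately obtain S1 where S1: "nice S1" "\<And>k. S k \<subseteq> S1 k" "e \<in> total S1"
      "\<And>v. v \<in> total S1 \<Longrightarrow> \<exists>w\<in>total S. \<exists>f. v = w + f \<cdot> e"
      using adjoin_total[OF S] by metis
    note gr1 = nice_graded[OF S1(1)]
    have "p \<cdot> v \<in> Z" if v: "v \<in> total S1" for v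
    proof -
      obtain w f where w: "w \<in> total S" "v = w + f \<cdot> e" using S1(4)[OF v] by blast
      have "p \<cdot> v = p \<cdot> w + f \<cdot> a"
        unfolding w(2) act_add e(2)[symmetric] by (simp only: act.scale_left_commute)
      also have "\<dots> \<in> Z"
        by (intro act.subspace_add[OF targetD(1)[OF Z]] act.subspace_scale[OF targetD(1)[OF Z]]
            targetD(3)[OF Z] w(1) aZ)
      finally show ?thesis .
    qed
    then have Z1: "target S1 Z" by (rule target_extend[OF Z S S1(1,2)])
    have py1: "p \<cdot> (y - e) = b" by (simp add: act.scale_right_diff_distrib ab(3) e(2))
    have y1D: "y - e \<in> D" by (rule fam_diff[OF D(1) yD e(1)])
    have finish: ?thesis if S2: "nice S2" "\<And>k. S1 k \<subseteq> S2 k" "y - e \<in> total S2" for S2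
    proof (rule x_from_y[OF S2(1)])
      show "S k \<subseteq> S2 k" for k using S1(2) S2(2) by blast
      have "(y - e) + e \<in> total S2"
        using total_mono[of S1 S2, OF S2(2)] S1(3) by (intro total_add[OF nice_graded[OF S2(1)] S2(3)]) blast
      then show "y \<in> total S2" by simp
    qed
    show ?thesis
    proof (cases "proper S1 (y - e)")
      case True
      have "p \<cdot> (y - e) \<in> S1 (\<not> i)" unfolding py1 using S1(2) ab(2) by blast
      then obtain S2 where "nice S2" "\<And>k. S1 k \<subseteq> S2 k" "y - e \<in> total S2"
        using adjoin_total[OF S1(1) _ True] by metis
      then show ?thesis by (rule finish)
    next
      case False
      then obtain E v where E: "E \<in> fam" and v: "v \<in> total S1" and vE: "y - e + v \<in> E" and "y - e \<notin> E"
        unfolding proper_def by blast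
      then have "\<not> D \<subseteq> E" using y1D by blast
      then have EpD: "E \<subseteq> act p ` D" by (rule fam_cases[OF D(1) E])
      \<comment> \<open>With the correction 0, \<open>a\<close> is not in p^2(D), hence not in p(E),
        while it is in p(C). This makes the measure decrease.\<close>
      have "a + p \<cdot> 0 \<notin> act p ` act p ` D"
        by (rule na[OF total_0[OF gr]]) (rule subspace_0[OF fam_subspace[OF D(1)]])
      then have "a \<notin> act p ` E" using image_mono[OF EpD, of "act p"] by auto
      moreover have "E \<subseteq> C" using EpD fam_image_subset[OF D(1)] D(2) by blast
      moreover have "a \<in> act p ` C" using \<open>a \<in> act p ` D\<close> D(2) by blast
      ultimately have "dim (Z \<inter> act p ` E) < dim (Z \<inter> act p ` C)"
        using dim_target_less[OF S Z less.prems(4) E _ aZ] by blast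
      moreover have "p \<cdot> (y - e + v) \<in> Z"
      proof -
        have "(a + b) - a \<in> Z" using pyZ ab(3) aZ by (intro act.subspace_diff[OF targetD(1)[OF Z]]) simp_all
        then have "b \<in> Z" by simp
        then show ?thesis unfolding act_add py1
          by (intro act.subspace_add[OF targetD(1)[OF Z]] targetD(3)[OF Z1] v)
      qed
      ultimately obtain S2 where S2: "nice S2" "\<And>k. S1 k \<subseteq> S2 k" "y - e + v \<in> total S2"
        using less.hyps[OF _ S1(1) Z1 _ E vE] by blast
      have "(y - e + v) - v \<in> total S2"
        using total_mono[of S1 S2, OF S2(2)] v by (intro total_diff[OF nice_graded[OF S2(1)] S2(3)]) blast
      then have "y - e \<in> total S2" by simp
      then show ?thesis by (rule finish[OF S2(1,2)])
    qed
  qed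
qed

lemma reach_primary:
  "nice S \<Longrightarrow> p ^ n \<cdot> x = 0 \<Longrightarrow> \<exists>S'. nice S' \<and> (\<forall>k. S k \<subseteq> S' k) \<and> x \<in> total S'"
proof (induction n arbitrary: x)
  case 0
  then have "x = 0" by (simp add: act_1)
  then show ?case using total_0[OF nice_graded[OF 0(1)]] 0(1) by blast
next
  case (Suc n)
  have "p ^ n \<cdot> p \<cdot> x = 0" using Suc.prems(2) by (simp only: power_Suc2 act_mult)
  then obtain S1 where S1: "nice S1" "\<And>k. S k \<subseteq> S1 k" "p \<cdot> x \<in> total S1"
    using Suc.IH[OF Suc.prems(1)] by blast
  note gr1 = nice_graded[OF S1(1)]
  \<comment> \<open>For each new exponent the recursion starts afresh, with the whole of
    \<open>total S1\<close> as \<open>Z\<close> and the whole space as \<open>C\<close>.\<close>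
  have "target S1 (total S1)"
    unfolding target_def
    by (intro conjI allI ballI impI act_subspace_total[OF gr1] subset_refl total_scale[OF gr1])
      (assumption | rule total_component[OF gr1])+
  then obtain S2 where "nice S2" "\<And>k. S1 k \<subseteq> S2 k" "x \<in> total S2"
    using reach[OF S1(1) _ S1(3) UNIV_in_iterated_images UNIV_I] by blast
  then show ?case using S1(2) by (intro exI[of _ S2]) blast
qed

lemma homogeneous_swap_split:
  assumes "countable_dim scale"
  shows "swap_split (primary p)"
proof (rule exhaust_swap_split[where P = "\<lambda>A B. nice (\<lambda>k. if k then B else A)", OF assms subspace_primary])
  have "graded (\<lambda>k. {0})"
    unfolding graded_def fin_dim_subspace_def
    using subspace_0[OF subspace_primary[of p]] by (auto simp: u.zero intro: exI[of _ "{}"])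
  then show "nice (\<lambda>k. if k then {0} else {0})"
    unfolding nice_def by (auto simp: subspace_0[OF fam_subspace])
next
  fix A B assume n: "nice (\<lambda>k. if k then B else A)"
  note gr = nice_graded[OF n]
  show "swap_pair A B \<and> A \<subseteq> primary p \<and> B \<subseteq> primary p"
    using graded_subspace[OF gr, of False] graded_subspace[OF gr, of True] graded_u[OF gr, of _ False]
      graded_u[OF gr, of _ True] graded_primary[OF gr, of _ False] graded_primary[OF gr, of _ True]
      graded_disjoint[OF gr, of _ False] subspace_0[of A] subspace_0[of B]
    unfolding swap_pair_def by auto
  fix x assume "x \<in> primary p"
  then obtain m where "p ^ m \<cdot> x = 0" unfolding primary_def by blast
  from reach_primary[OF n this] obtain S where S: "nice S" "\<And>k. (if k then B else A) \<subseteq> S k" "x \<in> total S"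
    by blast
  have "(\<lambda>k. if k then S True else S False) = S" by (rule ext) simp
  then have "nice (\<lambda>k. if k then S True else S False)" using S(1) by simp
  moreover have "A \<subseteq> S False" "B \<subseteq> S True" using S(2)[of False] S(2)[of True] by simp_all
  moreover have "\<exists>a\<in>S False. \<exists>b\<in>S True. x = a + b" using S(3) unfolding total_def by blast
  ultimately show "\<exists>A' B'. nice (\<lambda>k. if k then B' else A') \<and> A \<subseteq> A' \<and> B \<subseteq> B' \<and> (\<exists>a\<in>A'. \<exists>b\<in>B'. x = a + b)"
    by blast
qed

end

subsection \<open>Primary components of mixed parity\<close>

locale mixed_prime = endomorphism scale u
  for scale :: "'f::field \<Rightarrow> 'v::ab_group_add \<Rightarrow> 'v" and u +
  fixes p :: "'f poly"
  assumes char_2: "CHAR('f) = 2" and p_Irr: "p \<in> Irr - {monom 1 1}" and mixed: "\<not> homogeneous False p"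
    and torsion: "\<And>C x. C \<in> iterated_images (act (p * p)) \<Longrightarrow> x \<in> C \<Longrightarrow> p \<cdot> x = 0 \<Longrightarrow> x \<in> act p ` C"
begin

text \<open>Only the square of \<open>p\<close> is homogeneous here, so its chain takes the place of
  the chain of \<open>p\<close>.\<close>

abbreviation "fam \<equiv> iterated_images (act (p * p))"

lemma irr: "irreducible p"
  using p_Irr by (simp add: Irr_def)

lemma even_square: "homogeneous False (p * p)"
  by (rule homogeneous_square[OF char_2])

lemma comaximal_square: "comaximal f p \<Longrightarrow> comaximal f (p * p)"
  using comaximal_mult comaximal_sym by metis

text \<open>A purely odd \<open>p\<close> would be divisible by t, which is comaximal to
  \<open>p\<close>.\<close>

lemma comaximal_odd_part: "comaximal (part True p) p"
proof -
  have "\<not> homogeneous True p"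
  proof
    assume "homogeneous True p"
    then have "coeff p 0 = 0" unfolding homogeneous_def by (metis even_zero)
    then obtain r where "p = pCons 0 r" by (cases p) simp
    then have "p = [:0, 1:] * r" by simp
    then have dvd: "[:0, 1:] dvd p" by (rule dvdI)
    obtain k l where kl: "k * [:0, 1:] + l * p = 1"
      using comaximal_X[OF p_Irr] unfolding comaximal_def by blast
    have "[:0, 1:] dvd k * [:0, 1:] + l * p"
      by (intro dvd_add dvd_triv_right dvd_mult[OF dvd])
    then have "is_unit [:0, 1 :: 'f:]" unfolding kl .
    then show False by (simp add: is_unit_iff_degree)
  qed
  then show ?thesis using comaximal_part_True[OF irr mixed] by blast
qed

text \<open>The source of the passage between u(T) and p(T): u(r b) is p b minus the even part of p
  applied to b, where \<open>r\<close> is even and invertible on primary vectors.\<close>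

lemma odd_part_factor:
  obtains r where "homogeneous False r" "p = part False p + [:0, 1:] * r" "comaximal r p"
proof -
  obtain c r where cr: "part True p = pCons c r" by (cases "part True p")
  have "c = 0" using coeff_part[of True p 0] cr by simp
  then have r: "part True p = [:0, 1:] * r" using cr by simp
  have "homogeneous False r"
    unfolding homogeneous_def
  proof (intro allI impI)
    fix i assume "coeff r i \<noteq> 0"
    then have "coeff (part True p) (Suc i) \<noteq> 0" using cr by simp
    then show "odd i = False" using homogeneous_part[of True p] unfolding homogeneous_def by fastforce
  qed
  moreover have "p = part False p + [:0, 1:] * r"
    using part_add_part[of False p] r by simp
  moreover have "comaximal r p"
  proof -
    obtain k l where "k * part True p + l * p = 1"
      using comaximal_odd_part unfolding comaximal_def by blast
    then have "(k * [:0, 1:]) * r + l * p = 1" unfolding r by (simp only: mult.assoc)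
    then show ?thesis unfolding comaximal_def by blast
  qed
  ultimately show thesis by (rule that)
qed

text \<open>Differentiating f = p g shows that p divides g p', and p' is invertible modulo p. Among
  the even polynomials, the square of p thus plays the part of a prime.\<close>

lemma even_dvd_square:
  assumes "homogeneous False f" "p dvd f"
  shows "p * p dvd f"
proof -
  obtain g where g: "f = p * g" using assms(2) by (elim dvdE)
  have "p * pderiv g + g * pderiv p = 0"
    using pderiv_homogeneous_even[OF char_2 assms(1)] unfolding g pderiv_mult .
  then have "g * pderiv p = - (p * pderiv g)" by (simp add: eq_neg_iff_add_eq_0 add.commute)
  then have "p dvd pderiv p * g" by (simp add: mult.commute)
  then have "p dvd g" by (rule comaximal_dvd_mult[OF comaximal_pderiv[OF char_2 irr mixed]])
  then show ?thesis unfolding g by (intro mult_dvd_mono) simp_all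
qed

text \<open>The odd part of f + p g is g times the odd part of p, and the latter is invertible
  modulo p^2. So 1 and p are independent over the even polynomials modulo p^2.\<close>

lemma even_dvd_split:
  assumes "homogeneous False f" "homogeneous False g" "p * p dvd f + p * g"
  shows "p * p dvd f" "p * p dvd g"
proof -
  have "p * p dvd part True (f + p * g)" by (rule dvd_part[OF even_square assms(3)])
  also have "part True (f + p * g) = part True p * g"
    using part_mult_homogeneous[OF assms(2), of True p] part_homogeneous[OF assms(1), of True]
    by (simp add: part_add mult.commute)
  finally show g: "p * p dvd g"
    by (rule comaximal_dvd_mult[OF comaximal_square[OF comaximal_odd_part]])
  then show "p * p dvd f" using assms(3) by (metis dvd_add_left_iff dvd_mult)
qed

lemma fam_add: "C \<in> fam \<Longrightarrow> x \<in> C \<Longrightarrow> y \<in> C \<Longrightarrow> x + y \<in> C"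
  by (rule subspace_add[OF subspace_iterated_images])

lemma fam_diff: "C \<in> fam \<Longrightarrow> x \<in> C \<Longrightarrow> y \<in> C \<Longrightarrow> x - y \<in> C"
  by (rule subspace_diff[OF subspace_iterated_images])

lemma fam_scale: "C \<in> fam \<Longrightarrow> x \<in> C \<Longrightarrow> f \<cdot> x \<in> C"
  by (rule act.subspace_scale[OF act_subspace_iterated_images])

section \<open>Splittings generated by modules over the even polynomials\<close>

definition total :: "'v set \<Rightarrow> 'v set"
  where "total T = {a + p \<cdot> b | a b. a \<in> T \<and> b \<in> T}"

text \<open>The partial splitting given by \<open>T\<close> is \<open>T \<oplus> u(T)\<close>, which equals \<open>T \<oplus> p(T)\<close>.\<close>

definition nice :: "'v set \<Rightarrow> bool"
  where "nice T \<longleftrightarrow> fin_dim_subspace T \<and> T \<subseteq> primary p \<and> (\<forall>a\<in>T. u (u a) \<in> T) \<and>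
    (\<forall>a\<in>T. \<forall>b\<in>T. a + p \<cdot> b = 0 \<longrightarrow> a = 0 \<and> b = 0) \<and>
    (\<forall>C\<in>fam. \<forall>a\<in>T. \<forall>b\<in>T. a + p \<cdot> b \<in> C \<longrightarrow> a \<in> C \<and> b \<in> C) \<and>
    (\<forall>C\<in>fam. \<forall>a\<in>T. a \<in> act p ` C \<longrightarrow> a \<in> act (p * p) ` C)"

context
  fixes T assumes T: "nice T"
begin

lemma nice_fin_dim: "fin_dim_subspace T" and nice_primary: "a \<in> T \<Longrightarrow> a \<in> primary p"
  and nice_u_u: "a \<in> T \<Longrightarrow> u (u a) \<in> T"
  and nice_indep: "a \<in> T \<Longrightarrow> b \<in> T \<Longrightarrow> a + p \<cdot> b = 0 \<Longrightarrow> a = 0 \<and> b = 0"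
  and nice_component: "C \<in> fam \<Longrightarrow> a \<in> T \<Longrightarrow> b \<in> T \<Longrightarrow> a + p \<cdot> b \<in> C \<Longrightarrow> a \<in> C \<and> b \<in> C"
  and nice_image: "C \<in> fam \<Longrightarrow> a \<in> T \<Longrightarrow> a \<in> act p ` C \<Longrightarrow> a \<in> act (p * p) ` C"
proof -
  note n = T[unfolded nice_def]
  show "fin_dim_subspace T" using n by (elim conjE)
  have 1: "T \<subseteq> primary p" using n by (elim conjE)
  show "a \<in> T \<Longrightarrow> a \<in> primary p" by (rule subsetD[OF 1])
  have 2: "\<forall>a\<in>T. u (u a) \<in> T" using n by (elim conjE)
  show "a \<in> T \<Longrightarrow> u (u a) \<in> T" by (rule bspec[OF 2])
  have 3: "\<forall>a\<in>T. \<forall>b\<in>T. a + p \<cdot> b = 0 \<longrightarrow> a = 0 \<and> b = 0" using n by (elim conjE)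
  show "a \<in> T \<Longrightarrow> b \<in> T \<Longrightarrow> a + p \<cdot> b = 0 \<Longrightarrow> a = 0 \<and> b = 0" by (rule 3[rule_format])
  have 4: "\<forall>C\<in>fam. \<forall>a\<in>T. \<forall>b\<in>T. a + p \<cdot> b \<in> C \<longrightarrow> a \<in> C \<and> b \<in> C" using n by (elim conjE)
  show "C \<in> fam \<Longrightarrow> a \<in> T \<Longrightarrow> b \<in> T \<Longrightarrow> a + p \<cdot> b \<in> C \<Longrightarrow> a \<in> C \<and> b \<in> C" by (rule 4[rule_format])
  have 5: "\<forall>C\<in>fam. \<forall>a\<in>T. a \<in> act p ` C \<longrightarrow> a \<in> act (p * p) ` C" using n by (elim conjE)
  show "C \<in> fam \<Longrightarrow> a \<in> T \<Longrightarrow> a \<in> act p ` C \<Longrightarrow> a \<in> act (p * p) ` C" by (rule 5[rule_format])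
qed

lemma nice_subspace: "subspace T"
  using nice_fin_dim by (simp add: fin_dim_subspace_def)

lemma even_act:
  assumes "homogeneous False f" "x \<in> T"
  shows "f \<cdot> x \<in> T"
proof -
  have pw: "(u ^^ n) x \<in> T" if "even n" for n
    using that
  proof (induction n rule: less_induct)
    case (less n)
    show ?case
    proof (cases n)
      case 0
      then show ?thesis using assms(2) by simp
    next
      case (Suc m)
      then obtain k where k: "n = Suc (Suc k)" using less.prems by (cases m) auto
      then have "(u ^^ k) x \<in> T" using less by simp
      then show ?thesis using nice_u_u k by simp
    qed
  qed
  have "scale (coeff f n) ((u ^^ n) x) \<in> T" for n
  proof (cases "coeff f n = 0")
    case True
    then show ?thesis using subspace_0[OF nice_subspace] by simp
  next
    case False
    then have "even n" using assms(1) unfolding homogeneous_def by blast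
    then show ?thesis using subspace_scale[OF nice_subspace pw] by simp
  qed
  then show ?thesis
    unfolding act_def poly_end_def by (intro subspace_sum nice_subspace)
qed

text \<open>The inverse of \<open>r\<close> modulo a power of the even polynomial
  \<open>p * p\<close> can be chosen even, and even polynomials preserve \<open>T\<close>.\<close>

lemma even_act_surj:
  assumes r: "homogeneous False r" "comaximal r p" and x: "x \<in> T"
  obtains y where "y \<in> T" "x = r \<cdot> y"
proof -
  obtain n where n: "p ^ n \<cdot> x = 0" using nice_primary[OF x] unfolding primary_def by blast
  have "(p * p) ^ n \<cdot> x = p ^ n \<cdot> p ^ n \<cdot> x" by (simp only: power_mult_distrib act_mult)
  then have z: "(p * p) ^ n \<cdot> x = 0" unfolding n act.scale_zero_right .
  have "homogeneous False ((p * p) ^ n)"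
  proof (induction n)
    case (Suc n)
    then show ?case using homogeneous_mult[OF even_square Suc] by simp
  qed simp
  moreover have "comaximal r ((p * p) ^ n)"
    by (rule comaximal_sym[OF comaximal_power[OF comaximal_sym[OF comaximal_square[OF r(2)]]]])
  ultimately obtain k l where k: "homogeneous False k" "k * r + l * (p * p) ^ n = 1"
    using comaximal_homogeneous_even[OF r(1)] by metis
  have "x = (k * r + l * (p * p) ^ n) \<cdot> x" unfolding k(2) by (rule act_1[symmetric])
  also have "\<dots> = k \<cdot> r \<cdot> x + l \<cdot> (p * p) ^ n \<cdot> x" by (simp only: act_add_poly act_mult)
  also have "\<dots> = r \<cdot> k \<cdot> x"
    unfolding z act.scale_zero_right add_0_right by (rule act.scale_left_commute)
  finally show thesis using that even_act[OF k(1) x] by blast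
qed

lemma total_component: "a \<in> T \<Longrightarrow> a \<in> total T" and total_image: "a \<in> T \<Longrightarrow> p \<cdot> a \<in> total T"
proof -
  assume a: "a \<in> T"
  have "a = a + p \<cdot> 0" "p \<cdot> a = 0 + p \<cdot> a" by simp_all
  then show "a \<in> total T" "p \<cdot> a \<in> total T"
    unfolding total_def using a subspace_0[OF nice_subspace] by blast+
qed

lemma subspace_total: "subspace (total T)"
proof -
  interpret P: Vector_Spaces.linear scale scale "act p" by (rule act_linear)
  have "total T = {a + b | a b. a \<in> T \<and> b \<in> act p ` T}" unfolding total_def by blast
  then show ?thesis
    using subspace_sums[OF nice_subspace P.subspace_image[OF nice_subspace]] by simp
qed

lemma u_total: "a \<in> T \<Longrightarrow> u a \<in> total T"
proof -
  assume a: "a \<in> T"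
  obtain r where r: "homogeneous False r" "p = part False p + [:0, 1:] * r" "comaximal r p"
    by (rule odd_part_factor)
  obtain b where b: "b \<in> T" "a = r \<cdot> b" by (rule even_act_surj[OF r(1,3) a])
  have "p \<cdot> b = part False p \<cdot> b + u (r \<cdot> b)"
    by (subst r(2)) (simp only: act_add_poly act_mult act_X)
  then have "u a = p \<cdot> b - part False p \<cdot> b" unfolding b(2) by simp
  also have "\<dots> \<in> total T"
    by (intro subspace_diff[OF subspace_total] total_image b(1) total_component even_act homogeneous_part)
  finally show ?thesis .
qed

lemma act_subspace_total: "act.subspace (total T)"
proof (rule act_subspaceI[OF subspace_total])
  fix x assume "x \<in> total T"
  then obtain a b where ab: "a \<in> T" "b \<in> T" "x = a + p \<cdot> b" unfolding total_def by blast
  obtain c d where cd: "c \<in> T" "d \<in> T" "u b = c + p \<cdot> d" using u_total[OF ab(2)] unfolding total_def by blast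
  have "u x = u a + (p \<cdot> c + (p * p) \<cdot> d)"
    unfolding ab(3) u.add act_u[symmetric] cd(3) act_add act_mult ..
  also have "\<dots> \<in> total T"
    by (intro subspace_add[OF subspace_total] u_total ab(1) total_image cd total_component even_act even_square)
  finally show "u x \<in> total T" .
qed

lemma fin_dim_total: "fin_dim_subspace (total T)"
proof -
  interpret P: Vector_Spaces.linear scale scale "act p" by (rule act_linear)
  obtain E where E: "finite E" "T \<subseteq> span E" using nice_fin_dim unfolding fin_dim_subspace_def by blast
  have "act p ` T \<subseteq> span (act p ` E)" using E(2) P.span_image[of E] by blast
  moreover have "span E \<subseteq> span (E \<union> act p ` E)" "span (act p ` E) \<subseteq> span (E \<union> act p ` E)"
    by (intro span_mono; simp)+
  ultimately have "total T \<subseteq> span (E \<union> act p ` E)"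
    unfolding total_def using E(2) by (auto intro!: span_add)
  moreover have "finite (E \<union> act p ` E)" using E(1) by simp
  ultimately show ?thesis
    unfolding fin_dim_subspace_def using subspace_total by (intro conjI exI)
qed

text \<open>If b and u b both lie in \<open>T\<close> and b = r c, then p c is u b plus the even
  part of p applied to c, hence lies in \<open>T\<close>. Independence of \<open>T\<close> and p(T)
  forces c = 0.\<close>

lemma swap_pair_nice: "swap_pair T (u ` T)"
proof -
  have z: "u b = 0" if b: "b \<in> T" "u b \<in> T" for b
  proof -
    obtain r where r: "homogeneous False r" "p = part False p + [:0, 1:] * r" "comaximal r p"
      by (rule odd_part_factor)
    obtain c where c: "c \<in> T" "b = r \<cdot> c" by (rule even_act_surj[OF r(1,3) b(1)])
    have pc: "p \<cdot> c = part False p \<cdot> c + u (r \<cdot> c)"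
      by (subst r(2)) (simp only: act_add_poly act_mult act_X)
    have "(- (u b + part False p \<cdot> c)) + p \<cdot> c = 0" unfolding pc c(2) by simp
    moreover have "- (u b + part False p \<cdot> c) \<in> T"
      by (intro subspace_neg[OF nice_subspace] subspace_add[OF nice_subspace] b(2) even_act homogeneous_part c(1))
    ultimately have "c = 0" using nice_indep c(1) by blast
    then show ?thesis using c(2) by (simp add: u.zero)
  qed
  have "0 \<in> T" by (rule subspace_0[OF nice_subspace])
  then have "0 \<in> u ` T" using u.zero by (metis imageI)
  have "x = 0" if x: "x \<in> T" "x \<in> u ` T" for x
  proof -
    obtain b where "b \<in> T" "x = u b" using x(2) by (elim imageE)
    then show ?thesis using z x(1) by simp
  qed
  then have "T \<inter> u ` T = {0}" using \<open>0 \<in> T\<close> \<open>0 \<in> u ` T\<close> by auto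
  moreover have "u ` u ` T \<subseteq> T"
    unfolding image_image by (rule image_subsetI) (rule nice_u_u)
  ultimately show ?thesis
    unfolding swap_pair_def by (intro conjI nice_subspace u.subspace_image subset_refl)
qed

end

text \<open>A deepest vector y in the coset of \<open>x\<close> satisfies p y = a + p b with a and b
  in \<open>T\<close>, and z = y - b satisfies p z = a. The last clause of \<open>nice\<close> gives
  a = p^2 c with c in \<open>D\<close>. The vector z - p c is killed by p, so \<open>torsion\<close>
  yields w in \<open>D\<close> with p w = z and p^2 w = a. Adjoining w over the even polynomials
  captures z, and with it \<open>x\<close>, through p(T').\<close>

lemma adjoin:
  assumes T: "nice T" and x: "x \<notin> total T" "p \<cdot> x \<in> total T"
  shows "\<exists>T'. nice T' \<and> T \<subseteq> T' \<and> x \<in> total T'"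
proof -
  note sT = nice_subspace[OF T]
  note S = act_subspace_total[OF T]
  note S_add = act.subspace_add[OF S] and S_diff = act.subspace_diff[OF S] and S_scale = act.subspace_scale[OF S]
  note S_T = total_component[OF T] and S_pT = total_image[OF T]
  obtain D s where D: "D \<in> fam" and s: "s \<in> total T" and yD: "x + s \<in> D"
    and least: "\<And>E t. E \<in> fam \<Longrightarrow> t \<in> total T \<Longrightarrow> x + t \<in> E \<Longrightarrow> D \<subseteq> E"
    using least_meeting_translate[OF fin_dim_total[OF T] UNIV_in_iterated_images[of "act (p * p)"] UNIV_I[of x]] by metis
  define y where "y = x + s"
  have yD: "y \<in> D" using yD by (simp only: y_def)
  have yS: "y \<notin> total T" using S_diff[OF _ s, of y] x(1) unfolding y_def by auto
  have "p \<cdot> y \<in> total T" unfolding y_def act_add by (intro S_add x(2) S_scale s)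
  then obtain a b where ab: "a \<in> T" "b \<in> T" "p \<cdot> y = a + p \<cdot> b" unfolding total_def by blast
  have abD: "a \<in> D" "b \<in> D" using nice_component[OF T D ab(1,2)] fam_scale[OF D yD, of p] ab(3) by auto
  define z where "z = y - b"
  have zD: "z \<in> D" unfolding z_def by (rule fam_diff[OF D yD abD(2)])
  have zS: "z \<notin> total T" using S_add[OF _ S_T[OF ab(2)], of z] yS unfolding z_def by auto
  have pz: "p \<cdot> z = a" unfolding z_def act.scale_right_diff_distrib ab(3) by simp
  then have "a \<in> act p ` D" using zD by blast
  then obtain c where c: "c \<in> D" "a = (p * p) \<cdot> c" using nice_image[OF T D ab(1)] by blast
  have "p \<cdot> (z - p \<cdot> c) = 0" unfolding act.scale_right_diff_distrib pz c(2) act_mult by simp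
  moreover have "z - p \<cdot> c \<in> D" by (rule fam_diff[OF D zD fam_scale[OF D c(1)]])
  ultimately obtain d where d: "d \<in> D" "z - p \<cdot> c = p \<cdot> d" using torsion[OF D] by blast
  define w where "w = c + d"
  have wD: "w \<in> D" unfolding w_def by (rule fam_add[OF D c(1) d(1)])
  have pw: "p \<cdot> w = z" unfolding w_def act_add d(2)[symmetric] by simp
  have qw: "(p * p) \<cdot> w = a" unfolding act_mult pw pz ..
  have wP: "w \<in> primary p"
    using nice_primary[OF T ab(1)] unfolding pz[symmetric] pw[symmetric]
    by (rule primary_lift[OF primary_lift])
  \<comment> \<open>Every ideal that properly contains the one generated by p^2 contains
    \<open>p\<close>.\<close>
  have bezout: "\<exists>k l. k * h + l * (p * p) = p" if h: "\<not> p * p dvd h" for h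
  proof (cases "p dvd h")
    case True
    then obtain g where g: "h = p * g" by (elim dvdE)
    have "\<not> p dvd g" using h unfolding g by (metis dvd_refl mult_dvd_mono)
    then obtain k l where kl: "k * g + l * p = 1"
      using irreducible_comaximal[OF irr] unfolding comaximal_def by metis
    have "k * h + l * (p * p) = p * (k * g + l * p)"
      unfolding g by (simp add: algebra_simps)
    then have "k * h + l * (p * p) = p" unfolding kl by simp
    then show ?thesis by blast
  next
    case False
    then obtain k l where kl: "k * h + l * (p * p) = 1"
      using comaximal_square[OF irreducible_comaximal[OF irr]] unfolding comaximal_def by metis
    have "(p * k) * h + (p * l) * (p * p) = p * (k * h + l * (p * p))"
      by (simp add: algebra_simps)
    then have "(p * k) * h + (p * l) * (p * p) = p" unfolding kl by simp
    then show ?thesis by blast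
  qed
  \<comment> \<open>As \<open>z\<close> is \<open>p \<cdot> w\<close>, it can be recovered modulo
    \<open>total T\<close> from any vector whose coefficient at \<open>w\<close> is not divisible by
    \<open>p * p\<close>.\<close>
  have z_rep: "\<exists>t\<in>total T. \<exists>k. z + t = k \<cdot> (v + h \<cdot> w)" if h: "\<not> p * p dvd h" and v: "v \<in> total T" for h v
  proof -
    obtain k l where kl: "k * h + l * (p * p) = p" using bezout[OF h] by blast
    have "z = (k * h + l * (p * p)) \<cdot> w" unfolding kl pw ..
    also have "\<dots> = k \<cdot> h \<cdot> w + l \<cdot> a" by (simp only: act_add_poly act_mult[of k] act_mult[of l] qw)
    finally have "z + (k \<cdot> v - l \<cdot> a) = k \<cdot> (v + h \<cdot> w)" unfolding act_add by simp
    then show ?thesis using S_diff[OF S_scale[OF v] S_scale[OF S_T[OF ab(1)]]] by blast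
  qed
  have dvd: "p * p dvd h" if "h \<cdot> w \<in> total T" for h
  proof (rule ccontr)
    assume "\<not> p * p dvd h"
    then obtain t k where t: "t \<in> total T" "z + t = k \<cdot> (0 + h \<cdot> w)"
      using z_rep act.subspace_0[OF S] by blast
    then have "z = k \<cdot> h \<cdot> w - t" by (simp add: eq_diff_eq)
    also have "\<dots> \<in> total T" by (intro S_diff S_scale that t(1))
    finally show False using zS by blast
  qed
  have collapse: "f \<cdot> w \<in> T" if f: "homogeneous False f" "p * p dvd f" for f
  proof -
    obtain g where g: "f = (p * p) * g" using f(2) by (elim dvdE)
    have "f = part False f"
      using part_homogeneous[OF f(1), of False] by simp
    also have "\<dots> = part False ((p * p) * g)" unfolding g ..
    also have "\<dots> = (p * p) * part (False \<noteq> False) g"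
      by (rule part_mult_homogeneous[OF even_square])
    finally have "f = (p * p) * part False g" by simp
    then have "f \<cdot> w = part False g \<cdot> a" unfolding qw[symmetric] by (metis act_mult mult.commute)
    then show ?thesis using even_act[OF T homogeneous_part ab(1)] by simp
  qed
  \<comment> \<open>The cosets of \<open>z\<close> and \<open>x\<close> modulo
    \<open>total T\<close> coincide, so \<open>D\<close> is least for \<open>z\<close> as
    well.\<close>
  have D_least: "D \<subseteq> E" if E: "E \<in> fam" "t \<in> total T" "z + t \<in> E" for E t
  proof (rule least[OF E(1)])
    show "s + (t - b) \<in> total T" by (intro S_add s S_diff E(2) S_T ab(2))
    have "x + (s + (t - b)) = z + t" unfolding z_def y_def by simp
    then show "x + (s + (t - b)) \<in> E" using E(3) by (simp only:)
  qed
  define T' where "T' = {t + f \<cdot> w | t f. t \<in> T \<and> homogeneous False f}"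
  have T'I: "t + f \<cdot> w \<in> T'" if "t \<in> T" "homogeneous False f" for t f
    unfolding T'_def using that by blast
  have T'E: "\<exists>t f. v = t + f \<cdot> w \<and> t \<in> T \<and> homogeneous False f" if "v \<in> T'" for v
    using that unfolding T'_def by simp
  have "p \<noteq> 0" "T \<subseteq> primary p" using irr nice_primary[OF T] by auto
  then have ext: "fin_dim_subspace T'" "T' \<subseteq> primary p" and sub: "T \<subseteq> T'"
    unfolding T'_def using fin_dim_adjoin_homogeneous[OF nice_fin_dim[OF T] _ _ wP] by blast+
  have "0 + 1 \<cdot> w \<in> T'" by (rule T'I[OF subspace_0[OF sT] homogeneous_1])
  then have wT': "w \<in> T'" by (simp only: act_1 add_0_left)
  have "nice T'"
    unfolding nice_def
  proof (intro conjI ballI impI)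
    show "fin_dim_subspace T'" "T' \<subseteq> primary p" by (rule ext)+
  next
    fix v assume "v \<in> T'"
    then obtain t f where *: "v = t + f \<cdot> w" "t \<in> T" "homogeneous False f" using T'E by blast
    have X: "homogeneous True [:0, 1 :: 'f:]"
      unfolding homogeneous_def by (auto simp: coeff_pCons split: nat.splits)
    have "u (u v) = u (u t) + ([:0, 1:] * ([:0, 1:] * f)) \<cdot> w" by (simp only: * u.add act_mult act_X)
    moreover have "homogeneous False ([:0, 1:] * ([:0, 1:] * f))"
      using homogeneous_mult[OF X homogeneous_mult[OF X *(3)]] by simp
    ultimately show "u (u v) \<in> T'" using T'I[OF nice_u_u[OF T *(2)]] by simp
  next
    fix v v' assume v: "v \<in> T'" "v' \<in> T'"
    obtain t f t' f' where *: "v = t + f \<cdot> w" "t \<in> T" "homogeneous False f"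
        "v' = t' + f' \<cdot> w" "t' \<in> T" "homogeneous False f'" using T'E[OF v(1)] T'E[OF v(2)] by blast
    have tS: "t + p \<cdot> t' \<in> total T" by (intro S_add S_T S_pT *)
    have sum: "v + p \<cdot> v' = (t + p \<cdot> t') + (f + p * f') \<cdot> w"
      unfolding *(1,4) act_add act_add_poly act_mult by (simp only: add_ac)
    have inT: "v \<in> T \<and> v' \<in> T" if "p * p dvd f + p * f'"
      using even_dvd_split[OF *(3,6) that] collapse[OF *(3)] collapse[OF *(6)] subspace_add[OF sT] *(1,2,4,5)
      by blast
    {
      assume vv: "v + p \<cdot> v' = 0"
      have "(f + p * f') \<cdot> w = - (t + p \<cdot> t')"
        using vv unfolding sum by (simp only: add_eq_0_iff)
      also have "\<dots> \<in> total T" by (rule act.subspace_neg[OF S tS])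
      finally have "v \<in> T \<and> v' \<in> T" by (intro inT dvd)
      then show "v = 0" "v' = 0" using nice_indep[OF T _ _ vv] by blast+
    next
      fix C assume C: "C \<in> fam" and vv: "v + p \<cdot> v' \<in> C"
      have "v \<in> C \<and> v' \<in> C"
      proof (cases "p * p dvd f + p * f'")
        case True
        then show ?thesis using inT nice_component[OF T C _ _ vv] by blast
      next
        case False
        then obtain r k where r: "r \<in> total T" "z + r = k \<cdot> (v + p \<cdot> v')"
          using z_rep[OF _ tS] unfolding sum by blast
        have "z + r \<in> C" unfolding r(2) by (rule fam_scale[OF C vv])
        then have wC: "w \<in> C" using D_least[OF C r(1)] wD by blast
        have "t + p \<cdot> t' = (v + p \<cdot> v') - (f + p * f') \<cdot> w" unfolding sum by simp
        also have "\<dots> \<in> C" by (intro fam_diff[OF C vv] fam_scale[OF C wC])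
        finally have "t \<in> C" "t' \<in> C" using nice_component[OF T C *(2,5)] by blast+
        then show ?thesis unfolding *(1,4) using fam_add[OF C] fam_scale[OF C wC] by blast
      qed
      then show "v \<in> C" "v' \<in> C" by blast+
    }
  next
    fix C v assume C: "C \<in> fam" and vT: "v \<in> T'" and vC: "v \<in> act p ` C"
    obtain t f where *: "v = t + f \<cdot> w" "t \<in> T" "homogeneous False f" using T'E[OF vT] by blast
    note qC = iterated_images.image[OF C]
    have C': "act.subspace C" by (rule act_subspace_iterated_images[OF C])
    have pC: "act.subspace (act p ` C)" by (rule act_subspace_image[OF C'])
    have qpC: "act (p * p) ` C \<subseteq> act p ` C"
    proof (rule image_subsetI)
      fix x' assume "x' \<in> C"
      then have "p \<cdot> x' \<in> C" by (rule fam_scale[OF C])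
      then show "(p * p) \<cdot> x' \<in> act p ` C" unfolding act_mult by (rule imageI)
    qed
    show "v \<in> act (p * p) ` C"
    proof (cases "p dvd f")
      case True
      then have "v \<in> T"
        unfolding *(1) by (intro subspace_add[OF sT] *(2) collapse *(3) even_dvd_square)
      then show ?thesis by (rule nice_image[OF T C _ vC])
    next
      case False
      then obtain k l where kl: "homogeneous False k" "homogeneous False l" "k * f + l * (p * p) = 1"
        using comaximal_homogeneous_even[OF *(3) even_square comaximal_square[OF irreducible_comaximal[OF irr]]] by metis
      define r where "r = k \<cdot> t - l \<cdot> a"
      have rT: "r \<in> T" unfolding r_def by (intro subspace_diff[OF sT] even_act[OF T] kl *(2) ab(1))
      have "w = (k * f + l * (p * p)) \<cdot> w" unfolding kl(3) by (rule act_1[symmetric])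
      also have "\<dots> = k \<cdot> f \<cdot> w + l \<cdot> a" by (simp only: act_add_poly act_mult[of k] act_mult[of l] qw)
      finally have "w + r = k \<cdot> v" unfolding r_def *(1) act_add by (simp add: algebra_simps)
      \<comment> \<open>One more application of p turns this translate of \<open>w\<close> in p(C)
        into a translate of \<open>z\<close> in p^2(C). So \<open>D\<close>, and \<open>w\<close>
        with it, lies in p^2(C).\<close>
      then have "w + r \<in> act p ` C" using act.subspace_scale[OF pC vC] by simp
      then have "p \<cdot> (w + r) \<in> act p ` act p ` C" by (rule imageI)
      also have "act p ` act p ` C = act (p * p) ` C" by (simp only: image_image act_square)
      finally have "z + p \<cdot> r \<in> act (p * p) ` C" unfolding act_add pw .
      then have "D \<subseteq> act (p * p) ` C" by (rule D_least[OF qC S_pT[OF rT]])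
      then have fw: "f \<cdot> w \<in> act (p * p) ` C" using wD by (intro fam_scale[OF qC]) blast
      have "t = v - f \<cdot> w" unfolding *(1) by simp
      also have "\<dots> \<in> act p ` C" using fw qpC by (intro act.subspace_diff[OF pC vC]) blast
      finally have "t \<in> act (p * p) ` C" by (rule nice_image[OF T C *(2)])
      then show ?thesis unfolding *(1) by (rule fam_add[OF qC _ fw])
    qed
  qed
  moreover have "x \<in> total T'"
  proof -
    note n' = \<open>nice T'\<close>
    have "total T \<subseteq> total T'" unfolding total_def using sub by blast
    then have "s \<in> total T'" "b \<in> total T'" using s S_T[OF ab(2)] by blast+
    moreover have "x = p \<cdot> w + b - s" unfolding pw z_def y_def by simp
    ultimately show ?thesis
      using act.subspace_diff[OF act_subspace_total[OF n']] act.subspace_add[OF act_subspace_total[OF n']]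
        total_image[OF n' wT'] by simp
  qed
  ultimately show ?thesis using sub by blast
qed

lemma reach_primary:
  "nice T \<Longrightarrow> p ^ n \<cdot> x = 0 \<Longrightarrow> \<exists>T'. nice T' \<and> T \<subseteq> T' \<and> x \<in> total T'"
proof (induction n arbitrary: x)
  case 0
  then have "x = 0" by (simp add: act_1)
  then show ?case using act.subspace_0[OF act_subspace_total[OF 0(1)]] 0(1) by blast
next
  case (Suc n)
  have "p ^ n \<cdot> p \<cdot> x = 0" using Suc.prems(2) by (simp only: power_Suc2 act_mult)
  then obtain T1 where T1: "nice T1" "T \<subseteq> T1" "p \<cdot> x \<in> total T1"
    using Suc.IH[OF Suc.prems(1)] by blast
  show ?case
  proof (cases "x \<in> total T1")
    case True
    then show ?thesis using T1 by blast
  next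
    case False
    then show ?thesis using adjoin[OF T1(1) _ T1(3)] T1(2) by blast
  qed
qed

lemma mixed_swap_split:
  assumes "countable_dim scale"
  shows "swap_split (primary p)"
proof (rule exhaust_swap_split[where P = "\<lambda>A B. nice A \<and> B = u ` A", OF assms subspace_primary])
  have "0 \<in> act (p * p) ` C" if "C \<in> fam" for C
    by (rule subspace_0[OF subspace_iterated_images[OF iterated_images.image[OF that]]])
  then have "nice {0}"
    unfolding nice_def fin_dim_subspace_def
    using subspace_0[OF subspace_primary[of p]] by (auto simp: u.zero intro: exI[of _ "{}"])
  then show "nice {0} \<and> {0} = u ` {0}" by (simp add: u.zero)
next
  fix A B assume n: "nice A \<and> B = u ` A"
  have "u ` A \<subseteq> primary p"
    using nice_primary n act_subspace_u[OF act_subspace_primary] by blast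
  then show "swap_pair A B \<and> A \<subseteq> primary p \<and> B \<subseteq> primary p"
    using n swap_pair_nice nice_primary by blast
  fix x assume "x \<in> primary p"
  then obtain m where "p ^ m \<cdot> x = 0" unfolding primary_def by blast
  then obtain T where T: "nice T" "A \<subseteq> T" "x \<in> total T" using reach_primary n by blast
  obtain a b where ab: "a \<in> T" "b \<in> T" "x = a + p \<cdot> b" using T(3) unfolding total_def by blast
  obtain r where r: "homogeneous False r" "p = part False p + [:0, 1:] * r"
    by (rule odd_part_factor)
  \<comment> \<open>Passes from \<open>T\<close> plus p(T) back to \<open>T\<close> plus
    u(T).\<close>
  have "p \<cdot> b = part False p \<cdot> b + u (r \<cdot> b)"
    by (subst r(2)) (simp only: act_add_poly act_mult act_X)
  then have "x = (a + part False p \<cdot> b) + u (r \<cdot> b)" unfolding ab(3) by (simp only: add.assoc)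
  moreover have "a + part False p \<cdot> b \<in> T"
    by (intro subspace_add[OF nice_subspace[OF T(1)]] ab even_act[OF T(1)] homogeneous_part)
  moreover have "u (r \<cdot> b) \<in> u ` T" by (intro imageI even_act[OF T(1) r(1)] ab(2))
  ultimately have "\<exists>a\<in>T. \<exists>b\<in>u ` T. x = a + b" by blast
  then show "\<exists>A' B'. (nice A' \<and> B' = u ` A') \<and> A \<subseteq> A' \<and> B \<subseteq> B' \<and> (\<exists>a\<in>A'. \<exists>b\<in>B'. x = a + b)"
    using T(1,2) n by (intro exI[of _ T] exI[of _ "u ` T"]) blast
qed

end

theorem theorem5p2:
  fixes scale :: "'f::field \<Rightarrow> 'v::ab_group_add \<Rightarrow> 'v" and u :: "'v \<Rightarrow> 'v"
  assumes "CHAR('f) = 2"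
    and "Vector_Spaces.vector_space scale"
    and "countable_dim scale"
    and "Vector_Spaces.linear scale scale u"
    and "locally_finite_end scale u"
  shows "(sum_of_two_square_zero scale u \<longleftrightarrow> exchange_property scale u) \<and>
         (exchange_property scale u \<longleftrightarrow>
            (\<forall>p \<in> Irr - {monom 1 1}. \<not> even_poly p \<longrightarrow>
               (\<forall>\<alpha> :: 'o::infinite rel. Well_order \<alpha> \<and> even_ordinal \<alpha> \<longrightarrow>
                  kaplansky_invariant scale \<alpha> u p =o (czero :: 'v set rel))))"
proof -
  interpret endomorphism scale u
    by (rule endomorphism.intro[OF assms(2) endomorphism_axioms.intro[OF assms(4)]])
  let ?iii = "\<forall>p \<in> Irr - {monom 1 1}. \<not> even_poly p \<longrightarrow>
      (\<forall>\<alpha> :: 'o rel. Well_order \<alpha> \<and> even_ordinal \<alpha> \<longrightarrow>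
        kaplansky_invariant scale \<alpha> u p =o (czero :: 'v set rel))"
  have sum_imp: ?iii if sum: "sum_of_two_square_zero scale u"
  proof (intro ballI impI allI, elim conjE)
    fix p :: "'f poly" and \<alpha> :: "'o rel"
    assume p: "p \<in> Irr - {monom 1 1}" "\<not> even_poly p" and \<alpha>: "Well_order \<alpha>" "even_ordinal \<alpha>"
    have irr: "irreducible p" using p(1) by (simp add: Irr_def)
    have "transfinite_image (act p) \<alpha> \<in> iterated_images (act (p * p))"
      by (rule even_transfinite_image[OF act_square \<alpha>])
    then show "kaplansky_invariant scale \<alpha> u p =o (czero :: 'v set rel)"
      unfolding kaplansky_invariant_eq_czero_iff[OF irr \<alpha>(1)]
      using sum_imp_torsion_condition[OF assms(1) sum p] by (intro ballI impI)
  qed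
  have imp_exchange: "exchange_property scale u" if iii: ?iii
  proof (rule exchange_from_primary[OF assms(5)])
    fix p :: "'f poly"
    assume p: "p \<in> Irr"
    have irr: "irreducible p" using p by (simp add: Irr_def)
    show "swap_split (primary p)"
    \<comment> \<open>Condition (iii) says nothing about even p or p = t. Both are homogeneous, and
      their components always split.\<close>
    proof (cases "homogeneous False p \<or> homogeneous True p")
      case True
      then obtain \<pi> where "homogeneous \<pi> p" by blast
      then interpret homogeneous_prime scale u p \<pi>
        by unfold_locales (rule irr)
      show ?thesis by (rule homogeneous_swap_split[OF assms(3)])
    next
      case False
      have "homogeneous True (monom (1 :: 'f) 1)" unfolding homogeneous_def by simp
      then have p': "p \<in> Irr - {monom 1 1}" using p False by blast
      have odd: "\<not> even_poly p" using False by (simp add: even_poly_iff_homogeneous)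
      \<comment> \<open>For a fixed \<open>C\<close> the inclusion is immediate. Any other
        \<open>C\<close> is attained at an even ordinal, because no repetition in the chain above it
        disturbs the parity.\<close>
      have tor: "x \<in> act p ` C" if C: "C \<in> iterated_images (act (p * p))" and x: "x \<in> C" "p \<cdot> x = 0" for C x
      proof (cases "act p ` C = C")
        case True
        then show ?thesis using x(1) by (simp only:)
      next
        case nonfixed: False
        have "countable (above (act p) C)"
          by (rule countable_above[OF assms(3) square_iterated_images[OF act_square C]])
        from square_iterated_image_eq_even_transfinite_image[OF act_square nonfixed C this]
        obtain \<alpha> :: "'o rel" where \<alpha>: "Well_order \<alpha>" "even_ordinal \<alpha>" "transfinite_image (act p) \<alpha> = C"
          by metis
        have "kaplansky_invariant scale \<alpha> u p =o (czero :: 'v set rel)"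
          using iii p' odd \<alpha>(1,2) by blast
        then show ?thesis
          unfolding kaplansky_invariant_eq_czero_iff[OF irr \<alpha>(1)] \<alpha>(3) using x by blast
      qed
      have nh: "\<not> homogeneous False p" using False by blast
      interpret mixed_prime scale u p
        by unfold_locales (fact assms(1), fact p', fact nh, rule tor)
      show ?thesis by (rule mixed_swap_split[OF assms(3)])
    qed
  qed
  show ?thesis
    using exchange_imp_sum sum_imp imp_exchange by blast
qed

end
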